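(* Let $p$ be a prime and let $\mathcal{F}=\{F_1,\dots,F_n\}$ with $F_i(x)=(-1)^{b_i}p^{k_i}x+d_i$, where $b_i\in\{0,1\}$, $k_i\in\mathbb{Z}$, $k_i\ge 1$ and $d_i\in\mathbb{Z}_p\cap\mathbb{Q}$. Let $K$ be the $p$-adic self-similar set of $\mathcal{F}$. Then the rewriting of the elements \[ \sum_{j=1}^\infty (-1)^{\sum_{i=1}^{j-1} b_{a_i}}\, p^{\sum_{i=1}^{j-1} k_{a_i}}\, d_{a_j},\qquad (a_j)\in\{1,\dots,n\}^{\mathbb{N}}, \] of $K$ into their standard $p$-adic expansions $\sum_{i\ge0} c_i p^i$ with $c_i\in\{0,\dots,p-1\}$ is realized by a finite state transducer (reading the address $(a_j)$ and outputting the digit sequence $(c_i)$). In particular, the set of $p$-adic expansions of the elements of $K$ is recognized by a finite state automaton, and thus the Hausdorff dimension of $K$ is computable.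
   Context: $\mathbb{Q}_p$ is the field of $p$-adic numbers, $\mathbb{Z}_p$ the $p$-adic integers; every element of $\mathbb{Z}_p$ has a unique expansion $\sum_{i\ge0}c_ip^i$ with $c_i\in\{0,\dots,p-1\}$. The $p$-adic self-similar set (attractor) of $\mathcal{F}$ is the unique non-empty compact $K\subseteq\mathbb{Q}_p$ with $K=\bigcup_i F_i(K)$. A finite state transducer is a finite directed graph with an initial state, each transition labelled by an input symbol and an output (finite) word; reading an infinite input word along a path produces the concatenation of outputs. A finite automaton (all states accepting) recognizes a set of infinite words if these are exactly the labels of infinite paths starting at the initial state. Hausdorff dimension in $\mathbb{Q}_p$ is taken with respect to the metric $|x-y|_p$. *)

theory Defs
  imports
    "HOL-Analysis.Analysis"
    "HOL-Algebra.Ring"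
    "HOL-Library.Nat_Bijection"
    "HOL-Computational_Algebra.Primes"
begin

section \<open>The field of p-adic numbers\<close>

text \<open>The prime is a term rather than a type parameter, because the computability statement
  quantifies over it. The field is the completion of the rationals for the p-adic absolute
  value: Cauchy sequences of rationals modulo null sequences.\<close>

definition padic_abs :: "nat \<Rightarrow> rat \<Rightarrow> real" where
  "padic_abs p q =
     (if q = 0 then 0
      else real p powi (int (multiplicity (int p) (snd (quotient_of q)))
                        - int (multiplicity (int p) (fst (quotient_of q)))))"

definition padic_cauchy :: "nat \<Rightarrow> (nat \<Rightarrow> rat) set" where
  "padic_cauchy p =
     {x. \<forall>e>0. \<exists>N. \<forall>m\<ge>N. \<forall>n\<ge>N. padic_abs p (x m - x n) < e}"

definition padic_rel :: "nat \<Rightarrow> ((nat \<Rightarrow> rat) \<times> (nat \<Rightarrow> rat)) set" where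
  "padic_rel p =
     {(x, y). x \<in> padic_cauchy p \<and> y \<in> padic_cauchy p \<and>
              (\<lambda>n. padic_abs p (x n - y n)) \<longlonglongrightarrow> 0}"

definition padic_of_rat :: "nat \<Rightarrow> rat \<Rightarrow> (nat \<Rightarrow> rat) set" where
  "padic_of_rat p q = padic_rel p `` {\<lambda>_. q}"

definition Qp :: "nat \<Rightarrow> (nat \<Rightarrow> rat) set ring" where
  "Qp p =
     \<lparr> carrier = padic_cauchy p // padic_rel p,
       mult = (\<lambda>X Y. \<Union>x\<in>X. \<Union>y\<in>Y. padic_rel p `` {\<lambda>n. x n * y n}),
       one = padic_of_rat p 1,
       zero = padic_of_rat p 0,
       add = (\<lambda>X Y. \<Union>x\<in>X. \<Union>y\<in>Y. padic_rel p `` {\<lambda>n. x n + y n}) \<rparr>"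

text \<open>The absolute value of a class is the common limit of the absolute values along its
  representatives.\<close>

definition padic_norm :: "nat \<Rightarrow> (nat \<Rightarrow> rat) set \<Rightarrow> real" where
  "padic_norm p X = (THE r. \<forall>x\<in>X. (\<lambda>n. padic_abs p (x n)) \<longlonglongrightarrow> r)"

definition padic_dist :: "nat \<Rightarrow> (nat \<Rightarrow> rat) set \<Rightarrow> (nat \<Rightarrow> rat) set \<Rightarrow> real" where
  "padic_dist p X Y =
     (if X \<in> carrier (Qp p) \<and> Y \<in> carrier (Qp p) then padic_norm p (X \<ominus>\<^bsub>Qp p\<^esub> Y) else 0)"

definition padic_topology :: "nat \<Rightarrow> (nat \<Rightarrow> rat) set topology" where
  "padic_topology p = Metric_space.mtopology (carrier (Qp p)) (padic_dist p)"

definition Zp :: "nat \<Rightarrow> (nat \<Rightarrow> rat) set set" where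
  "Zp p = {X \<in> carrier (Qp p). padic_norm p X \<le> 1}"

definition padic_expansion :: "nat \<Rightarrow> (nat \<Rightarrow> nat) \<Rightarrow> (nat \<Rightarrow> rat) set \<Rightarrow> bool" where
  "padic_expansion p c X \<longleftrightarrow>
     (\<forall>i. c i \<in> {0..<p}) \<and>
     limitin (padic_topology p)
       (\<lambda>N. padic_of_rat p (\<Sum>i<N. of_nat (c i) * of_nat p ^ i)) X sequentially"

section \<open>The p-adic distance is a metric\<close>

text \<open>The topology of a metric in the library is only meaningful for a function satisfying the
  axioms of a metric, some of which are required outside the carrier as well. This is why the
  distance is set to 0 there.\<close>

lemma padic_abs_Fract:
  assumes p: "prime p" and "a \<noteq> 0" "b \<noteq> 0"
  shows "padic_abs p (Fract a b) = real p powi (int (multiplicity (int p) b) - int (multiplicity (int p) a))"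
proof -
  obtain c d where cd: "quotient_of (Fract a b) = (c, d)" by (cases "quotient_of (Fract a b)")
  have d: "d > 0" using cd by (simp add: quotient_of_denom_pos)
  have eq: "Fract a b = Fract c d" using cd quotient_of_Fract
    by (metis Fract_of_int_quotient quotient_of_div)
  hence e: "a * d = c * b" using assms d by (simp add: eq_rat)
  have c: "c \<noteq> 0" using e assms d by auto
  have pp: "prime_elem (int p)" using p by auto
  have "multiplicity (int p) a + multiplicity (int p) d = multiplicity (int p) c + multiplicity (int p) b"
    using e assms c d pp prime_elem_multiplicity_mult_distrib
    by (metis less_int_code(1))
  hence "int (multiplicity (int p) d) - int (multiplicity (int p) c) = int (multiplicity (int p) b) - int (multiplicity (int p) a)"
    by linarith
  moreover have "Fract a b \<noteq> 0" using assms by (simp add: Zero_rat_def eq_rat)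
  ultimately show ?thesis by (simp add: padic_abs_def cd)
qed

lemma padic_abs_nonneg: "0 \<le> padic_abs p x"
  by (simp add: padic_abs_def)

lemma padic_abs_0 [simp]: "padic_abs p 0 = 0"
  by (simp add: padic_abs_def)

lemma padic_abs_add:
  assumes p: "prime p"
  shows "padic_abs p (x + y) \<le> max (padic_abs p x) (padic_abs p y)"
proof (cases "x = 0 \<or> y = 0 \<or> x + y = 0")
  case True
  thus ?thesis using padic_abs_nonneg[of p x] padic_abs_nonneg[of p y] by auto
next
  case False
  obtain a b where x: "x = Fract a b" "b > 0" by (cases x) auto
  obtain c d where y: "y = Fract c d" "d > 0" by (cases y) auto
  have a: "a \<noteq> 0" "c \<noteq> 0" using False x y by (auto simp: rat_number_collapse)
  have x': "x = Fract (a * d) (b * d)" and y': "y = Fract (c * b) (b * d)"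
    using x y by (auto simp: eq_rat)
  have xy: "x + y = Fract (a * d + c * b) (b * d)" using x y by simp
  hence nz: "a * d + c * b \<noteq> 0" using False by (auto simp: rat_number_collapse)
  let ?m = "\<lambda>z. int (multiplicity (int p) z)"
  have "min (multiplicity (int p) (a * d)) (multiplicity (int p) (c * b)) \<le> multiplicity (int p) (a * d + c * b)"
  proof (rule multiplicity_geI)
    show "int p ^ min (multiplicity (int p) (a * d)) (multiplicity (int p) (c * b)) dvd a * d + c * b"
      by (rule dvd_add; rule multiplicity_dvd'; simp)
  qed (use p nz in auto)
  hence le: "min (?m (a * d)) (?m (c * b)) \<le> ?m (a * d + c * b)" by linarith
  have p1: "1 \<le> real p" using p prime_gt_1_nat[of p] by simp
  have "real p powi (?m (b * d) - ?m (a * d + c * b)) \<le>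
        max (real p powi (?m (b * d) - ?m (a * d))) (real p powi (?m (b * d) - ?m (c * b)))"
  proof (cases "?m (a * d) \<le> ?m (c * b)")
    case True
    hence "real p powi (?m (b * d) - ?m (a * d + c * b)) \<le> real p powi (?m (b * d) - ?m (a * d))"
      using le p1 by (intro power_int_increasing) linarith+
    thus ?thesis by linarith
  next
    case False
    hence "real p powi (?m (b * d) - ?m (a * d + c * b)) \<le> real p powi (?m (b * d) - ?m (c * b))"
      using le p1 by (intro power_int_increasing) linarith+
    thus ?thesis by linarith
  qed
  thus ?thesis using xy x' y' p nz a x y by (simp add: padic_abs_Fract)
qed

lemma padic_abs_mult:
  assumes p: "prime p"
  shows "padic_abs p (x * y) = padic_abs p x * padic_abs p y"
proof (cases "x = 0 \<or> y = 0")
  case False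
  obtain a b where x: "x = Fract a b" "b > 0" by (cases x) auto
  obtain c d where y: "y = Fract c d" "d > 0" by (cases y) auto
  have a: "a \<noteq> 0" "c \<noteq> 0" using False x y by (auto simp: rat_number_collapse)
  have pp: "prime_elem (int p)" using p by auto
  have "real p \<noteq> 0" using p by auto
  thus ?thesis using x y a p pp
    by (simp add: padic_abs_Fract prime_elem_multiplicity_mult_distrib flip: power_int_add)
      (simp add: algebra_simps)
qed auto


lemma padic_abs_minus:
  assumes p: "prime p"
  shows "padic_abs p (- x) = padic_abs p x"
proof -
  have "padic_abs p (- 1) * padic_abs p (- 1) = padic_abs p 1"
    using padic_abs_mult[OF p, of "-1" "-1"] by simp
  also have "padic_abs p 1 = 1" by (simp add: padic_abs_def)
  finally have "padic_abs p (- 1) = 1"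
    using padic_abs_nonneg[of p "-1"] square_eq_1_iff[of "padic_abs p (- 1)"] by linarith
  thus ?thesis using padic_abs_mult[OF p, of "-1" x] by simp
qed

lemma padic_abs_eq_0:
  assumes p: "prime p"
  shows "padic_abs p x = 0 \<longleftrightarrow> x = 0"
  using p by (auto simp: padic_abs_def)

lemma padic_abs_triangle:
  assumes p: "prime p"
  shows "padic_abs p (x + y) \<le> padic_abs p x + padic_abs p y"
  using padic_abs_add[OF p, of x y] padic_abs_nonneg[of p x] padic_abs_nonneg[of p y] by linarith

lemma padic_abs_sub:
  assumes p: "prime p"
  shows "\<bar>padic_abs p x - padic_abs p y\<bar> \<le> padic_abs p (x - y)"
  using padic_abs_triangle[OF p, of "x - y" y] padic_abs_triangle[OF p, of "y - x" x]
    padic_abs_minus[OF p, of "x - y"] by simp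

context
  fixes p :: nat
  assumes p: "prime p"
begin

lemma padic_cauchy_add:
  assumes "x \<in> padic_cauchy p" "y \<in> padic_cauchy p"
  shows "(\<lambda>n. x n + y n) \<in> padic_cauchy p"
  unfolding padic_cauchy_def
proof (clarify)
  fix e :: real assume e: "e > 0"
  obtain N where N: "\<And>m n. m \<ge> N \<Longrightarrow> n \<ge> N \<Longrightarrow> padic_abs p (x m - x n) < e"
    using assms(1) e unfolding padic_cauchy_def by blast
  obtain N' where N': "\<And>m n. m \<ge> N' \<Longrightarrow> n \<ge> N' \<Longrightarrow> padic_abs p (y m - y n) < e"
    using assms(2) e unfolding padic_cauchy_def by blast
  have "padic_abs p (x m + y m - (x n + y n)) < e" if "m \<ge> max N N'" "n \<ge> max N N'" for m n
  proof -
    have "padic_abs p (x m - x n) < e" "padic_abs p (y m - y n) < e" using N N' that by auto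
    moreover have "x m + y m - (x n + y n) = (x m - x n) + (y m - y n)" by simp
    ultimately show ?thesis using padic_abs_add[OF p, of "x m - x n" "y m - y n"]
      by (metis max_less_iff_conj order_le_less_trans)
  qed
  thus "\<exists>N. \<forall>m\<ge>N. \<forall>n\<ge>N. padic_abs p (x m + y m - (x n + y n)) < e" by blast
qed

lemma padic_cauchy_minus:
  assumes "x \<in> padic_cauchy p"
  shows "(\<lambda>n. - x n) \<in> padic_cauchy p"
proof -
  have "padic_abs p (- x m - - x n) = padic_abs p (x m - x n)" for m n
    using padic_abs_minus[OF p, of "x m - x n"] by simp
  thus ?thesis using assms by (simp add: padic_cauchy_def)
qed

lemma padic_cauchy_const: "(\<lambda>_. q) \<in> padic_cauchy p"
  by (auto simp: padic_cauchy_def)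

lemma padic_cauchy_convergent:
  assumes "x \<in> padic_cauchy p"
  shows "convergent (\<lambda>n. padic_abs p (x n))"
proof -
  have "Cauchy (\<lambda>n. padic_abs p (x n))"
  proof (rule CauchyI)
    fix e :: real assume "e > 0"
    then obtain N where "\<And>m n. m \<ge> N \<Longrightarrow> n \<ge> N \<Longrightarrow> padic_abs p (x m - x n) < e"
      using assms unfolding padic_cauchy_def by blast
    thus "\<exists>N. \<forall>m\<ge>N. \<forall>n\<ge>N. norm (padic_abs p (x m) - padic_abs p (x n)) < e"
      using order_le_less_trans[OF padic_abs_sub[OF p]] by (metis real_norm_def)
  qed
  thus ?thesis by (simp add: Cauchy_convergent_iff)
qed

lemma padic_null_add:
  assumes "(\<lambda>n. padic_abs p (x n)) \<longlonglongrightarrow> 0" "(\<lambda>n. padic_abs p (y n)) \<longlonglongrightarrow> 0"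
  shows "(\<lambda>n. padic_abs p (x n + y n)) \<longlonglongrightarrow> 0"
  by (rule Lim_null_comparison[OF _ tendsto_add_zero[OF assms]])
    (simp add: padic_abs_nonneg padic_abs_triangle[OF p])

lemma padic_rel_equiv: "equiv (padic_cauchy p) (padic_rel p)"
proof (rule equivI)
  show "padic_rel p \<subseteq> padic_cauchy p \<times> padic_cauchy p" by (auto simp: padic_rel_def)
  show "refl_on (padic_cauchy p) (padic_rel p)" by (auto simp: refl_on_def padic_rel_def)
  have "padic_abs p (x n - y n) = padic_abs p (y n - x n)" for x y :: "nat \<Rightarrow> rat" and n
    using padic_abs_minus[OF p, of "x n - y n"] by simp
  thus "sym (padic_rel p)" by (auto simp: sym_def padic_rel_def)
  show "trans (padic_rel p)"
  proof (rule transI)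
    fix x y z assume "(x, y) \<in> padic_rel p" "(y, z) \<in> padic_rel p"
    thus "(x, z) \<in> padic_rel p"
      using padic_null_add[of "\<lambda>n. x n - y n" "\<lambda>n. y n - z n"] by (auto simp: padic_rel_def)
  qed
qed

abbreviation padic_class where "padic_class x \<equiv> padic_rel p `` {x}"

lemma Qp_carrierE:
  assumes "X \<in> carrier (Qp p)"
  obtains x where "x \<in> padic_cauchy p" "X = padic_class x"
  using assms by (auto simp: Qp_def elim: quotientE)

lemma Qp_carrierI: "x \<in> padic_cauchy p \<Longrightarrow> padic_class x \<in> carrier (Qp p)"
  by (auto simp: Qp_def intro: quotientI)

lemma Qp_add:
  assumes "x \<in> padic_cauchy p" "y \<in> padic_cauchy p"
  shows "padic_class x \<oplus>\<^bsub>Qp p\<^esub> padic_class y = padic_class (\<lambda>n. x n + y n)"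
proof -
  have "congruent2 (padic_rel p) (padic_rel p) (\<lambda>x y. padic_class (\<lambda>n. x n + y n))"
  proof (rule congruent2I'[OF equiv_class_eq[OF padic_rel_equiv]])
    fix x x' y y' assume "(x, x') \<in> padic_rel p" "(y, y') \<in> padic_rel p"
    thus "((\<lambda>n. x n + y n), (\<lambda>n. x' n + y' n)) \<in> padic_rel p"
      using padic_null_add[of "\<lambda>n. x n - x' n" "\<lambda>n. y n - y' n"]
      by (auto simp: padic_rel_def padic_cauchy_add algebra_simps)
  qed
  thus ?thesis using UN_equiv_class2[OF padic_rel_equiv padic_rel_equiv _ assms]
    by (simp add: Qp_def)
qed

lemma Qp_zero: "\<zero>\<^bsub>Qp p\<^esub> = padic_class (\<lambda>_. 0)"
  by (simp add: Qp_def padic_of_rat_def)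

lemma Qp_abelian_group: "abelian_group (Qp p)"
proof (rule abelian_groupI)
  fix X Y assume "X \<in> carrier (Qp p)" "Y \<in> carrier (Qp p)"
  thus "X \<oplus>\<^bsub>Qp p\<^esub> Y \<in> carrier (Qp p)"
    by (auto elim!: Qp_carrierE simp: Qp_add Qp_carrierI padic_cauchy_add)
next
  show "\<zero>\<^bsub>Qp p\<^esub> \<in> carrier (Qp p)" by (simp add: Qp_zero Qp_carrierI padic_cauchy_const)
next
  fix X Y Z assume "X \<in> carrier (Qp p)" "Y \<in> carrier (Qp p)" "Z \<in> carrier (Qp p)"
  thus "X \<oplus>\<^bsub>Qp p\<^esub> Y \<oplus>\<^bsub>Qp p\<^esub> Z = X \<oplus>\<^bsub>Qp p\<^esub> (Y \<oplus>\<^bsub>Qp p\<^esub> Z)"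
    by (auto elim!: Qp_carrierE simp: Qp_add padic_cauchy_add add.assoc)
next
  fix X Y assume "X \<in> carrier (Qp p)" "Y \<in> carrier (Qp p)"
  thus "X \<oplus>\<^bsub>Qp p\<^esub> Y = Y \<oplus>\<^bsub>Qp p\<^esub> X"
    by (auto elim!: Qp_carrierE simp: Qp_add add.commute)
next
  fix X assume "X \<in> carrier (Qp p)"
  thus "\<zero>\<^bsub>Qp p\<^esub> \<oplus>\<^bsub>Qp p\<^esub> X = X"
    by (auto elim!: Qp_carrierE simp: Qp_zero Qp_add padic_cauchy_const)
next
  fix X assume "X \<in> carrier (Qp p)"
  then obtain x where x: "x \<in> padic_cauchy p" "X = padic_class x" by (rule Qp_carrierE)
  have "padic_class (\<lambda>n. - x n) \<oplus>\<^bsub>Qp p\<^esub> X = \<zero>\<^bsub>Qp p\<^esub>"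
    using x by (simp add: Qp_add padic_cauchy_minus Qp_zero)
  thus "\<exists>Y\<in>carrier (Qp p). Y \<oplus>\<^bsub>Qp p\<^esub> X = \<zero>\<^bsub>Qp p\<^esub>"
    using x padic_cauchy_minus Qp_carrierI by blast
qed

lemma Qp_minus:
  assumes "x \<in> padic_cauchy p" "y \<in> padic_cauchy p"
  shows "padic_class x \<ominus>\<^bsub>Qp p\<^esub> padic_class y = padic_class (\<lambda>n. x n - y n)"
proof -
  interpret abelian_group "Qp p" by (rule Qp_abelian_group)
  have "padic_class (\<lambda>n. - y n) \<oplus>\<^bsub>Qp p\<^esub> padic_class y = \<zero>\<^bsub>Qp p\<^esub>"
    using assms by (simp add: Qp_add padic_cauchy_minus Qp_zero)
  hence "\<ominus>\<^bsub>Qp p\<^esub> padic_class y = padic_class (\<lambda>n. - y n)"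
    using assms by (intro minus_equality) (auto intro: Qp_carrierI padic_cauchy_minus)
  thus ?thesis using assms by (simp add: a_minus_def Qp_add padic_cauchy_minus)
qed

lemma padic_norm_tendsto:
  assumes "x \<in> padic_cauchy p"
  shows "(\<lambda>n. padic_abs p (x n)) \<longlonglongrightarrow> padic_norm p (padic_class x)"
proof -
  obtain r where r: "(\<lambda>n. padic_abs p (x n)) \<longlonglongrightarrow> r"
    using padic_cauchy_convergent[OF assms] by (auto simp: convergent_def)
  have refl: "x \<in> padic_class x" using assms by (auto simp: padic_rel_def)
  have "(\<lambda>n. padic_abs p (y n)) \<longlonglongrightarrow> r" if "y \<in> padic_class x" for y
  proof -
    have "(\<lambda>n. padic_abs p (x n - y n)) \<longlonglongrightarrow> 0" using that by (auto simp: padic_rel_def)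
    hence "(\<lambda>n. padic_abs p (x n) - padic_abs p (y n)) \<longlonglongrightarrow> 0"
      by (rule Lim_null_comparison[rotated]) (simp add: padic_abs_sub[OF p])
    from tendsto_diff[OF r this] show ?thesis by simp
  qed
  hence "padic_norm p (padic_class x) = r"
    unfolding padic_norm_def using refl r by (intro the_equality) (auto intro: LIMSEQ_unique)
  thus ?thesis using r by simp
qed

lemma padic_cauchy_diff:
  "x \<in> padic_cauchy p \<Longrightarrow> y \<in> padic_cauchy p \<Longrightarrow> (\<lambda>n. x n - y n) \<in> padic_cauchy p"
  using padic_cauchy_add[of x "\<lambda>n. - y n"] padic_cauchy_minus[of y] by simp

lemma padic_dist_tendsto:
  assumes "x \<in> padic_cauchy p" "y \<in> padic_cauchy p"
  shows "(\<lambda>n. padic_abs p (x n - y n)) \<longlonglongrightarrow> padic_dist p (padic_class x) (padic_class y)"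
  using padic_norm_tendsto[OF padic_cauchy_diff[OF assms]] assms
  by (simp add: padic_dist_def Qp_minus Qp_carrierI)

lemma padic_metric_space: "Metric_space (carrier (Qp p)) (padic_dist p)"
proof
  show "0 \<le> padic_dist p X Y" for X Y
  proof (cases "X \<in> carrier (Qp p) \<and> Y \<in> carrier (Qp p)")
    case True
    then show ?thesis
      by (elim conjE Qp_carrierE)
        (auto intro!: LIMSEQ_le_const[OF padic_dist_tendsto] padic_abs_nonneg)
  qed (auto simp: padic_dist_def)
  show "padic_dist p X Y = padic_dist p Y X" for X Y
  proof (cases "X \<in> carrier (Qp p) \<and> Y \<in> carrier (Qp p)")
    case True
    then obtain x y where xy: "x \<in> padic_cauchy p" "X = padic_class x" "y \<in> padic_cauchy p" "Y = padic_class y"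
      by (meson Qp_carrierE)
    have "padic_abs p (x n - y n) = padic_abs p (y n - x n)" for n
      using padic_abs_minus[OF p, of "x n - y n"] by simp
    thus ?thesis
      using padic_dist_tendsto[of x y] padic_dist_tendsto[of y x] xy
      by (auto intro: LIMSEQ_unique)
  qed (auto simp: padic_dist_def)
next
  fix X Y assume "X \<in> carrier (Qp p)" "Y \<in> carrier (Qp p)"
  then obtain x y where xy: "x \<in> padic_cauchy p" "X = padic_class x" "y \<in> padic_cauchy p" "Y = padic_class y"
    by (meson Qp_carrierE)
  have "padic_dist p X Y = 0 \<longleftrightarrow> (\<lambda>n. padic_abs p (x n - y n)) \<longlonglongrightarrow> 0"
    using padic_dist_tendsto[of x y] xy by (auto intro: LIMSEQ_unique)
  also have "\<dots> \<longleftrightarrow> (x, y) \<in> padic_rel p" using xy by (auto simp: padic_rel_def)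
  also have "\<dots> \<longleftrightarrow> X = Y" using xy eq_equiv_class_iff[OF padic_rel_equiv] by simp
  finally show "padic_dist p X Y = 0 \<longleftrightarrow> X = Y" .
next
  fix X Y Z assume "X \<in> carrier (Qp p)" "Y \<in> carrier (Qp p)" "Z \<in> carrier (Qp p)"
  then obtain x y z where xy: "x \<in> padic_cauchy p" "X = padic_class x" "y \<in> padic_cauchy p" "Y = padic_class y"
    "z \<in> padic_cauchy p" "Z = padic_class z"
    by (meson Qp_carrierE)
  show "padic_dist p X Z \<le> padic_dist p X Y + padic_dist p Y Z"
    unfolding xy
  proof (rule LIMSEQ_le[OF padic_dist_tendsto tendsto_add[OF padic_dist_tendsto padic_dist_tendsto]])
    show "\<exists>N. \<forall>n\<ge>N. padic_abs p (x n - z n) \<le> padic_abs p (x n - y n) + padic_abs p (y n - z n)"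
    proof (intro exI allI impI)
      fix n
      show "padic_abs p (x n - z n) \<le> padic_abs p (x n - y n) + padic_abs p (y n - z n)"
        using padic_abs_triangle[OF p, of "x n - y n" "y n - z n"] by simp
    qed
  qed (use xy in auto)
qed

lemma padic_norm_of_rat: "padic_norm p (padic_of_rat p q) = padic_abs p q"
  using LIMSEQ_unique[OF padic_norm_tendsto[OF padic_cauchy_const[of q]]]
  by (simp add: padic_of_rat_def)

end

section \<open>Self-similar sets\<close>

definition padic_self_similar_set ::
  "nat \<Rightarrow> 'i set \<Rightarrow> ('i \<Rightarrow> (nat \<Rightarrow> rat) set \<Rightarrow> (nat \<Rightarrow> rat) set) \<Rightarrow> (nat \<Rightarrow> rat) set set" where
  "padic_self_similar_set p I F =
     (THE K. K \<noteq> {} \<and> compactin (padic_topology p) K \<and> K = (\<Union>i\<in>I. F i ` K))"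

text \<open>A system with maps indexed by 1, ..., n is given by the functions b, k and d, of which
  only the values on that range are used.\<close>

definition ifs_data ::
  "nat \<Rightarrow> nat \<Rightarrow> (nat \<Rightarrow> nat) \<Rightarrow> (nat \<Rightarrow> nat) \<Rightarrow> (nat \<Rightarrow> rat) \<Rightarrow> bool" where
  "ifs_data p n b k d \<longleftrightarrow>
     prime p \<and> 1 \<le> n \<and>
     (\<forall>i\<in>{1..n}. b i \<in> {0, 1} \<and> 1 \<le> k i \<and> padic_of_rat p (d i) \<in> Zp p)"

definition ifs_map ::
  "nat \<Rightarrow> (nat \<Rightarrow> nat) \<Rightarrow> (nat \<Rightarrow> nat) \<Rightarrow> (nat \<Rightarrow> rat) \<Rightarrow> nat \<Rightarrow>
   (nat \<Rightarrow> rat) set \<Rightarrow> (nat \<Rightarrow> rat) set" where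
  "ifs_map p b k d i X =
     padic_of_rat p ((-1) ^ b i * of_nat p ^ k i) \<otimes>\<^bsub>Qp p\<^esub> X \<oplus>\<^bsub>Qp p\<^esub> padic_of_rat p (d i)"

definition ifs_attractor ::
  "nat \<Rightarrow> nat \<Rightarrow> (nat \<Rightarrow> nat) \<Rightarrow> (nat \<Rightarrow> nat) \<Rightarrow> (nat \<Rightarrow> rat) \<Rightarrow> (nat \<Rightarrow> rat) set set" where
  "ifs_attractor p n b k d = padic_self_similar_set p {1..n} (ifs_map p b k d)"

text \<open>The address is indexed from 0, so its j-th entry is the letter with index j + 1 of the
  usual one-based notation.\<close>

definition address_value ::
  "nat \<Rightarrow> (nat \<Rightarrow> nat) \<Rightarrow> (nat \<Rightarrow> nat) \<Rightarrow> (nat \<Rightarrow> rat) \<Rightarrow> (nat \<Rightarrow> nat) \<Rightarrow>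
   (nat \<Rightarrow> rat) set \<Rightarrow> bool" where
  "address_value p b k d a X \<longleftrightarrow>
     limitin (padic_topology p)
       (\<lambda>N. padic_of_rat p
              (\<Sum>j<N. (-1) ^ (\<Sum>i<j. b (a i)) * of_nat p ^ (\<Sum>i<j. k (a i)) * d (a j)))
       X sequentially"

section \<open>Transducers and automata on infinite words\<close>

record ('q, 'a, 'c) transducer =
  tr_states :: "'q set"
  tr_init :: 'q
  tr_edges :: "('q \<times> 'a \<times> 'c list \<times> 'q) set"

definition finite_transducer :: "'a set \<Rightarrow> 'c set \<Rightarrow> ('q, 'a, 'c) transducer \<Rightarrow> bool" where
  "finite_transducer A C T \<longleftrightarrow>
     finite (tr_states T) \<and> tr_init T \<in> tr_states T \<and> finite (tr_edges T) \<and>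
     tr_edges T \<subseteq> tr_states T \<times> A \<times> lists C \<times> tr_states T"

definition tr_path ::
  "('q, 'a, 'c) transducer \<Rightarrow> (nat \<Rightarrow> 'a) \<Rightarrow> (nat \<Rightarrow> 'q) \<Rightarrow> (nat \<Rightarrow> 'c list) \<Rightarrow> bool" where
  "tr_path T a q w \<longleftrightarrow>
     q 0 = tr_init T \<and> (\<forall>j. (q j, a j, w j, q (Suc j)) \<in> tr_edges T)"

text \<open>The concatenation of the finite words w 0, w 1, ... is the infinite word c. In particular
  it is infinite.\<close>

definition concatenation_is :: "(nat \<Rightarrow> 'c list) \<Rightarrow> (nat \<Rightarrow> 'c) \<Rightarrow> bool" where
  "concatenation_is w c \<longleftrightarrow>
     (\<forall>N. concat (map w [0..<N]) = map c [0..<length (concat (map w [0..<N]))]) \<and>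
     (\<forall>L. \<exists>N. L \<le> length (concat (map w [0..<N])))"

text \<open>The graph need not be deterministic; the input can be read, and whichever path reads it,
  the output is the same.\<close>

definition transduces ::
  "('q, 'a, 'c) transducer \<Rightarrow> (nat \<Rightarrow> 'a) \<Rightarrow> (nat \<Rightarrow> 'c) \<Rightarrow> bool" where
  "transduces T a c \<longleftrightarrow>
     (\<exists>q w. tr_path T a q w) \<and> (\<forall>q w. tr_path T a q w \<longrightarrow> concatenation_is w c)"

record ('q, 'c) automaton =
  au_states :: "'q set"
  au_init :: 'q
  au_edges :: "('q \<times> 'c \<times> 'q) set"

definition finite_automaton :: "'c set \<Rightarrow> ('q, 'c) automaton \<Rightarrow> bool" where
  "finite_automaton C M \<longleftrightarrow>
     finite (au_states M) \<and> au_init M \<in> au_states M \<and> finite (au_edges M) \<and>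
     au_edges M \<subseteq> au_states M \<times> C \<times> au_states M"

definition recognized_words :: "('q, 'c) automaton \<Rightarrow> (nat \<Rightarrow> 'c) set" where
  "recognized_words M =
     {c. \<exists>q. q 0 = au_init M \<and> (\<forall>i. (q i, c i, q (Suc i)) \<in> au_edges M)}"

section \<open>Hausdorff dimension\<close>

text \<open>The diameter is only used for bounded sets.\<close>

definition set_diameter :: "('a \<Rightarrow> 'a \<Rightarrow> real) \<Rightarrow> 'a set \<Rightarrow> real" where
  "set_diameter dst U = (if U = {} then 0 else SUP (x, y)\<in>U \<times> U. dst x y)"

definition hausdorff_content ::
  "'a set \<Rightarrow> ('a \<Rightarrow> 'a \<Rightarrow> real) \<Rightarrow> real \<Rightarrow> real \<Rightarrow> 'a set \<Rightarrow> ennreal" where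
  "hausdorff_content X dst s \<delta> A =
     (INF U \<in> {U :: nat \<Rightarrow> 'a set. A \<subseteq> (\<Union>i. U i) \<and>
                 (\<forall>i. U i \<subseteq> X \<and> (\<forall>x\<in>U i. \<forall>y\<in>U i. dst x y \<le> \<delta>))}.
        \<Sum>i. ennreal (set_diameter dst (U i) powr s))"

definition hausdorff_measure ::
  "'a set \<Rightarrow> ('a \<Rightarrow> 'a \<Rightarrow> real) \<Rightarrow> real \<Rightarrow> 'a set \<Rightarrow> ennreal" where
  "hausdorff_measure X dst s A = (SUP \<delta>\<in>{0<..}. hausdorff_content X dst s \<delta> A)"

text \<open>Exponent 0 is left out since 0 powr 0 = 0; this does not change the infimum.\<close>

definition hausdorff_dimension :: "'a set \<Rightarrow> ('a \<Rightarrow> 'a \<Rightarrow> real) \<Rightarrow> 'a set \<Rightarrow> ereal" where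
  "hausdorff_dimension X dst A = (INF s\<in>{s. 0 < s \<and> hausdorff_measure X dst s A = 0}. ereal s)"

section \<open>Computability\<close>

text \<open>The total recursive functions, with the arity as first argument. Minimization is restricted
  to regular functions (Kleene), which yields all total recursive functions. The values on
  lists whose length is not the arity are irrelevant.\<close>

inductive general_recursive :: "nat \<Rightarrow> (nat list \<Rightarrow> nat) \<Rightarrow> bool" where
  zero: "general_recursive n (\<lambda>xs. 0)"
| succ: "general_recursive 1 (\<lambda>xs. Suc (xs ! 0))"
| proj: "i < n \<Longrightarrow> general_recursive n (\<lambda>xs. xs ! i)"
| comp: "general_recursive (length gs) f \<Longrightarrow> (\<forall>g\<in>set gs. general_recursive n g) \<Longrightarrow>
         general_recursive n (\<lambda>xs. f (map (\<lambda>g. g xs) gs))"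
| prim_rec: "general_recursive n f \<Longrightarrow> general_recursive (Suc (Suc n)) g \<Longrightarrow>
         general_recursive (Suc n)
           (\<lambda>xs. rec_nat (f (tl xs)) (\<lambda>y r. g (y # r # tl xs)) (hd xs))"
| minim: "general_recursive (Suc n) f \<Longrightarrow>
         (\<forall>xs. length xs = n \<longrightarrow> (\<exists>y. f (y # xs) = 0)) \<Longrightarrow>
         general_recursive n (\<lambda>xs. LEAST y. f (y # xs) = 0)"

definition rat_code :: "rat \<Rightarrow> nat" where
  "rat_code q =
     prod_encode (int_encode (fst (quotient_of q)), int_encode (snd (quotient_of q)))"

definition ifs_code ::
  "nat \<Rightarrow> nat \<Rightarrow> (nat \<Rightarrow> nat) \<Rightarrow> (nat \<Rightarrow> nat) \<Rightarrow> (nat \<Rightarrow> rat) \<Rightarrow> nat" where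
  "ifs_code p n b k d =
     list_encode
       (p # map (\<lambda>i. prod_encode (b i, prod_encode (k i, rat_code (d i)))) [1..<Suc n])"

text \<open>A family of quantities is computable if a single recursive function, given the code of an
  instance and a precision m, returns the numerator of a dyadic approximation with error at
  most 2 ^ (- m). In particular all the quantities are finite.\<close>

definition computable_from :: "(nat \<times> ereal) set \<Rightarrow> bool" where
  "computable_from V \<longleftrightarrow>
     (\<exists>f. general_recursive 2 f \<and>
        (\<forall>(z, v)\<in>V. \<forall>m. \<bar>v - ereal (real_of_int (int_decode (f [z, m])) / 2 ^ m)\<bar>
                              \<le> ereal (1 / 2 ^ m)))"

end

theory Submission
  imports Defs
begin

text \<open>Let Q be the product of the denominators of the translations. The sums belonging to
  addresses are 1/Q times limits of sums of integers, and everything is reduced to congruences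
  between these integers modulo powers of p. After a prefix of the address has been read, the digits
  that are already determined can be split off; the remaining carry is an integer that
  stays bounded because the maps contract, so finitely many states suffice.

  For the dimension, let N(m) be the number of residues modulo p^m of points of the
  attractor. Every ball of radius p^-m that meets the attractor contains a copy of it of size about
  p^-m, and by the boundedness of the carries it meets at most C different ones. Hence
  N(m) N(l) \<le> N(m + l + \<kappa>) and N(m + l) \<le> C N(m) N(l) with explicit constants, so the
  growth rate of N, which is the Hausdorff dimension, is approximated by log N(m) / m with an
  explicit error bound.\<close>

text \<open>The obstacle is uniformity: one recursive function must serve every prime and every
  system, although the copies of the attractor may overlap in any way. Reading the dimension off the
  automaton would involve the spectral radius of a determinized graph. Instead, residues are counted
  by brute force over finite addresses, and the two inequalities for N take over the role of a
  separation condition. Their constants must be computable as well. No exponent and no numerator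
  occurring in a code exceeds the code z, so z bounds the exponents and z times Q bounds the scaled
  translations. The algorithm is primitive recursive.

  The constant C counts descriptions of copies near a ball: a sign, an excess exponent and a
  rescaled integer translation.

  An infinite path of the automaton is compared with addresses at each finite level only, possibly
  with a different address each time; closedness of the attractor closes this gap.\<close>

section \<open>Recursive functions\<close>

text \<open>Values on lists of the wrong length are ignored, so that functions can be given by any
  expression in the entries of the argument list.\<close>

definition recursive_fun :: "nat \<Rightarrow> (nat list \<Rightarrow> nat) \<Rightarrow> bool" where
  "recursive_fun n F \<longleftrightarrow>
     (\<exists>f. general_recursive n f \<and> (\<forall>xs. length xs = n \<longrightarrow> f xs = F xs))"

lemma recursive_fun_cong:
  "recursive_fun n F \<Longrightarrow> (\<And>xs. length xs = n \<Longrightarrow> F xs = G xs) \<Longrightarrow> recursive_fun n G"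
  by (auto simp: recursive_fun_def)

lemma recursive_fun_nth: "i < n \<Longrightarrow> recursive_fun n (\<lambda>xs. xs ! i)"
  by (auto simp: recursive_fun_def intro: general_recursive.proj)

lemma recursive_fun_comp:
  assumes F: "recursive_fun (length Gs) F" and Gs: "\<And>G. G \<in> set Gs \<Longrightarrow> recursive_fun n G"
  shows "recursive_fun n (\<lambda>xs. F (map (\<lambda>G. G xs) Gs))"
proof -
  obtain f where f: "general_recursive (length Gs) f" "\<And>xs. length xs = length Gs \<Longrightarrow> f xs = F xs"
    using F by (auto simp: recursive_fun_def)
  obtain g where g: "\<And>G. G \<in> set Gs \<Longrightarrow> general_recursive n (g G) \<and> (\<forall>xs. length xs = n \<longrightarrow> g G xs = G xs)"
    using Gs unfolding recursive_fun_def by metis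
  have "general_recursive n (\<lambda>xs. f (map (\<lambda>h. h xs) (map g Gs)))"
    by (rule general_recursive.comp) (use f g in auto)
  moreover have "f (map (\<lambda>h. h xs) (map g Gs)) = F (map (\<lambda>G. G xs) Gs)" if "length xs = n" for xs
  proof -
    have "map (\<lambda>h. h xs) (map g Gs) = map (\<lambda>G. G xs) Gs" using g that by simp
    moreover have "f (map (\<lambda>G. G xs) Gs) = F (map (\<lambda>G. G xs) Gs)" by (rule f(2)) simp
    ultimately show ?thesis by (simp only:)
  qed
  ultimately show ?thesis unfolding recursive_fun_def by blast
qed

lemma recursive_fun_comp1:
  assumes "recursive_fun 1 (\<lambda>xs. h (xs ! 0))" "recursive_fun n F"
  shows "recursive_fun n (\<lambda>xs. h (F xs))"
  using recursive_fun_comp[of "[F]" "\<lambda>xs. h (xs ! 0)" n] assms by simp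

lemma recursive_fun_comp2:
  assumes "recursive_fun 2 (\<lambda>xs. h (xs ! 0) (xs ! 1))" "recursive_fun n F" "recursive_fun n G"
  shows "recursive_fun n (\<lambda>xs. h (F xs) (G xs))"
  using recursive_fun_comp[of "[F, G]" "\<lambda>xs. h (xs ! 0) (xs ! 1)" n] assms
  by (auto simp: numeral_2_eq_2)

lemma recursive_fun_comp4:
  assumes "recursive_fun 4 (\<lambda>xs. h (xs ! 0) (xs ! 1) (xs ! 2) (xs ! 3))"
    "recursive_fun n F" "recursive_fun n G" "recursive_fun n H" "recursive_fun n K"
  shows "recursive_fun n (\<lambda>xs. h (F xs) (G xs) (H xs) (K xs))"
  using recursive_fun_comp[of "[F, G, H, K]" "\<lambda>xs. h (xs ! 0) (xs ! 1) (xs ! 2) (xs ! 3)" n] assms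
  by (auto simp: numeral_3_eq_3 eval_nat_numeral)

lemma recursive_fun_Suc: "recursive_fun n F \<Longrightarrow> recursive_fun n (\<lambda>xs. Suc (F xs))"
  by (rule recursive_fun_comp1) (use general_recursive.succ in \<open>auto simp: recursive_fun_def\<close>)

lemma recursive_fun_const: "recursive_fun n (\<lambda>_. c)"
proof (induction c)
  case 0
  show ?case using general_recursive.zero by (auto simp: recursive_fun_def)
qed (rule recursive_fun_Suc)

text \<open>In the bodies of recursions and sums the bound variable is the head of the argument
  list.\<close>

lemma recursive_fun_hd: "recursive_fun (Suc n) hd"
  by (rule recursive_fun_cong[OF recursive_fun_nth[of 0]]) (auto simp: length_Suc_conv)

lemma recursive_fun_tl_nth: "Suc i < n \<Longrightarrow> recursive_fun n (\<lambda>xs. tl xs ! i)"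
  by (rule recursive_fun_cong[OF recursive_fun_nth[of "Suc i"]]) (auto simp: nth_tl)

lemma recursive_fun_hd_tl: "recursive_fun (Suc (Suc n)) (\<lambda>xs. hd (tl xs))"
  by (rule recursive_fun_cong[OF recursive_fun_nth[of 1]]) (auto simp: length_Suc_conv)

lemma recursive_fun_tl_tl_nth: "Suc (Suc i) < n \<Longrightarrow> recursive_fun n (\<lambda>xs. tl (tl xs) ! i)"
  by (rule recursive_fun_cong[OF recursive_fun_nth[of "Suc (Suc i)"]]) (auto simp: nth_tl)

text \<open>\<open>prim_rec\<close> recurses on the head of its list. Feeding it \<open>B\<close>
  followed by all projections makes it recurse up to \<open>B xs\<close> while the parameters remain
  \<open>xs\<close>.\<close>

lemma recursive_fun_rec_nat:
  assumes F: "recursive_fun n F" and B: "recursive_fun n B"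
    and G: "recursive_fun (Suc (Suc n)) (\<lambda>xs. G (hd xs) (hd (tl xs)) (tl (tl xs)))"
  shows "recursive_fun n (\<lambda>xs. rec_nat (F xs) (\<lambda>y r. G y r xs) (B xs))"
proof -
  obtain f where f: "general_recursive n f" "\<And>xs. length xs = n \<Longrightarrow> f xs = F xs"
    using F by (auto simp: recursive_fun_def)
  obtain g where g: "general_recursive (Suc (Suc n)) g"
    "\<And>xs. length xs = Suc (Suc n) \<Longrightarrow> g xs = G (hd xs) (hd (tl xs)) (tl (tl xs))"
    using G by (auto simp: recursive_fun_def)
  let ?r = "\<lambda>xs. rec_nat (f (tl xs)) (\<lambda>y r. g (y # r # tl xs)) (hd xs)"
  have r: "recursive_fun (Suc n) ?r"
    using general_recursive.prim_rec[OF f(1) g(1)] by (auto simp: recursive_fun_def)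
  let ?Gs = "B # map (\<lambda>i xs. xs ! i) [0..<n]"
  have "recursive_fun n (\<lambda>xs. ?r (map (\<lambda>G. G xs) ?Gs))"
    by (rule recursive_fun_comp) (use r B in \<open>auto intro: recursive_fun_nth\<close>)
  thus ?thesis
  proof (rule recursive_fun_cong)
    fix xs :: "nat list" assume xs: "length xs = n"
    have eq: "map (\<lambda>G. G xs) ?Gs = B xs # xs" using xs by (auto intro: nth_equalityI)
    have "rec_nat (f xs) (\<lambda>y r. g (y # r # xs)) m = rec_nat (F xs) (\<lambda>y r. G y r xs) m" for m
      using f(2)[OF xs] g(2) xs by (induction m) auto
    thus "?r (map (\<lambda>G. G xs) ?Gs) = rec_nat (F xs) (\<lambda>y r. G y r xs) (B xs)"
      unfolding eq by simp
  qed
qed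

lemmas recursive_fun_basic =
  recursive_fun_nth recursive_fun_hd recursive_fun_hd_tl recursive_fun_tl_nth
  recursive_fun_tl_tl_nth recursive_fun_Suc recursive_fun_const

lemma recursive_fun_add:
  assumes "recursive_fun n F" "recursive_fun n G"
  shows "recursive_fun n (\<lambda>xs. F xs + G xs)"
proof (rule recursive_fun_comp2[OF _ assms])
  have "recursive_fun 2 (\<lambda>xs. rec_nat (xs ! 0) (\<lambda>y r. Suc r) (xs ! 1))"
    by (intro recursive_fun_rec_nat recursive_fun_basic) auto
  moreover have "rec_nat a (\<lambda>y r. Suc r) c = a + c" for a c by (induction c) auto
  ultimately show "recursive_fun 2 (\<lambda>xs. xs ! 0 + xs ! 1)" by simp
qed

lemma recursive_fun_mult:
  assumes "recursive_fun n F" "recursive_fun n G"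
  shows "recursive_fun n (\<lambda>xs. F xs * G xs)"
proof (rule recursive_fun_comp2[OF _ assms])
  have "recursive_fun 2 (\<lambda>xs. rec_nat 0 (\<lambda>y r. xs ! 0 + r) (xs ! 1))"
    by (intro recursive_fun_rec_nat recursive_fun_add recursive_fun_basic) auto
  moreover have "rec_nat 0 (\<lambda>y r. a + r) c = a * c" for a c :: nat by (induction c) auto
  ultimately show "recursive_fun 2 (\<lambda>xs. xs ! 0 * xs ! 1)" by simp
qed

lemma recursive_fun_power:
  assumes "recursive_fun n F" "recursive_fun n G"
  shows "recursive_fun n (\<lambda>xs. F xs ^ G xs)"
proof (rule recursive_fun_comp2[OF _ assms])
  have "recursive_fun 2 (\<lambda>xs. rec_nat 1 (\<lambda>y r. xs ! 0 * r) (xs ! 1))"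
    by (intro recursive_fun_rec_nat recursive_fun_mult recursive_fun_basic) auto
  moreover have "rec_nat 1 (\<lambda>y r. a * r) c = a ^ c" for a c :: nat by (induction c) auto
  ultimately show "recursive_fun 2 (\<lambda>xs. xs ! 0 ^ xs ! 1)" by simp
qed

lemma recursive_fun_pred:
  assumes "recursive_fun n F"
  shows "recursive_fun n (\<lambda>xs. F xs - Suc 0)"
proof (rule recursive_fun_comp1[OF _ assms])
  have "recursive_fun 1 (\<lambda>xs. rec_nat 0 (\<lambda>y r. y) (xs ! 0))"
    by (intro recursive_fun_rec_nat recursive_fun_basic) auto
  moreover have "rec_nat 0 (\<lambda>y r. y) c = c - 1" for c :: nat by (cases c) auto
  ultimately show "recursive_fun 1 (\<lambda>xs. xs ! 0 - Suc 0)" by simp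
qed

lemma recursive_fun_diff:
  assumes "recursive_fun n F" "recursive_fun n G"
  shows "recursive_fun n (\<lambda>xs. F xs - G xs)"
proof (rule recursive_fun_comp2[OF _ assms])
  have "recursive_fun 2 (\<lambda>xs. rec_nat (xs ! 0) (\<lambda>y r. r - Suc 0) (xs ! 1))"
    by (intro recursive_fun_rec_nat recursive_fun_pred recursive_fun_basic) auto
  moreover have "rec_nat a (\<lambda>y r. r - Suc 0) c = a - c" for a c :: nat by (induction c) auto
  ultimately show "recursive_fun 2 (\<lambda>xs. xs ! 0 - xs ! 1)" by simp
qed

lemma recursive_fun_le:
  assumes "recursive_fun n F" "recursive_fun n G"
  shows "recursive_fun n (\<lambda>xs. of_bool (F xs \<le> G xs))"
proof -
  have "recursive_fun n (\<lambda>xs. 1 - (F xs - G xs))"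
    by (intro recursive_fun_diff recursive_fun_const assms)
  thus ?thesis by (rule recursive_fun_cong) auto
qed

lemma recursive_fun_eq:
  assumes "recursive_fun n F" "recursive_fun n G"
  shows "recursive_fun n (\<lambda>xs. of_bool (F xs = G xs))"
proof -
  have "recursive_fun n (\<lambda>xs. of_bool (F xs \<le> G xs) * of_bool (G xs \<le> F xs))"
    by (intro recursive_fun_le recursive_fun_mult assms)
  thus ?thesis by (rule recursive_fun_cong) auto
qed

lemma recursive_fun_sum:
  assumes "recursive_fun n B" "recursive_fun (Suc n) (\<lambda>xs. G (hd xs) (tl xs))"
  shows "recursive_fun n (\<lambda>xs. \<Sum>i<B xs. G i xs)"
proof -
  \<comment> \<open>A recursion step also receives the accumulator, as second argument. The
    projections skip it, so the summand is required to be recursive in index and parameters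
    only.\<close>
  have *: "recursive_fun (Suc (Suc n)) (\<lambda>xs. G (hd xs) (tl (tl xs)))"
  proof (rule recursive_fun_cong[OF recursive_fun_comp[where F = "\<lambda>xs. G (hd xs) (tl xs)" and
            Gs = "hd # map (\<lambda>i xs. xs ! Suc (Suc i)) [0..<n]"]])
    fix xs :: "nat list" assume xs: "length xs = Suc (Suc n)"
    have "map (\<lambda>F. F xs) (map (\<lambda>i xs. xs ! Suc (Suc i)) [0..<n]) = tl (tl xs)"
      using xs by (intro nth_equalityI) (auto simp: nth_tl)
    thus "(\<lambda>xs. G (hd xs) (tl xs)) (map (\<lambda>F. F xs) (hd # map (\<lambda>i xs. xs ! Suc (Suc i)) [0..<n])) =
        G (hd xs) (tl (tl xs))" by simp
  qed (use assms in \<open>auto intro: recursive_fun_nth recursive_fun_hd\<close>)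
  have "recursive_fun n (\<lambda>xs. rec_nat 0 (\<lambda>y r. r + G y xs) (B xs))"
    by (intro recursive_fun_rec_nat recursive_fun_add * recursive_fun_basic assms)
  moreover have "rec_nat 0 (\<lambda>y r. r + G y xs) m = (\<Sum>i<m. G i xs)" for m xs by (induction m) auto
  ultimately show ?thesis by simp
qed

lemma recursive_fun_prod:
  assumes "recursive_fun n B" "recursive_fun (Suc (Suc n)) (\<lambda>xs. G (hd xs) (tl (tl xs)))"
  shows "recursive_fun n (\<lambda>xs. \<Prod>i<B xs. G i xs)"
proof -
  have "recursive_fun n (\<lambda>xs. rec_nat 1 (\<lambda>y r. r * G y xs) (B xs))"
    by (intro recursive_fun_rec_nat recursive_fun_mult recursive_fun_basic assms)
  moreover have "rec_nat 1 (\<lambda>y r. r * G y xs) m = (\<Prod>i<m. G i xs)" for m xs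
    by (induction m) (auto simp: mult.commute)
  ultimately show ?thesis by simp
qed

lemmas recursive_fun_arith =
  recursive_fun_sum recursive_fun_add recursive_fun_mult recursive_fun_power recursive_fun_diff
  recursive_fun_le recursive_fun_eq recursive_fun_basic

lemma recursive_fun_div:
  assumes "recursive_fun n F" "recursive_fun n G"
  shows "recursive_fun n (\<lambda>xs. F xs div G xs)"
proof (rule recursive_fun_comp2[OF _ assms])
  have "recursive_fun 2 (\<lambda>xs. of_bool (1 \<le> xs ! 1) * (\<Sum>i<xs ! 0. of_bool (Suc i * xs ! 1 \<le> xs ! 0)))"
    by (intro recursive_fun_arith) auto
  \<comment> \<open>The quotient counts the positive multiples of \<open>c\<close> up to
    \<open>a\<close>. The first factor covers \<open>c = 0\<close>, where the sum alone would give
    \<open>a\<close> instead of 0.\<close>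
  moreover have "of_bool (1 \<le> c) * (\<Sum>i<a. of_bool (Suc i * c \<le> a)) = a div c" for a c :: nat
  proof (cases "c = 0")
    case False
    have "i < a \<and> Suc i * c \<le> a \<longleftrightarrow> i < a div c" for i
      using less_eq_div_iff_mult_less_eq[of c "Suc i" a] False order.strict_trans2[OF _ div_le_dividend, of i a c]
      by (auto simp del: mult_Suc simp: Suc_le_eq intro: order.strict_trans2)
    hence "{i. i < a \<and> Suc i * c \<le> a} = {..<a div c}" by auto
    thus ?thesis using False by (simp add: sum_of_bool_eq Int_def)
  qed simp
  ultimately show "recursive_fun 2 (\<lambda>xs. xs ! 0 div xs ! 1)" by simp
qed

lemma recursive_fun_mod:
  assumes "recursive_fun n F" "recursive_fun n G"
  shows "recursive_fun n (\<lambda>xs. F xs mod G xs)"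
  unfolding modulo_nat_def by (intro recursive_fun_arith recursive_fun_div assms)

section \<open>Inverting the pairing function\<close>

definition fst_decode :: "nat \<Rightarrow> nat" where "fst_decode z = fst (prod_decode z)"
definition snd_decode :: "nat \<Rightarrow> nat" where "snd_decode z = snd (prod_decode z)"

lemma fst_decode_encode [simp]: "fst_decode (prod_encode x) = fst x"
  and snd_decode_encode [simp]: "snd_decode (prod_encode x) = snd x"
  by (simp_all add: fst_decode_def snd_decode_def)

text \<open>A bounded search written as a double sum: both components are at most \<open>z\<close>,
  and injectivity of the pairing leaves exactly one indicator equal to 1.\<close>

lemma prod_decode_sum:
  "h (prod_decode z) = (\<Sum>a<Suc z. \<Sum>c<Suc z. of_bool (triangle (a + c) + a = z) * h (a, c) :: nat)"
proof -
  obtain a0 c0 where ac: "prod_decode z = (a0, c0)" by (cases "prod_decode z")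
  hence z: "z = prod_encode (a0, c0)" by (metis prod_decode_inverse)
  have *: "of_bool (triangle (a + c) + a = z) * h (a, c) =
      (if c = c0 then (if a = a0 then h (a, c) else 0) else 0)" for a c
    using z prod_encode_eq[of "(a, c)" "(a0, c0)"] by (auto simp: prod_encode_def)
  have "a0 < Suc z" "c0 < Suc z"
    using z le_prod_encode_1[of a0 c0] le_prod_encode_2[of c0 a0] by auto
  thus ?thesis unfolding * ac by (subst sum.delta; simp)+
qed

lemma recursive_fun_fst_decode:
  assumes "recursive_fun n F"
  shows "recursive_fun n (\<lambda>xs. fst_decode (F xs))"
proof (rule recursive_fun_comp1[OF _ assms])
  show "recursive_fun 1 (\<lambda>xs. fst_decode (xs ! 0))"
    unfolding fst_decode_def prod_decode_sum[of fst] triangle_def fst_conv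
    by (intro recursive_fun_arith recursive_fun_div) auto
qed

lemma recursive_fun_snd_decode:
  assumes "recursive_fun n F"
  shows "recursive_fun n (\<lambda>xs. snd_decode (F xs))"
proof (rule recursive_fun_comp1[OF _ assms])
  show "recursive_fun 1 (\<lambda>xs. snd_decode (xs ! 0))"
    unfolding snd_decode_def prod_decode_sum[of snd] triangle_def snd_conv
    by (intro recursive_fun_arith recursive_fun_div) auto
qed

section \<open>Approximating the dimension from the code of a system\<close>

text \<open>A nonempty list is coded as the successor of the pair of its head and the code of its
  tail, so predecessor and second component remove one entry. The code 0 of the empty list is
  preserved, since 0 also codes the pair (0, 0).\<close>

definition drop_code :: "nat \<Rightarrow> nat \<Rightarrow> nat" where
  "drop_code i z = rec_nat z (\<lambda>_ r. snd_decode (r - Suc 0)) i"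

definition entry_code :: "nat \<Rightarrow> nat \<Rightarrow> nat" where
  "entry_code z i = fst_decode (drop_code i z - Suc 0)"

text \<open>The entry with index 0 is the prime, so the maps are the entries with positive index.
  The code \<open>z\<close> bounds the length of the list that it codes.\<close>

definition code_card :: "nat \<Rightarrow> nat" where
  "code_card z = (\<Sum>i<z. of_bool (1 \<le> drop_code (Suc i) z))"

definition code_prime :: "nat \<Rightarrow> nat" where "code_prime z = entry_code z 0"

definition code_sign :: "nat \<Rightarrow> nat \<Rightarrow> nat" where
  "code_sign z i = fst_decode (entry_code z i)"

definition code_exp :: "nat \<Rightarrow> nat \<Rightarrow> nat" where
  "code_exp z i = fst_decode (snd_decode (entry_code z i))"

definition code_num :: "nat \<Rightarrow> nat \<Rightarrow> nat" where
  "code_num z i = fst_decode (snd_decode (snd_decode (entry_code z i)))"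

text \<open>A positive integer x is encoded as 2 x, hence the division by 2.\<close>

definition code_den :: "nat \<Rightarrow> nat \<Rightarrow> nat" where
  "code_den z i = snd_decode (snd_decode (snd_decode (entry_code z i))) div 2"

definition code_common_den :: "nat \<Rightarrow> nat" where
  "code_common_den z = (\<Prod>i<code_card z. code_den z (Suc i))"

text \<open>Negative integers are represented modulo P, using P - 1 for -1. If c encodes an integer x,
  then x is negative iff c mod 2 = 1, and its absolute value is c div 2 + c mod 2.\<close>

definition code_shift :: "nat \<Rightarrow> nat \<Rightarrow> nat \<Rightarrow> nat" where
  "code_shift z P i =
     (1 - code_num z i mod 2 + code_num z i mod 2 * (P - Suc 0)) *
     (code_num z i div 2 + code_num z i mod 2) * (code_common_den z div code_den z i)"

definition code_ratio :: "nat \<Rightarrow> nat \<Rightarrow> nat \<Rightarrow> nat" where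
  "code_ratio z P i =
     (1 - code_sign z i + code_sign z i * (P - Suc 0)) * code_prime z ^ code_exp z i"

text \<open>The base n digits of w are the letters of a finite address, the last letter first.\<close>

definition code_sum :: "nat \<Rightarrow> nat \<Rightarrow> nat \<Rightarrow> nat \<Rightarrow> nat" where
  "code_sum z P w j =
     rec_nat 0
       (\<lambda>i r. (code_shift z P (Suc (w div code_card z ^ i mod code_card z)) +
               code_ratio z P (Suc (w div code_card z ^ i mod code_card z)) * r) mod P) j"

definition code_count :: "nat \<Rightarrow> nat \<Rightarrow> nat" where
  "code_count z m =
     (\<Sum>r<code_prime z ^ m.
        of_bool (1 \<le> (\<Sum>w<code_card z ^ m. of_bool (code_sum z (code_prime z ^ m) w m = r) :: nat)))"

text \<open>This is the constant \<open>overlap\<close> below, taken for exponents at most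
  \<open>z\<close> and scaled translations at most \<open>code_common_den z * z\<close> in absolute
  value.\<close>

definition code_const :: "nat \<Rightarrow> nat" where
  "code_const z = 2 * (z + 1) * (2 * (code_common_den z * z * code_prime z ^ z) + 1)"

text \<open>Counting how many of the powers p^M, p^(2M), ... do not exceed X gives the integer part
  of log X / M in integer arithmetic, as long as the range of the sum is long enough.\<close>

definition code_approx :: "nat \<Rightarrow> nat \<Rightarrow> nat" where
  "code_approx z e =
     (\<Sum>i<2 ^ e + 1.
        of_bool (code_prime z ^ (Suc i * (z + code_const z))
          \<le> code_count z ((z + code_const z) * 2 ^ e) * code_prime z ^ code_const z))"

section \<open>Decoding lists, and recursiveness of the approximation\<close>

lemma drop_code_list_encode: "drop_code i (list_encode xs) = list_encode (drop i xs)"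
proof -
  have "snd_decode (list_encode ys - Suc 0) = list_encode (tl ys)" for ys
  proof (cases ys)
    case Nil
    have "prod_encode (0, 0) = 0" by (simp add: prod_encode_def)
    thus ?thesis using Nil snd_decode_encode[of "(0, 0)"] by simp
  qed simp
  thus ?thesis unfolding drop_code_def by (induction i) (simp_all only: nat.rec drop_0 drop_Suc tl_drop)
qed

lemma entry_code_list_encode: "i < length xs \<Longrightarrow> entry_code (list_encode xs) i = xs ! i"
  unfolding entry_code_def drop_code_list_encode by (subst Cons_nth_drop_Suc[symmetric]) simp_all

lemma length_le_list_encode: "length xs \<le> list_encode xs"
proof (induction xs)
  case (Cons y ys)
  have "list_encode ys \<le> prod_encode (y, list_encode ys)"
    by (rule le_prod_encode_2)
  with Cons show ?case by simp
qed simp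
lemma set_le_list_encode: "x \<in> set xs \<Longrightarrow> x \<le> list_encode xs"
proof (induction xs)
  case (Cons y ys)
  have "y \<le> prod_encode (y, list_encode ys)" "list_encode ys \<le> prod_encode (y, list_encode ys)"
    by (rule le_prod_encode_1 le_prod_encode_2)+
  with Cons show ?case by auto
qed simp

lemma code_card_list_encode: "code_card (list_encode xs) = length xs - 1"
proof -
  have "1 \<le> drop_code (Suc i) (list_encode xs) \<longleftrightarrow> i < length xs - 1" for i
  proof -
    have "1 \<le> list_encode ys \<longleftrightarrow> ys \<noteq> []" for ys by (cases ys) auto
    hence "1 \<le> drop_code (Suc i) (list_encode xs) \<longleftrightarrow> \<not> length xs \<le> Suc i"
      by (simp only: drop_code_list_encode drop_eq_Nil)
    thus ?thesis by linarith
  qed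
  hence "{i. i < list_encode xs \<and> 1 \<le> drop_code (Suc i) (list_encode xs)} = {..<length xs - 1}"
    using length_le_list_encode[of xs] by (simp only: set_eq_iff mem_Collect_eq lessThan_iff) linarith
  thus ?thesis by (simp only: code_card_def sum_of_bool_eq finite_lessThan Int_def lessThan_iff mem_Collect_eq card_lessThan of_nat_id)
qed

lemma recursive_fun_drop_code:
  assumes "recursive_fun n F" "recursive_fun n G"
  shows "recursive_fun n (\<lambda>xs. drop_code (F xs) (G xs))"
proof (rule recursive_fun_comp2[OF _ assms])
  show "recursive_fun 2 (\<lambda>xs. drop_code (xs ! 0) (xs ! 1))"
    unfolding drop_code_def
    by (intro recursive_fun_rec_nat recursive_fun_snd_decode recursive_fun_arith) auto
qed

lemma recursive_fun_entry_code:
  assumes "recursive_fun n F" "recursive_fun n G"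
  shows "recursive_fun n (\<lambda>xs. entry_code (F xs) (G xs))"
  unfolding entry_code_def
  by (intro recursive_fun_fst_decode recursive_fun_drop_code recursive_fun_diff recursive_fun_const assms)

lemma recursive_fun_code_card:
  assumes "recursive_fun n F"
  shows "recursive_fun n (\<lambda>xs. code_card (F xs))"
proof (rule recursive_fun_comp1[OF _ assms])
  show "recursive_fun 1 (\<lambda>xs. code_card (xs ! 0))"
    unfolding code_card_def
    by (intro recursive_fun_drop_code recursive_fun_arith) auto
qed

lemma recursive_fun_code_prime:
  "recursive_fun n F \<Longrightarrow> recursive_fun n (\<lambda>xs. code_prime (F xs))"
  unfolding code_prime_def by (intro recursive_fun_entry_code recursive_fun_const)

lemma recursive_fun_code_entries:
  assumes "recursive_fun n F" "recursive_fun n G"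
  shows "recursive_fun n (\<lambda>xs. code_sign (F xs) (G xs))"
    and "recursive_fun n (\<lambda>xs. code_exp (F xs) (G xs))"
    and "recursive_fun n (\<lambda>xs. code_num (F xs) (G xs))"
    and "recursive_fun n (\<lambda>xs. code_den (F xs) (G xs))"
  unfolding code_sign_def code_exp_def code_num_def code_den_def
  by (intro recursive_fun_fst_decode recursive_fun_snd_decode recursive_fun_entry_code
      recursive_fun_div recursive_fun_const assms)+

lemma recursive_fun_code_common_den:
  assumes "recursive_fun n F"
  shows "recursive_fun n (\<lambda>xs. code_common_den (F xs))"
proof (rule recursive_fun_comp1[OF _ assms])
  show "recursive_fun 1 (\<lambda>xs. code_common_den (xs ! 0))"
    unfolding code_common_den_def
    by (intro recursive_fun_code_card recursive_fun_code_entries recursive_fun_prod recursive_fun_arith) auto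
qed

lemma recursive_fun_code_shift:
  assumes "recursive_fun n F" "recursive_fun n G" "recursive_fun n H"
  shows "recursive_fun n (\<lambda>xs. code_shift (F xs) (G xs) (H xs))"
  unfolding code_shift_def
  by (intro recursive_fun_code_entries recursive_fun_code_common_den recursive_fun_div
      recursive_fun_mod recursive_fun_arith assms)

lemma recursive_fun_code_ratio:
  assumes "recursive_fun n F" "recursive_fun n G" "recursive_fun n H"
  shows "recursive_fun n (\<lambda>xs. code_ratio (F xs) (G xs) (H xs))"
  unfolding code_ratio_def
  by (intro recursive_fun_code_entries recursive_fun_code_prime recursive_fun_arith assms)

lemma recursive_fun_code_sum:
  assumes "recursive_fun n F" "recursive_fun n G" "recursive_fun n H" "recursive_fun n K"
  shows "recursive_fun n (\<lambda>xs. code_sum (F xs) (G xs) (H xs) (K xs))"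
proof (rule recursive_fun_comp4[OF _ assms])
  show "recursive_fun 4 (\<lambda>xs. code_sum (xs ! 0) (xs ! 1) (xs ! 2) (xs ! 3))"
    unfolding code_sum_def
    by (intro recursive_fun_rec_nat recursive_fun_code_shift recursive_fun_code_ratio
        recursive_fun_code_card recursive_fun_div recursive_fun_mod recursive_fun_arith) auto
qed

lemma recursive_fun_code_count:
  assumes "recursive_fun n F" "recursive_fun n G"
  shows "recursive_fun n (\<lambda>xs. code_count (F xs) (G xs))"
proof (rule recursive_fun_comp2[OF _ assms])
  show "recursive_fun 2 (\<lambda>xs. code_count (xs ! 0) (xs ! 1))"
    unfolding code_count_def
    by (intro recursive_fun_code_sum recursive_fun_code_prime recursive_fun_code_card
        recursive_fun_arith; simp)
qed

lemma recursive_fun_code_const: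
  assumes "recursive_fun n F"
  shows "recursive_fun n (\<lambda>xs. code_const (F xs))"
  unfolding code_const_def
  by (intro recursive_fun_code_common_den recursive_fun_code_prime recursive_fun_arith assms)

lemma recursive_fun_code_approx: "recursive_fun 2 (\<lambda>xs. code_approx (xs ! 0) (xs ! 1))"
  unfolding code_approx_def
  by (intro recursive_fun_code_count recursive_fun_code_const recursive_fun_code_prime
      recursive_fun_arith) auto

section \<open>Limits of rationals with a fixed denominator\<close>

lemma limitin_padic_of_rat:
  assumes p: "prime p" and x: "x \<in> padic_cauchy p"
  shows "limitin (padic_topology p) (\<lambda>N. padic_of_rat p (x N)) (padic_class p x) sequentially"
proof -
  interpret M: Metric_space "carrier (Qp p)" "padic_dist p" by (rule padic_metric_space[OF p])
  show ?thesis unfolding padic_topology_def M.limitin_metric eventually_sequentially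
  proof (intro conjI allI impI)
    show "padic_class p x \<in> carrier (Qp p)" by (rule Qp_carrierI[OF p x])
    fix e :: real assume e: "e > 0"
    have "e / 2 > 0" using e by simp
    then obtain N where N: "\<And>m n. m \<ge> N \<Longrightarrow> n \<ge> N \<Longrightarrow> padic_abs p (x m - x n) < e / 2"
      using x unfolding padic_cauchy_def by blast
    have "padic_dist p (padic_of_rat p (x m)) (padic_class p x) < e" if "m \<ge> N" for m
    proof -
      have "(\<lambda>n. padic_abs p (x m - x n)) \<longlonglongrightarrow> padic_dist p (padic_of_rat p (x m)) (padic_class p x)"
        unfolding padic_of_rat_def by (rule padic_dist_tendsto[OF p padic_cauchy_const[OF p] x])
      hence "padic_dist p (padic_of_rat p (x m)) (padic_class p x) \<le> e / 2"
        by (rule LIMSEQ_le_const2) (use N that less_imp_le in blast)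
      thus ?thesis using e by simp
    qed
    thus "\<exists>N. \<forall>n\<ge>N. padic_of_rat p (x n) \<in> carrier (Qp p) \<and>
        padic_dist p (padic_of_rat p (x n)) (padic_class p x) < e"
      using Qp_carrierI[OF p padic_cauchy_const[OF p]] unfolding padic_of_rat_def by blast
  qed
qed

section \<open>Multiplication by a rational number\<close>

lemma padic_cauchy_cmult:
  assumes p: "prime p" and x: "x \<in> padic_cauchy p"
  shows "(\<lambda>n. q * x n) \<in> padic_cauchy p"
  unfolding padic_cauchy_def
proof clarify
  fix e :: real assume "e > 0"
  let ?q = "padic_abs p q + 1"
  have q: "?q > 0" using padic_abs_nonneg[of p q] by simp
  have "e / ?q > 0" using \<open>e > 0\<close> q by simp
  then obtain N where N: "\<And>m n. m \<ge> N \<Longrightarrow> n \<ge> N \<Longrightarrow> padic_abs p (x m - x n) < e / ?q"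
    using x unfolding padic_cauchy_def by blast
  have "padic_abs p (q * x m - q * x n) < e" if "m \<ge> N" "n \<ge> N" for m n
  proof -
    have "padic_abs p (q * x m - q * x n) = padic_abs p q * padic_abs p (x m - x n)"
      by (simp add: padic_abs_mult[OF p] flip: right_diff_distrib)
    also have "\<dots> \<le> ?q * padic_abs p (x m - x n)"
      by (rule mult_right_mono) (auto simp: padic_abs_nonneg)
    also have "\<dots> < ?q * (e / ?q)" by (rule mult_strict_left_mono[OF N[OF that] q])
    finally show ?thesis using q by simp
  qed
  thus "\<exists>N. \<forall>m\<ge>N. \<forall>n\<ge>N. padic_abs p (q * x m - q * x n) < e" by blast
qed

lemma padic_null_mult:
  assumes p: "prime p" and x: "x \<in> padic_cauchy p" and y: "(\<lambda>n. padic_abs p (y n)) \<longlonglongrightarrow> 0"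
  shows "(\<lambda>n. padic_abs p (x n * y n)) \<longlonglongrightarrow> 0"
proof -
  obtain r where "(\<lambda>n. padic_abs p (x n)) \<longlonglongrightarrow> r"
    using padic_cauchy_convergent[OF p x] by (auto simp: convergent_def)
  from tendsto_mult[OF this y] show ?thesis by (simp add: padic_abs_mult[OF p])
qed

lemma padic_null_cauchy:
  assumes p: "prime p" and x: "(\<lambda>n. padic_abs p (x n)) \<longlonglongrightarrow> 0"
  shows "x \<in> padic_cauchy p"
  unfolding padic_cauchy_def
proof clarify
  fix e :: real assume "e > 0"
  then obtain N where N: "\<And>n. n \<ge> N \<Longrightarrow> padic_abs p (x n) < e"
    using order_tendstoD(2)[OF x] unfolding eventually_sequentially by blast
  have "padic_abs p (x m - x n) < e" if "m \<ge> N" "n \<ge> N" for m n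
    using padic_abs_add[OF p, of "x m" "- x n"] N[of m] N[of n] that
    by (simp add: padic_abs_minus[OF p])
  thus "\<exists>N. \<forall>m\<ge>N. \<forall>n\<ge>N. padic_abs p (x m - x n) < e" by blast
qed

text \<open>The product is a union over all pairs of representatives. It collapses to one class
  because \<open>q x - y z = q (x - z) + z (q - y)\<close> is a null sequence, which also shows that
  \<open>y z\<close> is Cauchy.\<close>

lemma Qp_of_rat_mult:
  assumes p: "prime p" and x: "x \<in> padic_cauchy p"
  shows "padic_of_rat p q \<otimes>\<^bsub>Qp p\<^esub> padic_class p x = padic_class p (\<lambda>n. q * x n)"
proof -
  have eq: "padic_class p (\<lambda>n. y n * z n) = padic_class p (\<lambda>n. q * x n)"
    if y: "y \<in> padic_class p (\<lambda>_. q)" and z: "z \<in> padic_class p x" for y z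
  proof -
    have yz: "y \<in> padic_cauchy p" "z \<in> padic_cauchy p" "(\<lambda>n. padic_abs p (q - y n)) \<longlonglongrightarrow> 0"
      "(\<lambda>n. padic_abs p (x n - z n)) \<longlonglongrightarrow> 0" using y z by (auto simp: padic_rel_def)
    have n1: "(\<lambda>n. padic_abs p (z n * (q - y n))) \<longlonglongrightarrow> 0" by (rule padic_null_mult[OF p yz(2,3)])
    have n2: "(\<lambda>n. padic_abs p (q * (x n - z n))) \<longlonglongrightarrow> 0"
      by (rule padic_null_mult[OF p padic_cauchy_const[OF p] yz(4)])
    have "q * x n - y n * z n = q * (x n - z n) + z n * (q - y n)" for n by (simp add: algebra_simps)
    hence null: "(\<lambda>n. padic_abs p (q * x n - y n * z n)) \<longlonglongrightarrow> 0"
      using padic_null_add[OF p n2 n1] by simp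
    have qx: "(\<lambda>n. q * x n) \<in> padic_cauchy p" by (rule padic_cauchy_cmult[OF p x])
    have "(\<lambda>n. q * x n - y n * z n) \<in> padic_cauchy p" by (rule padic_null_cauchy[OF p null])
    from padic_cauchy_diff[OF p qx this] have "(\<lambda>n. y n * z n) \<in> padic_cauchy p" by simp
    hence "((\<lambda>n. q * x n), (\<lambda>n. y n * z n)) \<in> padic_rel p"
      using null qx by (auto simp: padic_rel_def)
    thus ?thesis using equiv_class_eq[OF padic_rel_equiv[OF p]] by blast
  qed
  have "(\<lambda>_. q) \<in> padic_class p (\<lambda>_. q)" "x \<in> padic_class p x"
    using x padic_cauchy_const[OF p] by (auto simp: padic_rel_def)
  hence "padic_class p (\<lambda>_. q) \<noteq> {}" "padic_class p x \<noteq> {}" by blast+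
  moreover have "padic_of_rat p q \<otimes>\<^bsub>Qp p\<^esub> padic_class p x =
      (\<Union>y\<in>padic_class p (\<lambda>_. q). \<Union>z\<in>padic_class p x. padic_class p (\<lambda>n. y n * z n))"
    by (simp add: Qp_def padic_of_rat_def)
  moreover have "(\<Union>y\<in>padic_class p (\<lambda>_. q). \<Union>z\<in>padic_class p x. padic_class p (\<lambda>n. y n * z n)) =
      (\<Union>y\<in>padic_class p (\<lambda>_. q). \<Union>z\<in>padic_class p x. padic_class p (\<lambda>n. q * x n))"
    by (intro SUP_cong refl eq)
  ultimately show ?thesis by (simp only: UN_constant if_False)
qed

lemma ifs_map_class:
  assumes p: "prime p" and x: "x \<in> padic_cauchy p"
  shows "ifs_map p b k d i (padic_class p x) =
    padic_class p (\<lambda>n. (-1) ^ b i * of_nat p ^ k i * x n + d i)"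
  unfolding ifs_map_def Qp_of_rat_mult[OF p x] unfolding padic_of_rat_def
  by (rule Qp_add[OF p padic_cauchy_cmult[OF p x] padic_cauchy_const[OF p]])

section \<open>Digit sums and compatible residues\<close>

definition digit_sum :: "nat \<Rightarrow> (nat \<Rightarrow> nat) \<Rightarrow> nat \<Rightarrow> int" where
  "digit_sum p c m = (\<Sum>i<m. int (c i) * int p ^ i)"

lemma digit_sum_0 [simp]: "digit_sum p c 0 = 0"
  and digit_sum_Suc [simp]: "digit_sum p c (Suc m) = digit_sum p c m + int (c m) * int p ^ m"
  by (simp_all add: digit_sum_def)

lemma digit_sum_shift: "digit_sum p c (Suc m) = int (c 0) + int p * digit_sum p (\<lambda>i. c (Suc i)) m"
  unfolding digit_sum_def
  by (subst sum.lessThan_Suc_shift) (simp add: sum_distrib_left algebra_simps)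

lemma digit_sum_cong: "(\<And>i. i < m \<Longrightarrow> c i = c' i) \<Longrightarrow> digit_sum p c m = digit_sum p c' m"
  unfolding digit_sum_def by (rule sum.cong) auto

lemma digit_sum_bounds:
  assumes "\<And>i. i < m \<Longrightarrow> c i < p"
  shows "0 \<le> digit_sum p c m" "digit_sum p c m < int p ^ m"
proof -
  show "0 \<le> digit_sum p c m" unfolding digit_sum_def by (rule sum_nonneg) auto
  show "digit_sum p c m < int p ^ m" using assms
  proof (induction m)
    case (Suc m)
    have "(int (c m) + 1) * int p ^ m \<le> int p * int p ^ m"
      using Suc.prems[of m] by (intro mult_right_mono) auto
    thus ?case using Suc by (simp add: algebra_simps)
  qed simp
qed

text \<open>Such a sequence represents an element of the inverse limit of the rings Z/p^m: from
  index m on, the residue modulo p^m is final.\<close>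

definition coherent :: "nat \<Rightarrow> (nat \<Rightarrow> int) \<Rightarrow> bool" where
  "coherent p E \<longleftrightarrow> (\<forall>m N. m \<le> N \<longrightarrow> int p ^ m dvd E N - E m)"

lemma coherentI:
  assumes "\<And>m. int p ^ m dvd E (Suc m) - E m"
  shows "coherent p E"
  unfolding coherent_def
proof (intro allI impI)
  fix m N :: nat assume "m \<le> N"
  thus "int p ^ m dvd E N - E m"
  proof (induction N rule: dec_induct)
    case (step N)
    have "int p ^ m dvd E (Suc N) - E N" by (rule dvd_trans[OF le_imp_power_dvd[OF step(1)] assms])
    from dvd_add[OF this step(3)] show ?case by simp
  qed simp
qed

lemma coherent_dvd_iff:
  assumes "coherent p E" "coherent p E'" "m \<le> n"
  shows "int p ^ m dvd E n - E' n \<longleftrightarrow> int p ^ m dvd E m - E' m"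
proof -
  have "int p ^ m dvd E n - E m" "int p ^ m dvd E' n - E' m"
    using assms by (auto simp: coherent_def)
  hence "int p ^ m dvd (E n - E m) - (E' n - E' m)" by (rule dvd_diff)
  moreover have "E n - E' n = ((E n - E m) - (E' n - E' m)) + (E m - E' m)" by simp
  ultimately show ?thesis by (metis dvd_add_right_iff)
qed

lemma coherent_digit_sum: "coherent p (\<lambda>m. Q * digit_sum p c m)"
  by (rule coherentI) (simp add: algebra_simps)

text \<open>Since \<open>Q\<close> is a unit at p, division by \<open>Q\<close> preserves absolute
  values, and distances between fractions E/Q are read off from divisibility of integers.\<close>

locale padic_fractions =
  fixes p :: nat and Q :: int
  assumes p: "prime p" and Q: "Q > 0" and coprime: "coprime Q (int p)"
begin

lemma p_gt_1: "1 < p" using p by (rule prime_gt_1_nat)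

lemma padic_abs_quotient:
  "padic_abs p (of_int x / of_int Q) = (if x = 0 then 0 else 1 / real p ^ multiplicity (int p) x)"
proof (cases "x = 0")
  case False
  have "\<not> is_unit (int p)" using p_gt_1 by simp
  hence "\<not> int p dvd Q" using coprime coprime_absorb_left[of "int p" Q] by (auto simp: coprime_commute)
  hence "multiplicity (int p) Q = 0" by (rule not_dvd_imp_multiplicity_0)
  thus ?thesis using False Q padic_abs_Fract[OF p False, of Q]
    by (simp add: Fract_of_int_quotient power_int_minus divide_inverse)
qed simp

lemma padic_abs_quotient_le:
  assumes "int p ^ m dvd x"
  shows "padic_abs p (of_int x / of_int Q) \<le> 1 / real p ^ m"
proof (cases "x = 0")
  case False
  have "m \<le> multiplicity (int p) x"
    by (rule multiplicity_geI) (use assms False p in auto)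
  hence "real p ^ m \<le> real p ^ multiplicity (int p) x" using p_gt_1 by (intro power_increasing) auto
  thus ?thesis using p_gt_1 False by (auto simp: padic_abs_quotient intro: frac_le)
qed (simp add: padic_abs_quotient)

text \<open>Nonzero absolute values are powers of p, so failing divisibility by p^m means absolute
  value at least p^(1-m). This gap later identifies open balls with closed ones.\<close>

lemma padic_abs_quotient_ge:
  assumes "\<not> int p ^ m dvd x"
  shows "real p / real p ^ m \<le> padic_abs p (of_int x / of_int Q)"
proof -
  have x: "x \<noteq> 0" using assms by auto
  have "\<not> m \<le> multiplicity (int p) x" using assms multiplicity_dvd' by blast
  then obtain l where l: "m = Suc l" "multiplicity (int p) x \<le> l" by (cases m) auto
  have "real p ^ multiplicity (int p) x \<le> real p ^ l" using l p_gt_1 by (intro power_increasing) auto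
  thus ?thesis using p_gt_1 x l by (auto simp: padic_abs_quotient intro: frac_le)
qed

definition frac_seq :: "(nat \<Rightarrow> int) \<Rightarrow> nat \<Rightarrow> rat" where
  "frac_seq E = (\<lambda>n. of_int (E n) / of_int Q)"

definition frac_lim :: "(nat \<Rightarrow> int) \<Rightarrow> (nat \<Rightarrow> rat) set" where
  "frac_lim E = padic_class p (frac_seq E)"

lemma inverse_power_less:
  fixes e :: real
  assumes "e > 0"
  obtains m where "1 / real p ^ m < e"
proof -
  obtain m where "(1 / real p) ^ m < e"
    using real_arch_pow_inv[OF assms, of "1 / real p"] p_gt_1 by auto
  thus ?thesis using that by (simp add: power_one_over)
qed

lemma frac_seq_cauchy:
  assumes "coherent p E"
  shows "frac_seq E \<in> padic_cauchy p"
  unfolding padic_cauchy_def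
proof clarify
  fix e :: real assume "e > 0"
  then obtain m where m: "1 / real p ^ m < e" by (rule inverse_power_less)
  have "padic_abs p (frac_seq E i - frac_seq E j) < e" if "i \<ge> m" "j \<ge> m" for i j
  proof -
    have "int p ^ m dvd (E i - E m) - (E j - E m)"
      by (rule dvd_diff) (use assms that coherent_def in blast)+
    hence "padic_abs p (of_int (E i - E j) / of_int Q) \<le> 1 / real p ^ m"
      by (intro padic_abs_quotient_le) simp
    thus ?thesis using m by (simp add: frac_seq_def diff_divide_distrib)
  qed
  thus "\<exists>N. \<forall>m\<ge>N. \<forall>n\<ge>N. padic_abs p (frac_seq E m - frac_seq E n) < e" by blast
qed

lemma frac_lim_carrier: "coherent p E \<Longrightarrow> frac_lim E \<in> carrier (Qp p)"
  unfolding frac_lim_def by (rule Qp_carrierI[OF p frac_seq_cauchy])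

lemma padic_dist_frac_lim_tendsto:
  assumes "coherent p E" "coherent p E'"
  shows "(\<lambda>n. padic_abs p (of_int (E n - E' n) / of_int Q)) \<longlonglongrightarrow>
    padic_dist p (frac_lim E) (frac_lim E')"
  using padic_dist_tendsto[OF p assms[THEN frac_seq_cauchy]]
  by (simp add: frac_lim_def frac_seq_def diff_divide_distrib)

lemma padic_dist_frac_lim_ge:
  assumes E: "coherent p E" "coherent p E'" and "\<not> int p ^ m dvd E m - E' m"
  shows "real p / real p ^ m \<le> padic_dist p (frac_lim E) (frac_lim E')"
proof -
  have "\<forall>n\<ge>m. real p / real p ^ m \<le> padic_abs p (of_int (E n - E' n) / of_int Q)"
    using assms coherent_dvd_iff[OF E] padic_abs_quotient_ge by blast
  thus ?thesis using LIMSEQ_le_const[OF padic_dist_frac_lim_tendsto[OF E]] by blast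
qed

text \<open>The distance of the limits is decided at index m alone: all later terms lie on the same
  side, and the gap between p^-m and p^(1-m) survives the limit.\<close>

lemma padic_dist_frac_lim_le_iff:
  assumes E: "coherent p E" "coherent p E'"
  shows "padic_dist p (frac_lim E) (frac_lim E') \<le> 1 / real p ^ m \<longleftrightarrow> int p ^ m dvd E m - E' m"
proof (cases "int p ^ m dvd E m - E' m")
  case True
  hence "\<forall>n\<ge>m. padic_abs p (of_int (E n - E' n) / of_int Q) \<le> 1 / real p ^ m"
    using coherent_dvd_iff[OF E] padic_abs_quotient_le by blast
  thus ?thesis using True LIMSEQ_le_const2[OF padic_dist_frac_lim_tendsto[OF E]] by blast
next
  case False
  have "1 / real p ^ m < real p / real p ^ m"
    using p_gt_1 by (intro divide_strict_right_mono) auto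
  thus ?thesis using False padic_dist_frac_lim_ge[OF E False] by auto
qed

lemma frac_lim_eq_iff:
  assumes E: "coherent p E" "coherent p E'"
  shows "frac_lim E = frac_lim E' \<longleftrightarrow> (\<forall>m. int p ^ m dvd E m - E' m)"
proof -
  interpret M: Metric_space "carrier (Qp p)" "padic_dist p" by (rule padic_metric_space[OF p])
  have "padic_dist p (frac_lim E) (frac_lim E') = 0" if "\<forall>m. int p ^ m dvd E m - E' m"
  proof (rule ccontr)
    assume "padic_dist p (frac_lim E) (frac_lim E') \<noteq> 0"
    hence "padic_dist p (frac_lim E) (frac_lim E') > 0" using M.nonneg by (metis order_le_less)
    then obtain m where "1 / real p ^ m < padic_dist p (frac_lim E) (frac_lim E')"
      by (rule inverse_power_less)
    thus False using that padic_dist_frac_lim_le_iff[OF E, of m] by auto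
  qed
  moreover have "int p ^ m dvd E m - E' m" if "padic_dist p (frac_lim E) (frac_lim E') = 0" for m
    using that padic_dist_frac_lim_le_iff[OF E, of m] by simp
  ultimately show ?thesis
    using M.zero[OF E[THEN frac_lim_carrier]] by auto
qed

lemma limitin_frac_lim:
  "coherent p E \<Longrightarrow>
    limitin (padic_topology p) (\<lambda>N. padic_of_rat p (of_int (E N) / of_int Q)) (frac_lim E) sequentially"
  using limitin_padic_of_rat[OF p frac_seq_cauchy] by (simp add: frac_lim_def frac_seq_def)

lemma limitin_padic_unique:
  assumes "limitin (padic_topology p) f X sequentially" "limitin (padic_topology p) f Y sequentially"
  shows "X = Y"
proof -
  interpret M: Metric_space "carrier (Qp p)" "padic_dist p" by (rule padic_metric_space[OF p])
  show ?thesis using assms unfolding padic_topology_def by (rule M.limitin_metric_unique) simp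
qed

text \<open>Compact subsets of a metric space are closed. The form with the rate
  \<open>B / p ^ J\<close> suits arguments that produce approximations one level at a time.\<close>

lemma compactin_padic_limit:
  assumes S: "compactin (padic_topology p) S" and x: "x \<in> carrier (Qp p)"
    and near: "\<And>J. \<exists>y\<in>S. padic_dist p x y \<le> B / real p ^ J"
  shows "x \<in> S"
proof -
  interpret M: Metric_space "carrier (Qp p)" "padic_dist p" by (rule padic_metric_space[OF p])
  have "closedin M.mtopology S"
    using compactin_imp_closedin[OF M.Hausdorff_space_mtopology] S by (simp add: padic_topology_def)
  hence seq: "\<And>s l. range s \<subseteq> S \<Longrightarrow> limitin M.mtopology s l sequentially \<Longrightarrow> l \<in> S"
    and S': "S \<subseteq> carrier (Qp p)"
    unfolding M.metric_closedin_iff_sequentially_closed by blast+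
  obtain y where y: "\<And>J. y J \<in> S" "\<And>J. padic_dist p x (y J) \<le> B / real p ^ J" using near by metis
  have "(\<lambda>J. B / real p ^ J) \<longlonglongrightarrow> 0"
    using LIMSEQ_divide_realpow_zero[of "real p" B] p_gt_1 by simp
  hence "(\<lambda>J. padic_dist p (y J) x) \<longlonglongrightarrow> 0"
    by (rule Lim_null_comparison[rotated]) (simp add: M.commute[of _ x] y(2))
  moreover have "eventually (\<lambda>J. y J \<in> carrier (Qp p)) sequentially"
    using y(1) S' by (intro always_eventually) blast
  ultimately have "limitin M.mtopology y x sequentially"
    unfolding M.limitin_metric_dist_null using x by auto
  thus ?thesis using seq y(1) by blast
qed

lemma padic_expansion_frac_lim_iff:
  assumes E: "coherent p E"
  shows "padic_expansion p c (frac_lim E) \<longleftrightarrow>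
    (\<forall>i. c i < p) \<and> (\<forall>m. int p ^ m dvd Q * digit_sum p c m - E m)"
proof -
  let ?D = "\<lambda>m. Q * digit_sum p c m"
  have D: "coherent p ?D" by (rule coherent_digit_sum)
  have "of_int (?D N) / of_int Q = (\<Sum>i<N. of_nat (c i) * of_nat p ^ i :: rat)" for N
    using Q by (simp add: digit_sum_def)
  hence lim: "limitin (padic_topology p) (\<lambda>N. padic_of_rat p (\<Sum>i<N. of_nat (c i) * of_nat p ^ i))
      (frac_lim ?D) sequentially"
    using limitin_frac_lim[OF D] by simp
  have "limitin (padic_topology p) (\<lambda>N. padic_of_rat p (\<Sum>i<N. of_nat (c i) * of_nat p ^ i))
      (frac_lim E) sequentially \<longleftrightarrow> frac_lim ?D = frac_lim E"
  proof
    show "frac_lim ?D = frac_lim E" if "limitin (padic_topology p)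
      (\<lambda>N. padic_of_rat p (\<Sum>i<N. of_nat (c i) * of_nat p ^ i)) (frac_lim E) sequentially"
      by (rule limitin_padic_unique[OF lim that])
  qed (use lim in simp)
  thus ?thesis unfolding padic_expansion_def frac_lim_eq_iff[OF D E] by auto
qed

lemma dvd_mult_Q_iff: "int p ^ m dvd Q * x \<longleftrightarrow> int p ^ m dvd x"
proof -
  have "coprime (int p ^ m) Q" using coprime by (simp add: coprime_commute)
  thus ?thesis by (rule coprime_dvd_mult_right_iff)
qed

text \<open>After cancelling the unit \<open>Q\<close>, both digit sums lie between 0 and p^m and
  are congruent modulo p^m, hence equal. This finite form decides which blocks a transducer can
  output.\<close>

lemma digits_unique:
  assumes "\<And>i. i < m \<Longrightarrow> c i < p" "\<And>i. i < m \<Longrightarrow> c' i < p"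
    and "int p ^ m dvd Q * digit_sum p c m - Q * digit_sum p c' m" "i < m"
  shows "c i = c' i"
  using assms
proof (induction m arbitrary: i)
  case (Suc m)
  have "int p ^ Suc m dvd digit_sum p c (Suc m) - digit_sum p c' (Suc m)"
  proof -
    have "int p ^ Suc m dvd Q * (digit_sum p c (Suc m) - digit_sum p c' (Suc m))"
      using Suc.prems(3) by (simp only: right_diff_distrib)
    thus ?thesis unfolding dvd_mult_Q_iff .
  qed
  moreover have "\<bar>digit_sum p c (Suc m) - digit_sum p c' (Suc m)\<bar> < int p ^ Suc m"
    using digit_sum_bounds[of "Suc m" c p, OF Suc.prems(1)]
      digit_sum_bounds[of "Suc m" c' p, OF Suc.prems(2)] by linarith
  ultimately have eq: "digit_sum p c (Suc m) = digit_sum p c' (Suc m)"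
    using zdvd_not_zless[of "\<bar>digit_sum p c (Suc m) - digit_sum p c' (Suc m)\<bar>" "int p ^ Suc m"]
    by (simp only: dvd_abs_iff zero_less_abs_iff) auto
  have "digit_sum p c m - digit_sum p c' m = int p ^ m * (int (c' m) - int (c m))"
    using eq by (simp add: algebra_simps)
  hence "Q * digit_sum p c m - Q * digit_sum p c' m = int p ^ m * (Q * (int (c' m) - int (c m)))"
    by (simp only: mult.left_commute flip: right_diff_distrib)
  hence dvd: "int p ^ m dvd Q * digit_sum p c m - Q * digit_sum p c' m" by (simp only: dvd_triv_left)
  have IH: "c j = c' j" if "j < m" for j
    by (rule Suc.IH[OF _ _ dvd that]) (use Suc.prems(1,2) less_SucI in blast)+
  hence "digit_sum p c m = digit_sum p c' m" by (rule digit_sum_cong)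
  hence "c m = c' m" using eq p_gt_1 by simp
  thus ?case using IH Suc.prems(4) by (cases "i = m") auto
qed simp

lemma digits_exist:
  assumes E: "coherent p E"
  obtains c where "\<And>i. c i < p" "\<And>m. int p ^ m dvd Q * digit_sum p c m - E m"
proof -
  have "\<exists>y. 0 \<le> y \<and> y < int p ^ m \<and> int p ^ m dvd Q * y - E m" for m
  proof -
    have "coprime Q (int p ^ m)" using coprime by simp
    \<comment> \<open>The Bezout coefficient \<open>u\<close> inverts \<open>Q\<close> modulo p^m,
      so the residue of \<open>u * E m\<close> solves the congruence.\<close>
    then obtain u v where uv: "u * Q + v * int p ^ m = 1"
      using bezout_int[of Q "int p ^ m"] by auto
    have "(u * E m) mod int p ^ m = u * E m - int p ^ m * (u * E m div int p ^ m)"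
      by (rule minus_mult_div_eq_mod[symmetric])
    hence "Q * ((u * E m) mod int p ^ m) - E m =
        (u * Q - 1) * E m - int p ^ m * (Q * (u * E m div int p ^ m))"
      by (simp only: right_diff_distrib left_diff_distrib mult_1 mult_ac)
    also have "u * Q - 1 = int p ^ m * - v" using uv by (simp add: algebra_simps)
    finally have "int p ^ m dvd Q * ((u * E m) mod int p ^ m) - E m"
      by (simp only: mult.assoc right_diff_distrib[symmetric] dvd_triv_left)
    moreover have "0 < int p ^ m" using p_gt_1 by simp
    ultimately show ?thesis
      by (intro exI[of _ "(u * E m) mod int p ^ m"]) simp
  qed
  then obtain y where y: "\<And>m. 0 \<le> y m" "\<And>m. y m < int p ^ m" "\<And>m. int p ^ m dvd Q * y m - E m"
    by metis
  have mod: "y (Suc m) mod int p ^ m = y m" for m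
  proof -
    have "int p ^ m dvd Q * y (Suc m) - E (Suc m)"
      by (rule dvd_trans[OF _ y(3)]) simp
    moreover have "int p ^ m dvd E (Suc m) - E m" using E by (simp add: coherent_def)
    ultimately have "int p ^ m dvd (Q * y (Suc m) - E (Suc m)) + (E (Suc m) - E m) - (Q * y m - E m)"
      using y(3) by (intro dvd_diff[OF dvd_add])
    hence "int p ^ m dvd Q * (y (Suc m) - y m)" by (simp add: algebra_simps)
    hence "int p ^ m dvd y (Suc m) - y m" unfolding dvd_mult_Q_iff .
    hence "y (Suc m) mod int p ^ m = y m mod int p ^ m" by (simp add: mod_eq_dvd_iff)
    thus ?thesis using y by simp
  qed
  \<comment> \<open>Consecutive solutions agree modulo p^m, so this quotient is the digit that
    extends \<open>y m\<close> to \<open>y (Suc m)\<close>.\<close>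
  define c where "c m = nat (y (Suc m) div int p ^ m)" for m
  have ge0: "0 \<le> y (Suc m) div int p ^ m" for m
    using y(1)[of "Suc m"] p_gt_1 by (simp add: pos_imp_zdiv_nonneg_iff)
  have sum: "digit_sum p c m = y m" for m
  proof (induction m)
    case 0
    show ?case using y(1,2)[of 0] by simp
  next
    case (Suc m)
    have "y (Suc m) = y (Suc m) mod int p ^ m + int (c m) * int p ^ m"
      using ge0[of m] mod_div_mult_eq[of "y (Suc m)" "int p ^ m"] by (simp add: c_def)
    thus ?case using Suc mod[of m] by simp
  qed
  show ?thesis
  proof (rule that[of c])
    fix i
    have "0 < int p ^ i" using p_gt_1 by simp
    hence "y (Suc i) div int p ^ i * int p ^ i \<le> y (Suc i)"
      using mod_div_mult_eq[of "y (Suc i)" "int p ^ i"] pos_mod_sign[of "int p ^ i" "y (Suc i)"]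
      by linarith
    also have "\<dots> < int p * int p ^ i" using y(2)[of "Suc i"] by simp
    finally have "y (Suc i) div int p ^ i < int p" by (rule mult_right_less_imp_less) simp
    thus "c i < p" using ge0[of i] by (simp add: c_def nat_less_iff)
  qed (simp add: sum y(3))
qed

end

section \<open>Address sums of an iterated function system\<close>

locale ifs_system =
  fixes p n :: nat and b k :: "nat \<Rightarrow> nat" and d :: "nat \<Rightarrow> rat"
  assumes data: "ifs_data p n b k d"
begin

definition common_den :: int where
  "common_den = (\<Prod>i\<in>{1..n}. snd (quotient_of (d i)))"

text \<open>The integer \<open>common_den * d i\<close>; the division of \<open>common_den\<close>
  by a single denominator is exact for indices in range.\<close>

definition shift :: "nat \<Rightarrow> int" where
  "shift i = fst (quotient_of (d i)) * (common_den div snd (quotient_of (d i)))"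

lemma prime: "prime p" and n_ge_1: "1 \<le> n"
  using data by (simp_all add: ifs_data_def)

lemma k_ge_1: "i \<in> {1..n} \<Longrightarrow> 1 \<le> k i" and b_cases: "i \<in> {1..n} \<Longrightarrow> b i \<in> {0, 1}"
  and d_Zp: "i \<in> {1..n} \<Longrightarrow> padic_abs p (d i) \<le> 1"
  using data by (auto simp: ifs_data_def Zp_def padic_norm_of_rat)

lemma common_den_pos: "0 < common_den"
  unfolding common_den_def by (rule prod_pos) (simp add: quotient_of_denom_pos')

text \<open>Here integrality of the translations enters: in lowest terms, a denominator divisible by
  p leaves a numerator prime to p, and the absolute value would be at least p.\<close>

lemma not_dvd_den:
  assumes "i \<in> {1..n}"
  shows "\<not> int p dvd snd (quotient_of (d i))"
proof
  obtain x y where xy: "quotient_of (d i) = (x, y)" by (cases "quotient_of (d i)")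
  assume "int p dvd snd (quotient_of (d i))"
  hence py: "int p dvd y" by (simp add: xy)
  have p1: "1 < p" by (rule prime_gt_1_nat[OF prime])
  have y: "0 < y" using xy by (rule quotient_of_denom_pos)
  have "coprime x y" using xy by (rule quotient_of_coprime)
  hence px: "\<not> int p dvd x"
    using py p1 coprime_common_divisor[of x y "int p"] by auto
  hence "x \<noteq> 0" by auto
  hence "d i \<noteq> 0" using xy by auto
  moreover have "multiplicity (int p) x = 0" using px by (rule not_dvd_imp_multiplicity_0)
  moreover have "1 \<le> multiplicity (int p) y"
    by (rule multiplicity_geI) (use py y p1 in auto)
  moreover from this have "real p powi 1 \<le> real p powi int (multiplicity (int p) y)"
    using p1 by (intro power_int_increasing) auto
  ultimately have "real p powi 1 \<le> padic_abs p (d i)"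
    unfolding padic_abs_def by (simp add: xy)
  thus False using d_Zp[OF assms] p1 by simp
qed

lemma coprime_common_den: "coprime common_den (int p)"
  unfolding common_den_def
proof (rule prod_coprime_left)
  fix i assume "i \<in> {1..n}"
  hence "\<not> int p dvd snd (quotient_of (d i))" by (rule not_dvd_den)
  moreover have "prime_elem (int p)" using prime by simp
  ultimately show "coprime (snd (quotient_of (d i))) (int p)"
    using prime_elem_imp_coprime coprime_commute by blast
qed

sublocale padic_fractions p common_den
  by unfold_locales (rule prime common_den_pos coprime_common_den)+

lemma of_int_shift:
  assumes "i \<in> {1..n}"
  shows "of_int (shift i) = (of_int common_den * d i :: rat)"
proof -
  obtain x y where xy: "quotient_of (d i) = (x, y)" by (cases "quotient_of (d i)")
  have y: "0 < y" using xy by (rule quotient_of_denom_pos)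
  have "y dvd common_den"
    unfolding common_den_def using dvd_prodI[OF _ assms, of "\<lambda>i. snd (quotient_of (d i))"] xy by simp
  then obtain z where z: "common_den = y * z" by blast
  hence "shift i = x * z" using y by (simp add: shift_def xy)
  thus ?thesis using y z quotient_of_div[OF xy] by simp
qed

definition addresses :: "(nat \<Rightarrow> nat) set" where
  "addresses = {a. \<forall>j. a j \<in> {1..n}}"

definition exp_sum :: "(nat \<Rightarrow> nat) \<Rightarrow> nat \<Rightarrow> nat" where
  "exp_sum a N = (\<Sum>i<N. k (a i))"

definition sgn_prod :: "(nat \<Rightarrow> nat) \<Rightarrow> nat \<Rightarrow> int" where
  "sgn_prod a N = (-1) ^ (\<Sum>i<N. b (a i))"

definition addr_sum :: "(nat \<Rightarrow> nat) \<Rightarrow> nat \<Rightarrow> int" where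
  "addr_sum a N = (\<Sum>j<N. sgn_prod a j * int p ^ exp_sum a j * shift (a j))"

definition point :: "(nat \<Rightarrow> nat) \<Rightarrow> (nat \<Rightarrow> rat) set" where
  "point a = frac_lim (addr_sum a)"

lemma addressesD: "a \<in> addresses \<Longrightarrow> a j \<in> {1..n}"
  unfolding addresses_def by blast

lemma addresses_nonempty: "addresses \<noteq> {}"
proof -
  have "(\<lambda>_. 1) \<in> addresses" using n_ge_1 by (simp add: addresses_def)
  thus ?thesis by blast
qed

lemma addresses_shift: "a \<in> addresses \<Longrightarrow> (\<lambda>j. a (J + j)) \<in> addresses"
  by (simp add: addresses_def)

lemma addresses_case_nat: "i \<in> {1..n} \<Longrightarrow> a \<in> addresses \<Longrightarrow> case_nat i a \<in> addresses"
  by (auto simp: addresses_def split: nat.split)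

lemma addresses_join:
  "a \<in> addresses \<Longrightarrow> a' \<in> addresses \<Longrightarrow> (\<lambda>i. if i < J then a i else a' (i - J)) \<in> addresses"
  by (auto simp: addresses_def)

lemma exp_sum_0 [simp]: "exp_sum a 0 = 0"
  and exp_sum_Suc [simp]: "exp_sum a (Suc N) = exp_sum a N + k (a N)"
  by (simp_all add: exp_sum_def)

lemma sgn_prod_0 [simp]: "sgn_prod a 0 = 1"
  and sgn_prod_Suc [simp]: "sgn_prod a (Suc N) = sgn_prod a N * (-1) ^ b (a N)"
  by (simp_all add: sgn_prod_def power_add)

lemma addr_sum_0 [simp]: "addr_sum a 0 = 0"
  and addr_sum_Suc [simp]:
    "addr_sum a (Suc N) = addr_sum a N + sgn_prod a N * int p ^ exp_sum a N * shift (a N)"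
  by (simp_all add: addr_sum_def)

lemma sgn_prod_cases: "sgn_prod a N = 1 \<or> sgn_prod a N = -1"
  unfolding sgn_prod_def by (cases "even (\<Sum>i<N. b (a i))") auto

lemma abs_sgn_prod [simp]: "\<bar>sgn_prod a N\<bar> = 1"
  using sgn_prod_cases[of a N] by auto

lemma exp_sum_less_Suc: "a \<in> addresses \<Longrightarrow> exp_sum a N < exp_sum a (Suc N)"
  using k_ge_1[OF addressesD, of a N] by simp

lemma exp_sum_strict_mono: "a \<in> addresses \<Longrightarrow> strict_mono (exp_sum a)"
  unfolding strict_mono_Suc_iff using exp_sum_less_Suc by blast

lemma exp_sum_ge: "a \<in> addresses \<Longrightarrow> N \<le> exp_sum a N"
  by (rule strict_mono_imp_increasing[OF exp_sum_strict_mono])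

text \<open>Every exponent \<open>k i\<close> is at least 1, so the term with index m is divisible
  by p^m.\<close>

lemma coherent_addr_sum:
  assumes "a \<in> addresses"
  shows "coherent p (addr_sum a)"
proof (rule coherentI)
  fix m
  have "int p ^ m dvd int p ^ exp_sum a m" by (rule le_imp_power_dvd[OF exp_sum_ge[OF assms]])
  thus "int p ^ m dvd addr_sum a (Suc m) - addr_sum a m" by simp
qed

text \<open>Sharper than coherence: after J letters the sum is final modulo p to the accumulated
  exponent, which may exceed J.\<close>

lemma addr_sum_exp_sum_dvd:
  assumes "a \<in> addresses" "J \<le> N"
  shows "int p ^ exp_sum a J dvd addr_sum a N - addr_sum a J"
  using assms(2)
proof (induction N rule: dec_induct)
  case (step N)
  have "exp_sum a J \<le> exp_sum a N"
    using strict_mono_less_eq[OF exp_sum_strict_mono[OF assms(1)]] step by simp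
  hence "int p ^ exp_sum a J dvd int p ^ exp_sum a N" by (rule le_imp_power_dvd)
  hence "int p ^ exp_sum a J dvd sgn_prod a N * int p ^ exp_sum a N * shift (a N)" by simp
  from dvd_add[OF this step(3)] show ?case by (simp add: algebra_simps)
qed simp

section \<open>Splitting and joining addresses\<close>

lemma exp_sum_split: "exp_sum a (J + N) = exp_sum a J + exp_sum (\<lambda>j. a (J + j)) N"
  by (induction N) auto

lemma sgn_prod_split: "sgn_prod a (J + N) = sgn_prod a J * sgn_prod (\<lambda>j. a (J + j)) N"
  by (induction N) auto

text \<open>Self-similarity for partial sums: the first J maps act as one similarity with scaled
  translation \<open>addr_sum a J\<close>, applied to the shifted address.\<close>

lemma addr_sum_split:
  "addr_sum a (J + N) =
    addr_sum a J + sgn_prod a J * int p ^ exp_sum a J * addr_sum (\<lambda>j. a (J + j)) N"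
  by (induction N) (auto simp: exp_sum_split sgn_prod_split power_add distrib_left mult_ac)

lemma addr_sum_cong:
  assumes "\<And>i. i < N \<Longrightarrow> a i = a' i"
  shows "exp_sum a N = exp_sum a' N" "sgn_prod a N = sgn_prod a' N" "addr_sum a N = addr_sum a' N"
  using assms by (induction N) auto

lemma addr_sum_join:
  fixes J N :: nat and a a' :: "nat \<Rightarrow> nat"
  defines "c \<equiv> (\<lambda>i. if i < J then a i else a' (i - J))"
  shows "addr_sum c (J + N) = addr_sum a J + sgn_prod a J * int p ^ exp_sum a J * addr_sum a' N"
proof -
  have "addr_sum c J = addr_sum a J" "sgn_prod c J = sgn_prod a J" "exp_sum c J = exp_sum a J"
    by (rule addr_sum_cong; simp add: c_def)+
  moreover have "(\<lambda>j. c (J + j)) = a'" by (simp add: c_def)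
  ultimately show ?thesis by (simp add: addr_sum_split)
qed

lemma addr_sum_case_nat:
  "addr_sum (case_nat i a) (Suc N) = shift i + (-1) ^ b i * int p ^ k i * addr_sum a N"
  using addr_sum_split[of "case_nat i a" 1 N] by simp

lemma address_value_point:
  assumes a: "a \<in> addresses"
  shows "address_value p b k d a (point a)"
proof -
  have "of_int (addr_sum a N) / of_int common_den =
      (\<Sum>j<N. (-1) ^ (\<Sum>i<j. b (a i)) * of_nat p ^ (\<Sum>i<j. k (a i)) * d (a j))" for N
  proof -
    have "of_int (addr_sum a N) = (\<Sum>j<N. (-1) ^ (\<Sum>i<j. b (a i)) * of_nat p ^ (\<Sum>i<j. k (a i)) *
        (of_int common_den * d (a j)))"
      using of_int_shift[OF addressesD[OF a]] by (simp add: addr_sum_def sgn_prod_def exp_sum_def)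
    also have "\<dots> = of_int common_den *
        (\<Sum>j<N. (-1) ^ (\<Sum>i<j. b (a i)) * of_nat p ^ (\<Sum>i<j. k (a i)) * d (a j))"
      by (simp add: sum_distrib_left mult_ac)
    finally show ?thesis using common_den_pos by simp
  qed
  thus ?thesis using limitin_frac_lim[OF coherent_addr_sum[OF a]]
    by (simp add: address_value_def point_def)
qed

lemma dist_point_le_iff:
  assumes "a \<in> addresses" "a' \<in> addresses"
  shows "padic_dist p (point a) (point a') \<le> 1 / real p ^ m \<longleftrightarrow>
    int p ^ m dvd addr_sum a m - addr_sum a' m"
  unfolding point_def using assms coherent_addr_sum padic_dist_frac_lim_le_iff by blast

lemma padic_expansion_point_iff:
  assumes "a \<in> addresses"
  shows "padic_expansion p c (point a) \<longleftrightarrow>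
    (\<forall>i. c i < p) \<and> (\<forall>m. int p ^ m dvd common_den * digit_sum p c m - addr_sum a m)"
  unfolding point_def by (rule padic_expansion_frac_lim_iff[OF coherent_addr_sum[OF assms]])

section \<open>The attractor\<close>

lemma point_carrier: "a \<in> addresses \<Longrightarrow> point a \<in> carrier (Qp p)"
  unfolding point_def by (rule frac_lim_carrier[OF coherent_addr_sum])

lemma ifs_map_point:
  assumes a: "a \<in> addresses" and i: "i \<in> {1..n}"
  shows "ifs_map p b k d i (point a) = point (case_nat i a)"
proof -
  let ?E = "addr_sum (case_nat i a)"
  have E: "coherent p ?E" by (rule coherent_addr_sum[OF addresses_case_nat[OF i a]])
  \<comment> \<open>Prepending a letter advances the index of the partial sums by one, which leaves
    the limit unchanged.\<close>
  hence E': "coherent p (\<lambda>N. ?E (Suc N))"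
    unfolding coherent_def by (metis Suc_le_mono dvd_trans le_imp_power_dvd lessI less_imp_le)
  have "of_int (?E (Suc N)) / of_int common_den =
      ((-1) ^ b i * of_nat p ^ k i * (of_int (addr_sum a N) / of_int common_den) + d i :: rat)" for N
    unfolding addr_sum_case_nat using common_den_pos of_int_shift[OF i]
    by (simp add: add_divide_distrib)
  hence "ifs_map p b k d i (point a) = frac_lim (\<lambda>N. ?E (Suc N))"
    unfolding point_def frac_lim_def ifs_map_class[OF prime frac_seq_cauchy[OF coherent_addr_sum[OF a]]]
    by (simp add: frac_seq_def)
  also have "\<dots> = frac_lim ?E"
    unfolding frac_lim_eq_iff[OF E' E] using E by (simp add: coherent_def del: addr_sum_Suc)
  finally show ?thesis by (simp add: point_def)
qed

lemma ifs_map_contraction: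
  assumes X: "X \<in> carrier (Qp p)" and Y: "Y \<in> carrier (Qp p)" and i: "i \<in> {1..n}"
  shows "padic_dist p (ifs_map p b k d i X) (ifs_map p b k d i Y) \<le> padic_dist p X Y / real p"
proof -
  obtain x y where x: "x \<in> padic_cauchy p" "X = padic_class p x"
    and y: "y \<in> padic_cauchy p" "Y = padic_class p y"
    using X Y Qp_carrierE[OF prime] by metis
  let ?g = "(-1) ^ b i * of_nat p ^ k i :: rat"
  have "int p dvd int p ^ k i" using k_ge_1[OF i] by (intro dvd_power) auto
  hence "int p ^ 1 dvd common_den * ((-1) ^ b i * int p ^ k i)" by simp
  from padic_abs_quotient_le[OF this] have g: "padic_abs p ?g \<le> 1 / real p"
    using common_den_pos by simp
  have "(\<lambda>N. ?g * z N + d i) \<in> padic_cauchy p" if "z \<in> padic_cauchy p" for z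
    by (rule padic_cauchy_add[OF prime padic_cauchy_cmult[OF prime that] padic_cauchy_const[OF prime]])
  from padic_dist_tendsto[OF prime this[OF x(1)] this[OF y(1)]]
  have l1: "(\<lambda>N. padic_abs p ?g * padic_abs p (x N - y N)) \<longlonglongrightarrow>
      padic_dist p (ifs_map p b k d i X) (ifs_map p b k d i Y)"
    unfolding x(2) y(2) ifs_map_class[OF prime x(1)] ifs_map_class[OF prime y(1)]
    by (simp add: padic_abs_mult[OF prime] flip: right_diff_distrib)
  have l2: "(\<lambda>N. 1 / real p * padic_abs p (x N - y N)) \<longlonglongrightarrow> 1 / real p * padic_dist p X Y"
    unfolding x(2) y(2) by (rule tendsto_mult_left[OF padic_dist_tendsto[OF prime x(1) y(1)]])
  have "padic_dist p (ifs_map p b k d i X) (ifs_map p b k d i Y) \<le> 1 / real p * padic_dist p X Y"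
    by (rule LIMSEQ_le[OF l1 l2]) (intro exI allI impI mult_right_mono g padic_abs_nonneg)
  thus ?thesis by simp
qed

text \<open>The points form the continuous image of a product of finite discrete spaces: addresses
  that agree in m letters give points at distance at most p^-m.\<close>

lemma compactin_points: "compactin (padic_topology p) (point ` addresses)"
proof -
  interpret M: Metric_space "carrier (Qp p)" "padic_dist p" by (rule padic_metric_space[OF prime])
  let ?T = "product_topology (\<lambda>_. discrete_topology {1..n}) (UNIV :: nat set)"
  have top: "topspace ?T = addresses" by (auto simp: addresses_def PiE_def)
  have "continuous_map ?T M.mtopology point"
    unfolding M.continuous_map_to_metric
  proof (intro ballI allI impI)
    fix a and e :: real assume "a \<in> topspace ?T" "e > 0"
    hence a: "a \<in> addresses" using top by simp
    obtain m where m: "1 / real p ^ m < e" using inverse_power_less[OF \<open>e > 0\<close>] .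
    let ?U = "\<Pi>\<^sub>E i\<in>UNIV. if i < m then {a i} else {1..n}"
    have "finite {i. (if i < m then {a i} else {1..n}) \<noteq> {1..n}}"
      by (rule finite_subset[of _ "{..<m}"]) auto
    hence open_U: "openin ?T ?U"
      by (intro product_topology_basis) (use addressesD[OF a] in auto)
    have "point a' \<in> M.mball (point a) e" if "a' \<in> ?U" for a'
    proof -
      have "a' i \<in> (if i < m then {a i} else {1..n})" for i using that by (rule PiE_mem) simp
      hence a': "a' i = a i" if "i < m" for i using that by (metis singletonD)
      have "a' \<in> addresses" using open_U that openin_subset top by blast
      moreover have "addr_sum a m = addr_sum a' m" using a' by (intro addr_sum_cong) simp
      ultimately have "padic_dist p (point a) (point a') \<le> 1 / real p ^ m"
        using dist_point_le_iff[OF a] by simp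
      thus ?thesis using m a \<open>a' \<in> addresses\<close> by (simp add: point_carrier)
    qed
    moreover have "a \<in> ?U" using addressesD[OF a] by auto
    ultimately show "\<exists>U. openin ?T U \<and> a \<in> U \<and> (\<forall>a'\<in>U. point a' \<in> M.mball (point a) e)"
      using open_U by blast
  qed
  moreover have "compact_space ?T"
    by (simp add: compact_space_product_topology compact_space_discrete_topology)
  hence "compactin ?T addresses" unfolding compact_space_def top .
  ultimately show ?thesis unfolding padic_topology_def by (rule image_compactin[rotated])
qed

lemma points_fixed: "point ` addresses = (\<Union>i\<in>{1..n}. ifs_map p b k d i ` point ` addresses)"
proof (intro equalityI subsetI)
  fix x assume "x \<in> point ` addresses"
  then obtain a where a: "a \<in> addresses" "x = point a" by blast
  have "a = case_nat (a 0) (\<lambda>j. a (1 + j))" by (auto split: nat.split)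
  hence "x = ifs_map p b k d (a 0) (point (\<lambda>j. a (1 + j)))"
    using ifs_map_point[OF addresses_shift[OF a(1)] addressesD[OF a(1)]] a(2) by metis
  thus "x \<in> (\<Union>i\<in>{1..n}. ifs_map p b k d i ` point ` addresses)"
    using addresses_shift[OF a(1)] addressesD[OF a(1)] by blast
next
  fix x assume "x \<in> (\<Union>i\<in>{1..n}. ifs_map p b k d i ` point ` addresses)"
  then obtain i a where "i \<in> {1..n}" "a \<in> addresses" "x = ifs_map p b k d i (point a)" by blast
  thus "x \<in> point ` addresses" using ifs_map_point addresses_case_nat by auto
qed

text \<open>Both inclusions are pointwise approximations. Applying the same J maps to two points at
  distance at most \<open>B\<close> brings them within \<open>B / p ^ J\<close>, and compact sets
  contain the resulting limits. \<open>B\<close> bounds the union of both sets, which provides the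
  start J = 0 in either direction.\<close>

lemma attractor_unique:
  assumes L: "L \<noteq> {}" "compactin (padic_topology p) L" "L = (\<Union>i\<in>{1..n}. ifs_map p b k d i ` L)"
  shows "L = point ` addresses"
proof -
  interpret M: Metric_space "carrier (Qp p)" "padic_dist p" by (rule padic_metric_space[OF prime])
  let ?F = "ifs_map p b k d"
  have "compactin M.mtopology (L \<union> point ` addresses)"
    using L(2) compactin_points unfolding padic_topology_def by (rule compactin_Un)
  hence "M.mbounded (L \<union> point ` addresses)" by (rule M.compactin_imp_mbounded)
  hence sub: "L \<subseteq> carrier (Qp p)"
    and "\<exists>B. \<forall>x\<in>L \<union> point ` addresses. \<forall>y\<in>L \<union> point ` addresses. padic_dist p x y \<le> B"
    unfolding M.mbounded_alt by simp_all
  then obtain B where B: "\<And>x y. x \<in> L \<union> point ` addresses \<Longrightarrow> y \<in> L \<union> point ` addresses \<Longrightarrow> padic_dist p x y \<le> B"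
    by metis
  have mem_L: "z \<in> L \<longleftrightarrow> (\<exists>i\<in>{1..n}. \<exists>y\<in>L. z = ?F i y)" for z
  proof -
    have "z \<in> L \<longleftrightarrow> z \<in> (\<Union>i\<in>{1..n}. ?F i ` L)" by (rule arg_cong[OF L(3)])
    thus ?thesis by blast
  qed
  have contr: "padic_dist p (?F i x) (?F i y) \<le> B / real p ^ Suc J"
    if "padic_dist p x y \<le> B / real p ^ J" "x \<in> carrier (Qp p)" "y \<in> carrier (Qp p)" "i \<in> {1..n}"
    for i x y J
  proof -
    have "padic_dist p x y / real p \<le> B / real p ^ J / real p"
      using that p_gt_1 by (intro divide_right_mono) auto
    thus ?thesis using ifs_map_contraction[OF that(2-4)] by (simp add: mult.commute)
  qed
  show ?thesis
  proof (intro equalityI subsetI)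
    fix x assume x: "x \<in> L"
    have "\<exists>i y. i \<in> {1..n} \<and> y \<in> L \<and> z = ?F i y" if "z \<in> L" for z
      using that mem_L[of z] by blast
    then obtain A N where AN: "\<And>z. z \<in> L \<Longrightarrow> A z \<in> {1..n}" "\<And>z. z \<in> L \<Longrightarrow> N z \<in> L"
      "\<And>z. z \<in> L \<Longrightarrow> z = ?F (A z) (N z)" by metis
    \<comment> \<open>\<open>A z\<close> is a letter whose map sends \<open>N z\<close>, again in
      \<open>L\<close>, to z. Iterating backwards along these preimages spells an address of
      z.\<close>
    define adr where "adr z = (\<lambda>j. A ((N ^^ j) z))" for z
    have N_iter: "(N ^^ j) z \<in> L" if "z \<in> L" for j z
      by (induction j) (auto simp: that AN)
    have adr: "adr z \<in> addresses" if "z \<in> L" for z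
      using AN(1) N_iter[OF that] by (simp add: adr_def addresses_def)
    have adr_eq: "adr z = case_nat (A z) (adr (N z))" for z
      by (auto simp: adr_def funpow_swap1 split: nat.split)
    have "padic_dist p z (point (adr z)) \<le> B / real p ^ J" if "z \<in> L" for J z
      using that
    proof (induction J arbitrary: z)
      case 0
      thus ?case using B adr by simp
    next
      case (Suc J)
      have "padic_dist p (?F (A z) (N z)) (?F (A z) (point (adr (N z)))) \<le> B / real p ^ Suc J"
        by (rule contr[OF Suc.IH]) (use Suc.prems AN(1,2) adr point_carrier sub in auto)
      moreover have "padic_dist p z (point (adr z)) =
          padic_dist p (?F (A z) (N z)) (?F (A z) (point (adr (N z))))"
      proof (rule arg_cong2[where f = "padic_dist p"])
        show "z = ?F (A z) (N z)" by (rule AN(3)[OF Suc.prems])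
        show "point (adr z) = ?F (A z) (point (adr (N z)))"
          using ifs_map_point[OF adr[OF AN(2)] AN(1), OF Suc.prems Suc.prems] adr_eq[of z] by simp
      qed
      ultimately show ?case by (simp only:)
    qed
    hence "\<exists>y\<in>point ` addresses. padic_dist p x y \<le> B / real p ^ J" for J
      using x adr by blast
    thus "x \<in> point ` addresses" using compactin_padic_limit[OF compactin_points] x sub by blast
  next
    fix x assume "x \<in> point ` addresses"
    then obtain a where a: "a \<in> addresses" "x = point a" by blast
    have "\<exists>y\<in>L. padic_dist p (point a) y \<le> B / real p ^ J" if "a \<in> addresses" for J a
      using that
    proof (induction J arbitrary: a)
      case 0
      thus ?case using B L(1) by auto
    next
      case (Suc J)
      have a': "(\<lambda>j. a (1 + j)) \<in> addresses" by (rule addresses_shift[OF Suc.prems])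
      then obtain y where y: "y \<in> L" "padic_dist p (point (\<lambda>j. a (1 + j))) y \<le> B / real p ^ J"
        using Suc.IH by blast
      have "padic_dist p (?F (a 0) (point (\<lambda>j. a (1 + j)))) (?F (a 0) y) \<le> B / real p ^ Suc J"
        by (rule contr) (use y sub a' point_carrier addressesD[OF Suc.prems] in auto)
      moreover have "a = case_nat (a 0) (\<lambda>j. a (1 + j))" by (auto split: nat.split)
      moreover have "?F (a 0) y \<in> L"
        using mem_L[of "?F (a 0) y"] y(1) addressesD[OF Suc.prems] by blast
      ultimately show ?case using ifs_map_point[OF a' addressesD[OF Suc.prems, of 0]] by metis
    qed
    thus "x \<in> L" using compactin_padic_limit[OF L(2), of x B] a point_carrier by simp
  qed
qed

lemma attractor_eq: "ifs_attractor p n b k d = point ` addresses"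
  unfolding ifs_attractor_def padic_self_similar_set_def
proof (rule the_equality)
  show "point ` addresses \<noteq> {} \<and> compactin (padic_topology p) (point ` addresses) \<and>
      point ` addresses = (\<Union>i\<in>{1..n}. ifs_map p b k d i ` point ` addresses)"
    using addresses_nonempty compactin_points points_fixed by blast
qed (use attractor_unique in blast)

section \<open>The transducer\<close>

text \<open>What remains of the partial sum of the first J terms, scaled by the common denominator,
  after the first i digits have been read off.\<close>

definition carry :: "(nat \<Rightarrow> nat) \<Rightarrow> (nat \<Rightarrow> nat) \<Rightarrow> nat \<Rightarrow> nat \<Rightarrow> int" where
  "carry a c i J = (addr_sum a J - common_den * digit_sum p c i) div int p ^ i"

definition shift_bound :: int where
  "shift_bound = (\<Sum>i\<in>{1..n}. \<bar>shift i\<bar>)"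

lemma abs_shift_le: "i \<in> {1..n} \<Longrightarrow> \<bar>shift i\<bar> \<le> shift_bound"
  unfolding shift_bound_def by (rule member_le_sum) auto

lemma shift_bound_nonneg: "0 \<le> shift_bound"
  unfolding shift_bound_def by (rule sum_nonneg) simp

text \<open>If e is the exponent so far, old bound and new term are both at most B p^e. Their sum 2
  B p^e is covered because p is at least 2 and the exponent grows by at least 1.\<close>

lemma abs_addr_sum_le:
  assumes a: "a \<in> addresses" and B: "\<And>i. i \<in> {1..n} \<Longrightarrow> \<bar>shift i\<bar> \<le> B"
  shows "\<bar>addr_sum a J\<bar> \<le> B * int p ^ exp_sum a J"
proof (induction J)
  case 0
  have "0 \<le> B" using B[OF addressesD[OF a, of 0]] by linarith
  thus ?case by simp
next
  case (Suc J)
  have B0: "0 \<le> B" using B[OF addressesD[OF a, of 0]] by linarith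
  have "\<bar>addr_sum a (Suc J)\<bar> \<le> \<bar>addr_sum a J\<bar> + \<bar>sgn_prod a J * int p ^ exp_sum a J * shift (a J)\<bar>"
    unfolding addr_sum_Suc by (rule abs_triangle_ineq)
  also have "\<bar>sgn_prod a J * int p ^ exp_sum a J * shift (a J)\<bar> = int p ^ exp_sum a J * \<bar>shift (a J)\<bar>"
    by (simp add: abs_mult)
  also have "\<dots> \<le> int p ^ exp_sum a J * B"
    by (rule mult_left_mono[OF B[OF addressesD[OF a]]]) simp
  finally have "\<bar>addr_sum a (Suc J)\<bar> \<le> B * (2 * int p ^ exp_sum a J)" using Suc by (simp add: mult.commute)
  also have "\<dots> \<le> B * int p ^ exp_sum a (Suc J)"
  proof (rule mult_left_mono[OF _ B0])
    have "2 * int p ^ exp_sum a J \<le> int p * int p ^ exp_sum a J"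
      using p_gt_1 by (intro mult_right_mono) auto
    also have "\<dots> = int p ^ Suc (exp_sum a J)" by simp
    also have "\<dots> \<le> int p ^ exp_sum a (Suc J)"
      using exp_sum_less_Suc[OF a, of J] p_gt_1 by (intro power_increasing) auto
    finally show "2 * int p ^ exp_sum a J \<le> int p ^ exp_sum a (Suc J)" .
  qed
  finally show ?case .
qed

text \<open>The sum with fewer terms is already final modulo p^i: by coherence if it has i terms, by
  its accumulated exponent if it has J.\<close>

lemma addr_sum_dvd:
  assumes a: "a \<in> addresses" and i: "i \<le> exp_sum a J"
  shows "int p ^ i dvd addr_sum a J - addr_sum a i"
proof (cases "i \<le> J")
  case True
  thus ?thesis using coherent_addr_sum[OF a] by (simp add: coherent_def)
next
  case False
  hence "int p ^ exp_sum a J dvd addr_sum a i - addr_sum a J"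
    by (intro addr_sum_exp_sum_dvd[OF a]) simp
  hence "int p ^ i dvd addr_sum a i - addr_sum a J"
    by (rule dvd_trans[OF le_imp_power_dvd[OF i]])
  thus ?thesis by (simp only: dvd_diff_commute)
qed

lemma carry_mult:
  assumes a: "a \<in> addresses" and c: "\<And>m. int p ^ m dvd common_den * digit_sum p c m - addr_sum a m"
    and i: "i \<le> exp_sum a J"
  shows "int p ^ i * carry a c i J = addr_sum a J - common_den * digit_sum p c i"
proof -
  from dvd_diff[OF addr_sum_dvd[OF a i] c[of i]] have "int p ^ i dvd addr_sum a J - common_den * digit_sum p c i"
    by simp
  thus ?thesis unfolding carry_def by (rule dvd_mult_div_cancel)
qed

text \<open>\<open>l\<close> bounds how far the exponent runs ahead of the digits: 0 for the
  transducer, which outputs all determined digits at once, and \<open>exp_bound\<close> for the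
  automaton.\<close>

lemma abs_carry_le:
  assumes a: "a \<in> addresses" and c: "\<And>m. int p ^ m dvd common_den * digit_sum p c m - addr_sum a m"
    and digits: "\<And>i. c i < p" and i: "i \<le> exp_sum a J" "exp_sum a J \<le> i + l"
  shows "\<bar>carry a c i J\<bar> \<le> shift_bound * int p ^ l + common_den"
proof -
  have "int p ^ i * \<bar>carry a c i J\<bar> = \<bar>addr_sum a J - common_den * digit_sum p c i\<bar>"
    using carry_mult[OF a c i(1)] by (simp add: abs_mult flip: carry_mult[OF a c i(1)])
  also have "\<dots> \<le> \<bar>addr_sum a J\<bar> + \<bar>common_den * digit_sum p c i\<bar>" by (rule abs_triangle_ineq4)
  also have "\<bar>common_den * digit_sum p c i\<bar> = common_den * digit_sum p c i"
    using common_den_pos digit_sum_bounds(1)[of i c p] digits by simp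
  also have "\<dots> \<le> common_den * int p ^ i"
    using common_den_pos digit_sum_bounds(2)[of i c p] digits by (intro mult_left_mono) auto
  also have "\<bar>addr_sum a J\<bar> \<le> shift_bound * int p ^ exp_sum a J"
    by (rule abs_addr_sum_le[OF a abs_shift_le])
  also have "\<dots> \<le> shift_bound * int p ^ (i + l)"
    using p_gt_1 i(2) by (intro mult_left_mono[OF _ shift_bound_nonneg] power_increasing) auto
  finally have "int p ^ i * \<bar>carry a c i J\<bar> \<le> int p ^ i * (shift_bound * int p ^ l + common_den)"
    by (simp add: power_add algebra_simps)
  thus ?thesis using p_gt_1 by simp
qed

lemma digit_sum_split:
  "digit_sum p c (i + m) = digit_sum p c i + int p ^ i * digit_sum p (\<lambda>j. c (i + j)) m"
  by (induction m) (auto simp: power_add algebra_simps)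

definition transducer_states :: "(int \<times> int) set" where
  "transducer_states =
     {1, -1} \<times> {- (shift_bound + common_den)..shift_bound + common_den}"

text \<open>In state (s, u) the output still due is the expansion of (u + s x) / Q, where x / Q is
  the point of the unread address. Reading i splits off the first \<open>k i\<close> digits of (u +
  s Q d_i) / Q and leaves u'. Determinism is not built in; it follows from uniqueness of
  digits.\<close>

definition transducer_edges :: "((int \<times> int) \<times> nat \<times> nat list \<times> int \<times> int) set" where
  "transducer_edges =
     {((s, u), i, w, (s', u')).
        (s, u) \<in> transducer_states \<and> (s', u') \<in> transducer_states \<and> i \<in> {1..n} \<and>
        set w \<subseteq> {0..<p} \<and> length w = k i \<and> s' = s * (-1) ^ b i \<and>
        u + s * shift i = common_den * digit_sum p (\<lambda>j. w ! j) (k i) + int p ^ k i * u'}"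

definition ifs_transducer :: "(nat, nat, nat) transducer" where
  "ifs_transducer =
     \<lparr> tr_states = to_nat ` transducer_states,
       tr_init = to_nat (1 :: int, 0 :: int),
       tr_edges = (\<lambda>(q, i, w, q'). (to_nat q, i, w, to_nat q')) ` transducer_edges \<rparr>"

lemma finite_ifs_transducer: "finite_transducer {1..n} {0..<p} ifs_transducer"
proof -
  have fin: "finite transducer_states" by (simp add: transducer_states_def)
  have "transducer_edges \<subseteq> transducer_states \<times> {1..n} \<times>
      (\<Union>i\<in>{1..n}. {w. set w \<subseteq> {0..<p} \<and> length w = k i}) \<times> transducer_states"
    by (auto simp: transducer_edges_def)
  moreover have "finite (transducer_states \<times> {1..n} \<times>
      (\<Union>i\<in>{1..n}. {w. set w \<subseteq> {0..<p} \<and> length w = k i}) \<times> transducer_states)"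
    using fin by (intro finite_cartesian_product finite_UN_I finite_lists_length_eq) auto
  ultimately have "finite transducer_edges" by (rule finite_subset)
  moreover have "(1, 0) \<in> transducer_states"
    using common_den_pos shift_bound_nonneg by (simp add: transducer_states_def)
  moreover have "transducer_edges \<subseteq> transducer_states \<times> {1..n} \<times> lists {0..<p} \<times> transducer_states"
    by (auto simp: transducer_edges_def)
  ultimately show ?thesis using fin by (fastforce simp: finite_transducer_def ifs_transducer_def)
qed

lemma ifs_transducer_edge_iff:
  "(to_nat q, i, w, r) \<in> tr_edges ifs_transducer \<longleftrightarrow> (\<exists>q'. r = to_nat q' \<and> (q, i, w, q') \<in> transducer_edges)"
  by (force simp: ifs_transducer_def)

lemma transduces_expansion:
  assumes a: "a \<in> addresses" and digits: "\<And>i. c i < p"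
    and c: "\<And>m. int p ^ m dvd common_den * digit_sum p c m - addr_sum a m"
  shows "transduces ifs_transducer a c"
proof -
  let ?K = "exp_sum a" and ?D = "digit_sum p c"
  have carry: "int p ^ ?K j * carry a c (?K j) j = addr_sum a j - common_den * ?D (?K j)" for j
    by (rule carry_mult[OF a c]) simp
  define q where "q j = to_nat (sgn_prod a j, carry a c (?K j) j)" for j
  define w where "w j = map c [?K j..<?K (Suc j)]" for j
  have state: "(sgn_prod a j, carry a c (?K j) j) \<in> transducer_states" for j
    using sgn_prod_cases[of a j] abs_carry_le[OF a c digits, of "?K j" j 0]
    by (auto simp: transducer_states_def abs_le_iff)
  have "tr_path ifs_transducer a q w"
    unfolding tr_path_def
  proof (intro conjI allI)
    show "q 0 = tr_init ifs_transducer" by (simp add: q_def ifs_transducer_def carry_def)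
    fix j
    have "digit_sum p (\<lambda>i. w j ! i) (k (a j)) = digit_sum p (\<lambda>i. c (?K j + i)) (k (a j))"
      by (rule digit_sum_cong) (simp add: w_def)
    hence D: "?D (?K (Suc j)) = ?D (?K j) + int p ^ ?K j * digit_sum p (\<lambda>i. w j ! i) (k (a j))"
      by (simp add: digit_sum_split)
    have "int p ^ ?K j * (carry a c (?K j) j + sgn_prod a j * shift (a j)) =
        int p ^ ?K j * (common_den * digit_sum p (\<lambda>i. w j ! i) (k (a j)) +
          int p ^ k (a j) * carry a c (?K (Suc j)) (Suc j))"
      using carry[of j] carry[of "Suc j"] D by (simp add: power_add algebra_simps)
    hence "carry a c (?K j) j + sgn_prod a j * shift (a j) =
        common_den * digit_sum p (\<lambda>i. w j ! i) (k (a j)) +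
          int p ^ k (a j) * carry a c (?K (Suc j)) (Suc j)"
      using p_gt_1 by simp
    moreover have "set (w j) \<subseteq> {0..<p}" "length (w j) = k (a j)"
      using digits by (auto simp: w_def)
    ultimately have "((sgn_prod a j, carry a c (?K j) j), a j, w j,
        (sgn_prod a (Suc j), carry a c (?K (Suc j)) (Suc j))) \<in> transducer_edges"
      using state[of j] state[of "Suc j"] addressesD[OF a, of j] unfolding transducer_edges_def by simp
    thus "(q j, a j, w j, q (Suc j)) \<in> tr_edges ifs_transducer"
      unfolding q_def ifs_transducer_edge_iff by blast
  qed
  moreover have "concatenation_is w c" if path: "tr_path ifs_transducer a q w" for q w
  proof -
    \<comment> \<open>An invariant of an arbitrary path. The existence of some carry u is enough to
      force the output so far.\<close>
    have inv: "\<exists>u. q j = to_nat (sgn_prod a j, u) \<and>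
        addr_sum a j = common_den * ?D (?K j) + int p ^ ?K j * u \<and>
        concat (map w [0..<j]) = map c [0..<?K j]" for j
    proof (induction j)
      case 0
      show ?case using path by (auto simp: tr_path_def ifs_transducer_def)
    next
      case (Suc j)
      then obtain u where u: "q j = to_nat (sgn_prod a j, u)"
        "addr_sum a j = common_den * ?D (?K j) + int p ^ ?K j * u"
        "concat (map w [0..<j]) = map c [0..<?K j]" by blast
      have "(to_nat (sgn_prod a j, u), a j, w j, q (Suc j)) \<in> tr_edges ifs_transducer"
        using path u(1) by (metis tr_path_def)
      then obtain s' u' where q': "q (Suc j) = to_nat (s', u')"
        and edge: "((sgn_prod a j, u), a j, w j, (s', u')) \<in> transducer_edges"
        unfolding ifs_transducer_edge_iff by (metis surj_pair)
      have s': "s' = sgn_prod a (Suc j)" and w: "set (w j) \<subseteq> {0..<p}" "length (w j) = k (a j)"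
        and u': "u + sgn_prod a j * shift (a j) =
          common_den * digit_sum p (\<lambda>i. w j ! i) (k (a j)) + int p ^ k (a j) * u'"
        using edge by (auto simp: transducer_edges_def)
      \<comment> \<open>The known digits continued by the block \<open>w j\<close>. The edge
        equation makes this sequence correct modulo p^\<open>exp_sum a (Suc j)\<close>, so
        uniqueness identifies the block with the digits of c.\<close>
      define c' where "c' i = (if i < ?K j then c i else w j ! (i - ?K j))" for i
      have "digit_sum p c' (?K j) = ?D (?K j)" by (rule digit_sum_cong) (simp add: c'_def)
      hence D': "digit_sum p c' (?K (Suc j)) =
          ?D (?K j) + int p ^ ?K j * digit_sum p (\<lambda>i. w j ! i) (k (a j))"
        by (simp add: digit_sum_split c'_def)
      have E: "addr_sum a (Suc j) = common_den * digit_sum p c' (?K (Suc j)) + int p ^ ?K (Suc j) * u'"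
      proof -
        have "addr_sum a (Suc j) = common_den * ?D (?K j) + int p ^ ?K j * (u + sgn_prod a j * shift (a j))"
          using u(2) by (simp add: algebra_simps)
        thus ?thesis unfolding u' D' by (simp add: power_add algebra_simps)
      qed
      have "c i = c' i" if "i < ?K (Suc j)" for i
      proof (rule digits_unique[OF digits _ _ that])
        show "c' i < p" if "i < ?K (Suc j)" for i
        proof (cases "i < ?K j")
          case False
          hence "w j ! (i - ?K j) \<in> set (w j)" using that w(2) by (intro nth_mem) simp
          thus ?thesis using w(1) False by (auto simp: c'_def)
        qed (simp add: c'_def digits)
        have "common_den * ?D (?K (Suc j)) - common_den * digit_sum p c' (?K (Suc j)) =
            int p ^ ?K (Suc j) * (u' - carry a c (?K (Suc j)) (Suc j))"
          using E carry[of "Suc j"] by (simp add: algebra_simps)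
        thus "int p ^ ?K (Suc j) dvd common_den * ?D (?K (Suc j)) - common_den * digit_sum p c' (?K (Suc j))"
          by (simp only: dvd_triv_left)
      qed
      hence cc': "c' i = c i" if "i < ?K (Suc j)" for i using that by simp
      have "digit_sum p c' (?K (Suc j)) = ?D (?K (Suc j))" by (rule digit_sum_cong[OF cc'])
      moreover have "w j = map c [?K j..<?K (Suc j)]"
      proof (rule nth_equalityI)
        fix i assume "i < length (w j)"
        hence "i < k (a j)" using w by simp
        thus "w j ! i = map c [?K j..<?K (Suc j)] ! i"
          using cc'[of "?K j + i"] by (simp add: c'_def)
      qed (simp add: w)
      moreover have "[0..<?K (Suc j)] = [0..<?K j] @ [?K j..<?K (Suc j)]"
        using upt_add_eq_append[of 0 "?K j" "k (a j)"] by simp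
      ultimately show ?case using q' s' E u(3) by (intro exI[of _ u']) simp
    qed
    have "length (concat (map w [0..<N])) = ?K N" for N
      using inv[of N] by (metis length_map length_upt diff_zero)
    moreover have "concat (map w [0..<N]) = map c [0..<?K N]" for N using inv[of N] by blast
    ultimately show ?thesis unfolding concatenation_is_def using exp_sum_ge[OF a] by metis
  qed
  ultimately show ?thesis unfolding transduces_def by blast
qed

lemma transducer_correct:
  assumes "\<And>j. a j \<in> {1..n}"
  shows "\<exists>x\<in>ifs_attractor p n b k d. \<exists>c.
    address_value p b k d a x \<and> padic_expansion p c x \<and> transduces ifs_transducer a c"
proof -
  have a: "a \<in> addresses" using assms by (simp add: addresses_def)
  obtain c where "\<And>i. c i < p" "\<And>m. int p ^ m dvd common_den * digit_sum p c m - addr_sum a m"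
    using digits_exist[OF coherent_addr_sum[OF a]] by blast
  thus ?thesis
    using a address_value_point[OF a] transduces_expansion[OF a, of c]
      padic_expansion_point_iff[OF a, of c] attractor_eq by blast
qed

section \<open>The automaton\<close>

text \<open>A state (s, u, l) stands for the set of points (u + s p^l x) / Q with x / Q in the attractor,
  where Q is the common denominator. At l = 0 a map of the system is chosen, and each
  transition reads off one digit.\<close>

definition exp_bound :: nat where
  "exp_bound = (\<Sum>i\<in>{1..n}. k i)"

definition automaton_states :: "(int \<times> int \<times> nat) set" where
  "automaton_states =
     {1, -1} \<times> {- (shift_bound * int p ^ exp_bound + common_den)..shift_bound * int p ^ exp_bound + common_den} \<times>
     {..exp_bound}"

definition automaton_edges :: "((int \<times> int \<times> nat) \<times> nat \<times> int \<times> int \<times> nat) set" where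
  "automaton_edges =
     {((s, u, l), c, (s', u', l')).
        (s, u, l) \<in> automaton_states \<and> (s', u', l') \<in> automaton_states \<and> c < p \<and>
        (l = Suc l' \<and> s' = s \<and> u = common_den * int c + int p * u' \<or>
         (\<exists>i\<in>{1..n}. l = 0 \<and> k i = Suc l' \<and> s' = s * (-1) ^ b i \<and>
            u + s * shift i = common_den * int c + int p * u'))}"

definition ifs_automaton :: "(nat, nat) automaton" where
  "ifs_automaton =
     \<lparr> au_states = to_nat ` automaton_states,
       au_init = to_nat (1 :: int, 0 :: int, 0 :: nat),
       au_edges = (\<lambda>(q, c, q'). (to_nat q, c, to_nat q')) ` automaton_edges \<rparr>"

lemma k_le_exp_bound: "i \<in> {1..n} \<Longrightarrow> k i \<le> exp_bound"
  unfolding exp_bound_def by (rule member_le_sum) auto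

lemma finite_ifs_automaton: "finite_automaton {0..<p} ifs_automaton"
proof -
  have fin: "finite automaton_states" by (simp add: automaton_states_def)
  have sub: "automaton_edges \<subseteq> automaton_states \<times> {0..<p} \<times> automaton_states"
    by (auto simp: automaton_edges_def)
  moreover have "finite (automaton_states \<times> {0..<p} \<times> automaton_states)"
    using fin by (intro finite_cartesian_product) auto
  ultimately have "finite automaton_edges" by (rule finite_subset)
  moreover have "(1, 0, 0) \<in> automaton_states"
    using common_den_pos mult_nonneg_nonneg[OF shift_bound_nonneg, of "int p ^ exp_bound"]
    by (simp add: automaton_states_def)
  ultimately show ?thesis using fin sub by (fastforce simp: finite_automaton_def ifs_automaton_def)
qed

lemma ifs_automaton_edge_iff:
  "(to_nat q, c, r) \<in> au_edges ifs_automaton \<longleftrightarrow> (\<exists>q'. r = to_nat q' \<and> (q, c, q') \<in> automaton_edges)"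
  by (force simp: ifs_automaton_def)

lemma expansion_recognized:
  assumes a: "a \<in> addresses" and digits: "\<And>i. c i < p"
    and c: "\<And>m. int p ^ m dvd common_den * digit_sum p c m - addr_sum a m"
  shows "c \<in> recognized_words ifs_automaton"
proof -
  let ?K = "exp_sum a"
  \<comment> \<open>\<open>J i\<close> is the least number of letters that determines i digits; the
    surplus exponent becomes the third component of the state.\<close>
  define J where "J i = (LEAST J. i \<le> ?K J)" for i
  have J: "i \<le> ?K (J i)" for i
    unfolding J_def using LeastI[of "\<lambda>J. i \<le> ?K J" i] exp_sum_ge[OF a] by blast
  have J_least: "J i \<le> j" if "i \<le> ?K j" for i j
    unfolding J_def using that by (rule Least_le)
  \<comment> \<open>By minimality, one letter fewer stays below i, so the surplus is at most a
    single exponent \<open>k\<close>.\<close>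
  have K_less: "?K (J i) \<le> i + exp_bound" for i
  proof (cases "J i")
    case (Suc j)
    hence "?K j < i" using J_least[of i j] by fastforce
    thus ?thesis using Suc k_le_exp_bound[OF addressesD[OF a, of j]] by simp
  qed simp
  have K_mono: "?K j < ?K j' \<longleftrightarrow> j < j'" for j j'
    by (rule strict_mono_less[OF exp_sum_strict_mono[OF a]])
  have carry: "int p ^ i * carry a c i j = addr_sum a j - common_den * digit_sum p c i"
    if "i \<le> ?K j" for i j by (rule carry_mult[OF a c that])
  define q where "q i = (sgn_prod a (J i), carry a c i (J i), ?K (J i) - i)" for i
  have state: "q i \<in> automaton_states" for i
    using sgn_prod_cases[of a "J i"] abs_carry_le[OF a c digits J K_less, of i] K_less[of i]
    by (auto simp: q_def automaton_states_def abs_le_iff)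
  have "(q i, c i, q (Suc i)) \<in> automaton_edges" for i
  \<comment> \<open>Either the surplus pays for the next digit, or it is zero and exactly one
    further letter is taken.\<close>
  proof (cases "Suc i \<le> ?K (J i)")
    case True
    have "J (Suc i) = J i"
      using J_least[OF True] J_least[of i "J (Suc i)"] J[of "Suc i"] by simp
    moreover have "int p ^ i * carry a c i (J i) =
        int p ^ i * (common_den * int (c i) + int p * carry a c (Suc i) (J i))"
      using carry[OF J, of i] carry[OF True] by (simp add: algebra_simps)
    hence "carry a c i (J i) = common_den * int (c i) + int p * carry a c (Suc i) (J i)"
      using p_gt_1 by simp
    moreover have "?K (J i) - i = Suc (?K (J i) - Suc i)" using True by simp
    ultimately show ?thesis
      using state[of i] state[of "Suc i"] digits[of i] by (simp add: automaton_edges_def q_def)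
  next
    case False
    hence K: "?K (J i) = i" using J[of i] by simp
    have le: "Suc i \<le> ?K (Suc (J i))" using exp_sum_less_Suc[OF a, of "J i"] K by simp
    have "J i < J (Suc i)" using K_mono J[of "Suc i"] K by (metis Suc_le_lessD)
    hence Suc: "J (Suc i) = Suc (J i)" using J_least[OF le] by simp
    have "int p ^ i * (carry a c i (J i) + sgn_prod a (J i) * shift (a (J i))) =
        int p ^ i * (common_den * int (c i) + int p * carry a c (Suc i) (Suc (J i)))"
      using carry[OF J, of i] carry[OF le] K by (simp add: algebra_simps)
    hence "carry a c i (J i) + sgn_prod a (J i) * shift (a (J i)) =
        common_den * int (c i) + int p * carry a c (Suc i) (Suc (J i))"
      using p_gt_1 by simp
    moreover have "k (a (J i)) = Suc (?K (Suc (J i)) - Suc i)" using le K by simp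
    ultimately show ?thesis
      using state[of i] state[of "Suc i"] digits[of i] addressesD[OF a, of "J i"] Suc K
      by (auto simp: automaton_edges_def q_def)
  qed
  hence "(to_nat (q i), c i, to_nat (q (Suc i))) \<in> au_edges ifs_automaton" for i
    unfolding ifs_automaton_edge_iff by blast
  moreover have "J 0 = 0" using J_least[of 0 0] by simp
  hence "to_nat (q 0) = au_init ifs_automaton"
    by (simp add: q_def ifs_automaton_def carry_def)
  ultimately show ?thesis unfolding recognized_words_def by (auto intro: exI[of _ "\<lambda>i. to_nat (q i)"])
qed

text \<open>The starting state is arbitrary for the induction. Letters chosen along the path are
  prepended to an address given by the induction hypothesis, so the address may change with
  m.\<close>

lemma path_near_address:
  assumes "\<And>i. (q i, c i, q (Suc i)) \<in> automaton_edges" "q 0 = (s, u, l)"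
  shows "\<exists>a\<in>addresses. int p ^ m dvd u + s * int p ^ l * addr_sum a m - common_den * digit_sum p c m"
  using assms
proof (induction m arbitrary: q c s u l)
  case 0
  thus ?case using addresses_nonempty by auto
next
  case (Suc m)
  obtain s' u' l' where q1: "q (Suc 0) = (s', u', l')" by (cases "q (Suc 0)")
  let ?D = "digit_sum p (\<lambda>i. c (Suc i)) m"
  obtain a where a: "a \<in> addresses"
    and dvd: "int p ^ m dvd u' + s' * int p ^ l' * addr_sum a m - common_den * ?D"
    using Suc.IH[of "\<lambda>i. q (Suc i)" "\<lambda>i. c (Suc i)"] Suc.prems(1) q1 by blast
  from mult_dvd_mono[OF dvd_refl[of "int p"] dvd]
  have dvd': "int p ^ Suc m dvd int p * (u' + s' * int p ^ l' * addr_sum a m - common_den * ?D)"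
    by simp
  have "((s, u, l), c 0, (s', u', l')) \<in> automaton_edges"
    using Suc.prems(1)[of 0] Suc.prems(2) q1 by simp
  then consider (lag) "l = Suc l'" "s' = s" "u = common_den * int (c 0) + int p * u'"
    | (letter) i where "i \<in> {1..n}" "l = 0" "k i = Suc l'" "s' = s * (-1) ^ b i"
        "u + s * shift i = common_den * int (c 0) + int p * u'"
    by (auto simp: automaton_edges_def)
  thus ?case
  proof cases
    case lag
    \<comment> \<open>One more term changes the sum by a multiple of p^m; the factor p gained from l
      = l' + 1 lifts this to p^(m+1).\<close>
    have "int p ^ m dvd addr_sum a (Suc m) - addr_sum a m"
      using coherent_addr_sum[OF a] by (simp add: coherent_def del: addr_sum_Suc)
    hence "int p * int p ^ m dvd int p * (addr_sum a (Suc m) - addr_sum a m)"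
      by (rule mult_dvd_mono[OF dvd_refl])
    hence "int p ^ Suc m dvd s * int p ^ l' * (int p * (addr_sum a (Suc m) - addr_sum a m))"
      by (simp only: power_Suc dvd_mult)
    from dvd_add[OF dvd' this] have "int p ^ Suc m dvd int p *
        (u' + s' * int p ^ l' * addr_sum a m - common_den * ?D) +
        s * int p ^ l' * (int p * (addr_sum a (Suc m) - addr_sum a m))" .
    also have "int p * (u' + s' * int p ^ l' * addr_sum a m - common_den * ?D) +
        s * int p ^ l' * (int p * (addr_sum a (Suc m) - addr_sum a m)) =
        u + s * int p ^ l * addr_sum a (Suc m) - common_den * digit_sum p c (Suc m)"
      unfolding digit_sum_shift lag power_Suc by (simp only: algebra_simps)
    finally have "int p ^ Suc m dvd
        u + s * int p ^ l * addr_sum a (Suc m) - common_den * digit_sum p c (Suc m)" .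
    thus ?thesis using a by blast
  next
    case letter
    have "int p * (u' + s' * int p ^ l' * addr_sum a m - common_den * ?D) =
        u + s * int p ^ l * addr_sum (case_nat i a) (Suc m) - common_den * digit_sum p c (Suc m)"
      using letter(5) unfolding digit_sum_shift addr_sum_case_nat letter(2,3,4)
      by (simp add: algebra_simps)
    thus ?thesis using dvd' addresses_case_nat[OF letter(1) a] by metis
  qed
qed

lemma recognized_words_eq:
  "recognized_words ifs_automaton = {c. \<exists>x\<in>ifs_attractor p n b k d. padic_expansion p c x}"
proof (intro equalityI subsetI)
  fix c assume "c \<in> {c. \<exists>x\<in>ifs_attractor p n b k d. padic_expansion p c x}"
  then obtain a where a: "a \<in> addresses" "padic_expansion p c (point a)"
    unfolding attractor_eq by blast
  hence "\<And>i. c i < p" "\<And>m. int p ^ m dvd common_den * digit_sum p c m - addr_sum a m"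
    unfolding padic_expansion_point_iff[OF a(1)] by simp_all
  thus "c \<in> recognized_words ifs_automaton" by (rule expansion_recognized[OF a(1)])
next
  fix c assume "c \<in> recognized_words ifs_automaton"
  then obtain r where r0: "r 0 = to_nat (1 :: int, 0 :: int, 0 :: nat)"
    and r: "\<And>i. (r i, c i, r (Suc i)) \<in> au_edges ifs_automaton"
    by (auto simp: recognized_words_def ifs_automaton_def)
  define q :: "nat \<Rightarrow> int \<times> int \<times> nat" where "q i = from_nat (r i)" for i
  have q0: "q 0 = (1, 0, 0)" by (simp add: q_def r0)
  have q: "(q i, c i, q (Suc i)) \<in> automaton_edges" for i
    using r[of i] by (auto simp: ifs_automaton_def q_def)
  have digits: "c i < p" for i using q[of i] by (auto simp: automaton_edges_def)
  let ?D = "\<lambda>m. common_den * digit_sum p c m"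
  have D: "coherent p ?D" by (rule coherent_digit_sum)
  \<comment> \<open>The approximating points for different m need not be related; closedness of the
    attractor puts the limit into it nevertheless.\<close>
  have near: "\<exists>y\<in>point ` addresses. padic_dist p (frac_lim ?D) y \<le> 1 / real p ^ m" for m
  proof -
    obtain a where a: "a \<in> addresses" "int p ^ m dvd addr_sum a m - ?D m"
      using path_near_address[OF q q0, of m] by auto
    hence "int p ^ m dvd ?D m - addr_sum a m" by (simp only: dvd_diff_commute)
    hence "padic_dist p (frac_lim ?D) (point a) \<le> 1 / real p ^ m"
      unfolding point_def padic_dist_frac_lim_le_iff[OF D coherent_addr_sum[OF a(1)]] .
    thus ?thesis using a(1) by blast
  qed
  have "frac_lim ?D \<in> point ` addresses"
    by (rule compactin_padic_limit[OF compactin_points frac_lim_carrier[OF D] near])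
  moreover have "padic_expansion p c (frac_lim ?D)"
    unfolding padic_expansion_frac_lim_iff[OF D] using digits by simp
  ultimately show "c \<in> {c. \<exists>x\<in>ifs_attractor p n b k d. padic_expansion p c x}"
    unfolding attractor_eq by blast
qed

section \<open>Counting residues\<close>

text \<open>Points are scaled by \<open>common_den\<close>, a unit modulo p^m, so the cardinality is
  the number of balls of radius p^-m that meet the attractor.\<close>

definition residues :: "nat \<Rightarrow> int set" where
  "residues m = (\<lambda>a. addr_sum a m mod int p ^ m) ` addresses"

definition residue_count :: "nat \<Rightarrow> nat" where
  "residue_count m = card (residues m)"

lemma residues_subset: "residues m \<subseteq> {0..<int p ^ m}"
  using p_gt_1 by (auto simp: residues_def)

lemma finite_residues [simp]: "finite (residues m)"
  by (rule finite_subset[OF residues_subset]) simp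

lemma residue_count_pos: "0 < residue_count m"
proof -
  have "residues m \<noteq> {}" using addresses_nonempty by (simp add: residues_def)
  thus ?thesis unfolding residue_count_def by (simp add: card_gt_0_iff)
qed

lemma residue_count_le: "residue_count m \<le> p ^ m"
proof -
  have "residue_count m \<le> card {0..<int p ^ m}"
    unfolding residue_count_def by (rule card_mono[OF _ residues_subset]) simp
  thus ?thesis by (simp add: nat_power_eq)
qed

lemma addr_sum_mod:
  assumes "a \<in> addresses" "m \<le> N"
  shows "addr_sum a N mod int p ^ m = addr_sum a m mod int p ^ m"
  using coherent_addr_sum[OF assms(1)] assms(2) by (simp add: mod_eq_dvd_iff coherent_def)

lemma residues_mod:
  assumes "x \<in> residues (m + l)"
  shows "x mod int p ^ m \<in> residues m"
proof -
  obtain a where a: "a \<in> addresses" "x = addr_sum a (m + l) mod int p ^ (m + l)"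
    using assms by (auto simp: residues_def)
  have "x mod int p ^ m = addr_sum a (m + l) mod int p ^ m"
    unfolding a(2) by (rule mod_mod_cancel) (simp add: power_add)
  thus ?thesis using a(1) addr_sum_mod[OF a(1), of m "m + l"] by (auto simp: residues_def)
qed

end

text \<open>The bounds are parameters, so that they can later be numbers computed from the code;
  every constant in the approximation depends on them.\<close>

locale bounded_ifs_system = ifs_system +
  fixes \<kappa> B :: nat
  assumes k_le: "\<And>i. i \<in> {1..n} \<Longrightarrow> k i \<le> \<kappa>"
    and shift_le: "\<And>i. i \<in> {1..n} \<Longrightarrow> \<bar>shift i\<bar> \<le> int B"
begin

text \<open>The number of triples in \<open>card_residues_ball\<close>: two signs,
  \<open>\<kappa> + 1\<close> excess exponents, and the integers of absolute value at most
  \<open>B * p ^ \<kappa>\<close>.\<close>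

definition overlap :: nat where
  "overlap = 2 * (\<kappa> + 1) * (2 * (B * p ^ \<kappa>) + 1)"

lemma \<kappa>_pos: "0 < \<kappa>"
  using k_ge_1[of 1] k_le[of 1] n_ge_1 by simp

lemma overlap_pos: "0 < overlap"
  by (simp add: overlap_def)

text \<open>Accumulated exponents grow in steps of at most \<kappa>, so they skip no window from m
  to m + \<kappa>.\<close>

lemma exp_sum_between:
  assumes a: "a \<in> addresses"
  shows "\<exists>J. m \<le> exp_sum a J \<and> exp_sum a J \<le> m + \<kappa>"
proof (induction m)
  case 0
  show ?case by (intro exI[of _ 0]) simp
next
  case (Suc m)
  then obtain J where J: "m \<le> exp_sum a J" "exp_sum a J \<le> m + \<kappa>" by blast
  show ?case
  proof (cases "Suc m \<le> exp_sum a J")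
    case True
    thus ?thesis using J by (intro exI[of _ J]) simp
  next
    case False
    thus ?thesis
      using J exp_sum_less_Suc[OF a, of J] k_le[OF addressesD[OF a, of J]]
      by (intro exI[of _ "Suc J"]) simp
  qed
qed

text \<open>Every ball of radius p^-m that meets the attractor contains a copy of it of size at
  least p^-(m + kappa).\<close>

lemma residue_count_mult_le: "residue_count m * residue_count l \<le> residue_count (m + l + \<kappa>)"
proof -
  let ?M = "m + l + \<kappa>"
  have "\<exists>a J. a \<in> addresses \<and> u = addr_sum a m mod int p ^ m \<and> m \<le> exp_sum a J \<and> exp_sum a J \<le> m + \<kappa>"
    if "u \<in> residues m" for u
    using that exp_sum_between by (auto simp: residues_def)
  then obtain A J where AJ: "\<And>u. u \<in> residues m \<Longrightarrow> A u \<in> addresses"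
    "\<And>u. u \<in> residues m \<Longrightarrow> u = addr_sum (A u) m mod int p ^ m"
    "\<And>u. u \<in> residues m \<Longrightarrow> m \<le> exp_sum (A u) (J u)"
    "\<And>u. u \<in> residues m \<Longrightarrow> exp_sum (A u) (J u) \<le> m + \<kappa>" by metis
  have "\<exists>a. a \<in> addresses \<and> v = addr_sum a l mod int p ^ l" if "v \<in> residues l" for v
    using that by (auto simp: residues_def)
  then obtain A' where A': "\<And>v. v \<in> residues l \<Longrightarrow> A' v \<in> addresses"
    "\<And>v. v \<in> residues l \<Longrightarrow> v = addr_sum (A' v) l mod int p ^ l" by metis
  \<comment> \<open>Follow an address representing u until its exponent reaches m, then continue
    with one representing v: the copy so entered lies in the ball of u.\<close>
  define w where "w u v = (\<lambda>i. if i < J u then A u i else A' v (i - J u))" for u v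
  have w: "w u v \<in> addresses" if "u \<in> residues m" "v \<in> residues l" for u v
    unfolding w_def by (rule addresses_join[OF AJ(1) A'(1)]) (use that in auto)
  have J_le: "J u + l \<le> ?M" if "u \<in> residues m" for u
    using exp_sum_ge[OF AJ(1)[OF that], of "J u"] AJ(4)[OF that] by simp
  have sum_w: "addr_sum (w u v) ?M = addr_sum (A u) (J u) +
      sgn_prod (A u) (J u) * int p ^ exp_sum (A u) (J u) * addr_sum (A' v) (?M - J u)"
    if "u \<in> residues m" "v \<in> residues l" for u v
    using addr_sum_join[where J = "J u" and N = "?M - J u" and a = "A u" and a' = "A' v"] J_le[OF that(1)]
    by (simp add: w_def)
  have w_mod: "addr_sum (w u v) ?M mod int p ^ m = u" if uv: "u \<in> residues m" "v \<in> residues l" for u v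
  proof -
    have "int p ^ m dvd int p ^ exp_sum (A u) (J u)" by (rule le_imp_power_dvd[OF AJ(3)[OF uv(1)]])
    hence "int p ^ m dvd sgn_prod (A u) (J u) * int p ^ exp_sum (A u) (J u) * addr_sum (A' v) (?M - J u)"
      by simp
    moreover have "int p ^ m dvd addr_sum (A u) (J u) - addr_sum (A u) m"
      by (rule addr_sum_dvd[OF AJ(1,3)]; fact)
    ultimately have "int p ^ m dvd addr_sum (w u v) ?M - addr_sum (A u) m"
      unfolding sum_w[OF uv] diff_add_eq[symmetric] by (rule dvd_add[rotated])
    hence "addr_sum (w u v) ?M mod int p ^ m = addr_sum (A u) m mod int p ^ m"
      by (simp only: mod_eq_dvd_iff)
    thus ?thesis by (simp only: AJ(2)[OF uv(1), symmetric])
  qed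
  \<comment> \<open>Reduction modulo p^m recovers u. For equal u the common translation and factor
    cancel, and since the factor has exponent at most m + \<kappa>, v is still determined modulo
    p^l.\<close>
  have "inj_on (\<lambda>(u, v). addr_sum (w u v) ?M mod int p ^ ?M) (residues m \<times> residues l)"
  proof (rule inj_onI, clarify)
    fix u v u' v'
    assume uv: "u \<in> residues m" "v \<in> residues l" "u' \<in> residues m" "v' \<in> residues l"
      and eq: "addr_sum (w u v) ?M mod int p ^ ?M = addr_sum (w u' v') ?M mod int p ^ ?M"
    have "int p ^ m dvd int p ^ ?M" by (rule le_imp_power_dvd) simp
    hence "addr_sum (w u v) ?M mod int p ^ m = addr_sum (w u' v') ?M mod int p ^ m"
      using mod_mod_cancel[of "int p ^ m" "int p ^ ?M" "addr_sum (w u v) ?M"]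
        mod_mod_cancel[of "int p ^ m" "int p ^ ?M" "addr_sum (w u' v') ?M"] eq by simp
    hence u: "u = u'" using w_mod uv by simp
    have "int p ^ ?M dvd addr_sum (w u v) ?M - addr_sum (w u v') ?M"
      using eq u by (simp only: mod_eq_dvd_iff)
    hence "int p ^ ?M dvd sgn_prod (A u) (J u) * (int p ^ exp_sum (A u) (J u) *
        (addr_sum (A' v) (?M - J u) - addr_sum (A' v') (?M - J u)))"
      unfolding sum_w[OF uv(1,2)] sum_w[OF uv(1,4)] by (simp add: algebra_simps)
    hence "int p ^ ?M dvd int p ^ exp_sum (A u) (J u) *
        (addr_sum (A' v) (?M - J u) - addr_sum (A' v') (?M - J u))"
      using sgn_prod_cases[of "A u" "J u"] by auto
    moreover have "int p ^ (exp_sum (A u) (J u) + l) dvd int p ^ ?M"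
      by (rule le_imp_power_dvd) (use AJ(4)[OF uv(1)] in simp)
    ultimately have "int p ^ exp_sum (A u) (J u) * int p ^ l dvd int p ^ exp_sum (A u) (J u) *
        (addr_sum (A' v) (?M - J u) - addr_sum (A' v') (?M - J u))"
      unfolding power_add[symmetric] by (rule dvd_trans[rotated])
    hence "int p ^ l dvd addr_sum (A' v) (?M - J u) - addr_sum (A' v') (?M - J u)"
      using p_gt_1 by simp
    hence "addr_sum (A' v) (?M - J u) mod int p ^ l = addr_sum (A' v') (?M - J u) mod int p ^ l"
      by (simp only: mod_eq_dvd_iff)
    moreover have "addr_sum (A' x) (?M - J u) mod int p ^ l = x" if "x \<in> residues l" for x
    proof -
      have "l \<le> ?M - J u" using J_le[OF uv(1)] by simp
      from addr_sum_mod[OF A'(1)[OF that] this] show ?thesis by (simp only: A'(2)[OF that, symmetric])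
    qed
    ultimately have "v = v'" using uv(2,4) by metis
    thus "u = u' \<and> v = v'" using u by simp
  qed
  moreover have "(\<lambda>(u, v). addr_sum (w u v) ?M mod int p ^ ?M) ` (residues m \<times> residues l) \<subseteq> residues ?M"
    using w by (auto simp: residues_def)
  ultimately have "card (residues m \<times> residues l) \<le> card (residues ?M)"
    by (intro card_inj_on_le) auto
  thus ?thesis by (simp add: residue_count_def card_cartesian_product)
qed

text \<open>A ball of radius p^-m meets only boundedly many different copies of size about p^-m, since
  their translations, rescaled to unit size, have a common denominator and are bounded.\<close>

lemma card_residues_ball: "card {x \<in> residues (m + l). x mod int p ^ m = u} \<le> overlap * residue_count l"
proof -
  let ?R = "int B * int p ^ \<kappa>"
  \<comment> \<open>The data are a sign, an excess exponent t, a translation r in units of p^m and a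
    residue y of the tail; \<open>?g\<close> rebuilds x from them.\<close>
  let ?T = "{1, -1 :: int} \<times> {..\<kappa>} \<times> {- ?R..?R} \<times> residues l"
  let ?g = "\<lambda>(s, t, r, y). (u + int p ^ m * r + s * int p ^ (m + t) * y) mod int p ^ (m + l)"
  have "{x \<in> residues (m + l). x mod int p ^ m = u} \<subseteq> ?g ` ?T"
  proof (rule subsetI)
    fix x assume "x \<in> {x \<in> residues (m + l). x mod int p ^ m = u}"
    hence "x \<in> residues (m + l)" and u: "u = x mod int p ^ m" by simp_all
    then obtain a where a: "a \<in> addresses" and x: "x = addr_sum a (m + l) mod int p ^ (m + l)"
      by (auto simp: residues_def)
    obtain J where J: "m \<le> exp_sum a J" "exp_sum a J \<le> m + \<kappa>" using exp_sum_between[OF a] by blast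
    define t where "t = exp_sum a J - m"
    have t: "exp_sum a J = m + t" "t \<le> \<kappa>" using J by (simp_all add: t_def)
    define a' where "a' = (\<lambda>j. a (J + j))"
    have a': "a' \<in> addresses" unfolding a'_def by (rule addresses_shift[OF a])
    define y where "y = addr_sum a' l mod int p ^ l"
    define r where "r = addr_sum a J div int p ^ m"
    have "u = addr_sum a (m + l) mod int p ^ m"
      unfolding u x by (rule mod_mod_cancel) (simp add: power_add)
    also have "\<dots> = addr_sum a m mod int p ^ m" by (rule addr_sum_mod[OF a]) simp
    also have "\<dots> = addr_sum a J mod int p ^ m"
      using addr_sum_dvd[OF a J(1)] by (simp add: mod_eq_dvd_iff dvd_diff_commute)
    finally have E: "addr_sum a J = u + int p ^ m * r"
      using mod_mult_div_eq[of "addr_sum a J" "int p ^ m"] by (simp add: r_def)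
    have pm: "0 < int p ^ m" using p_gt_1 by simp
    \<comment> \<open>The exponent of the first J letters is at most m + \<kappa>, so division by
      p^m leaves a translation whose bound is independent of m.\<close>
    have "\<bar>addr_sum a J\<bar> \<le> int B * int p ^ exp_sum a J" by (rule abs_addr_sum_le[OF a shift_le])
    also have "\<dots> \<le> int B * int p ^ (m + \<kappa>)"
      using p_gt_1 J(2) by (intro mult_left_mono power_increasing) auto
    finally have "\<bar>addr_sum a J\<bar> \<le> ?R * int p ^ m" by (simp add: power_add mult_ac)
    hence le: "addr_sum a J \<le> ?R * int p ^ m" "(- ?R) * int p ^ m \<le> addr_sum a J"
      unfolding abs_le_iff by (simp_all only: mult_minus_left minus_le_iff)
    have cancel: "z * int p ^ m div int p ^ m = z" for z
      by (rule nonzero_mult_div_cancel_right) (use pm in simp)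
    have "r \<le> ?R" "- ?R \<le> r"
      using zdiv_mono1[OF le(1) pm] zdiv_mono1[OF le(2) pm] unfolding cancel r_def by simp_all
    hence r: "r \<in> {- ?R..?R}" by simp
    have "m + l \<le> exp_sum a (J + l)"
      using exp_sum_ge[OF a', of l] J(1) by (simp add: exp_sum_split a'_def)
    from addr_sum_dvd[OF a this] have "x = addr_sum a (J + l) mod int p ^ (m + l)"
      unfolding x by (simp add: mod_eq_dvd_iff dvd_diff_commute)
    also have "addr_sum a (J + l) = u + int p ^ m * r + sgn_prod a J * int p ^ (m + t) * addr_sum a' l"
      by (simp only: addr_sum_split E t(1) a'_def)
    also have "\<dots> mod int p ^ (m + l) = (u + int p ^ m * r + sgn_prod a J * int p ^ (m + t) * y) mod int p ^ (m + l)"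
    proof -
      have "int p ^ l dvd addr_sum a' l - y" by (simp add: y_def dvd_minus_mod)
      hence "int p ^ m * int p ^ l dvd int p ^ m * (addr_sum a' l - y)" by (rule mult_dvd_mono[OF dvd_refl])
      hence "int p ^ (m + l) dvd sgn_prod a J * int p ^ t * (int p ^ m * (addr_sum a' l - y))"
        unfolding power_add by (rule dvd_mult)
      thus ?thesis by (simp add: mod_eq_dvd_iff power_add algebra_simps)
    qed
    finally have "x = ?g (sgn_prod a J, t, r, y)" by simp
    moreover have "(sgn_prod a J, t, r, y) \<in> ?T"
      using sgn_prod_cases[of a J] t(2) r a' by (auto simp: y_def residues_def)
    ultimately show "x \<in> ?g ` ?T" by (rule image_eqI)
  qed
  hence "card {x \<in> residues (m + l). x mod int p ^ m = u} \<le> card ?T"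
    by (rule surj_card_le[rotated]) simp
  also have "card ?T = overlap * residue_count l"
    by (simp add: overlap_def residue_count_def card_cartesian_product nat_power_eq nat_mult_distrib nat_add_distrib algebra_simps)
  finally show ?thesis .
qed

section \<open>Growth rate of the residue counts\<close>

lemma residue_count_add_le: "residue_count (m + l) \<le> overlap * residue_count m * residue_count l"
proof -
  have "residues (m + l) = (\<Union>u\<in>residues m. {x \<in> residues (m + l). x mod int p ^ m = u})"
    using residues_mod by blast
  hence "residue_count (m + l) = card (\<Union>u\<in>residues m. {x \<in> residues (m + l). x mod int p ^ m = u})"
    unfolding residue_count_def by (rule arg_cong)
  also have "\<dots> \<le> (\<Sum>u\<in>residues m. card {x \<in> residues (m + l). x mod int p ^ m = u})"
    by (rule card_UN_le) simp
  also have "\<dots> \<le> (\<Sum>u\<in>residues m. overlap * residue_count l)"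
    by (rule sum_mono) (rule card_residues_ball)
  finally show ?thesis by (simp add: residue_count_def mult_ac)
qed

text \<open>Both sides are compared with the count at level m (l + \<kappa>), reached by m steps of
  length l + \<kappa> or by l + \<kappa> steps of length m.\<close>

lemma residue_count_power_le: "residue_count l ^ m \<le> (overlap * residue_count m) ^ (l + \<kappa>)"
proof -
  have "residue_count l ^ t \<le> residue_count (t * (l + \<kappa>))" for t
  proof (induction t)
    case (Suc t)
    have "residue_count l ^ Suc t \<le> residue_count (t * (l + \<kappa>)) * residue_count l"
      using Suc by simp
    also have "\<dots> \<le> residue_count (t * (l + \<kappa>) + l + \<kappa>)" by (rule residue_count_mult_le)
    finally show ?case by (simp add: algebra_simps)
  qed (use residue_count_pos[of 0] in simp)
  moreover have "residue_count (t * m) \<le> (overlap * residue_count m) ^ t" for t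
  proof (induction t)
    case (Suc t)
    have "residue_count (Suc t * m) \<le> overlap * residue_count m * residue_count (t * m)"
      using residue_count_add_le[of m "t * m"] by simp
    also have "\<dots> \<le> overlap * residue_count m * (overlap * residue_count m) ^ t"
      by (rule mult_le_mono2[OF Suc])
    finally show ?case by simp
  qed (use residue_count_le[of 0] in simp)
  from this[of "l + \<kappa>"] have "residue_count (m * (l + \<kappa>)) \<le> (overlap * residue_count m) ^ (l + \<kappa>)"
    by (simp add: mult.commute)
  ultimately show ?thesis using order_trans by blast
qed

text \<open>By \<open>residue_count_power_le\<close> each quotient under this supremum is at most
  log (C N(m)) / m for every positive m. The rate is thus enclosed from both sides at every level,
  without forming a limit.\<close>

definition growth :: real where
  "growth = (SUP l. log (real p) (real (residue_count l)) / real (l + \<kappa>))"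

lemma log_count_ratio_le:
  assumes "0 < m"
  shows "log (real p) (real (residue_count l)) / real (l + \<kappa>) \<le>
    log (real p) (real (overlap * residue_count m)) / real m"
proof -
  have p1: "1 < real p" using p_gt_1 by simp
  have pos: "0 < real (residue_count l)" "0 < real (overlap * residue_count m)"
    using residue_count_pos overlap_pos by simp_all
  have "real (residue_count l) ^ m \<le> real (overlap * residue_count m) ^ (l + \<kappa>)"
    using residue_count_power_le[of l m] by (simp only: of_nat_le_iff flip: of_nat_power)
  hence "log (real p) (real (residue_count l) ^ m) \<le> log (real p) (real (overlap * residue_count m) ^ (l + \<kappa>))"
    using pos p1 by (subst log_le_cancel_iff) auto
  hence "real m * log (real p) (real (residue_count l)) \<le>
      real (l + \<kappa>) * log (real p) (real (overlap * residue_count m))"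
    using pos by (simp only: log_nat_power)
  thus ?thesis using assms \<kappa>_pos by (simp add: field_simps del: of_nat_add)
qed

lemma growth_le: "0 < m \<Longrightarrow> growth \<le> log (real p) (real (overlap * residue_count m)) / real m"
  unfolding growth_def by (rule cSUP_least) (simp, rule log_count_ratio_le)

lemma growth_ge: "log (real p) (real (residue_count m)) / real (m + \<kappa>) \<le> growth"
  unfolding growth_def
  by (rule cSUP_upper) (use log_count_ratio_le[of 1] in \<open>auto intro!: bdd_aboveI\<close>)

lemma growth_nonneg: "0 \<le> growth"
proof -
  have "0 \<le> log (real p) (real (residue_count 0)) / real (0 + \<kappa>)"
    using residue_count_pos[of 0] p_gt_1 by simp
  thus ?thesis using growth_ge[of 0] by linarith
qed

text \<open>Together with \<open>powr_le_residue_count\<close>, this pins N(m) to p^(growth m) up to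
  constant factors.\<close>

lemma residue_count_le_powr: "real (residue_count m) \<le> real p powr (growth * real (m + \<kappa>))"
proof -
  have "log (real p) (real (residue_count m)) \<le> growth * real (m + \<kappa>)"
    using growth_ge[of m] \<kappa>_pos by (simp add: field_simps del: of_nat_add)
  thus ?thesis using p_gt_1 residue_count_pos[of m] by (simp add: log_le_iff)
qed

lemma powr_le_residue_count: "real p powr (growth * real m) \<le> real overlap * real (residue_count m)"
proof (cases "m = 0")
  case True
  have "1 \<le> overlap * residue_count 0" using overlap_pos residue_count_pos[of 0] by (simp add: Suc_le_eq)
  hence "1 \<le> real overlap * real (residue_count 0)" by (metis of_nat_1 of_nat_le_iff of_nat_mult)
  thus ?thesis using True p_gt_1 by simp
next
  case False
  hence "growth * real m \<le> log (real p) (real (overlap * residue_count m))"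
    using growth_le[of m] by (simp add: field_simps)
  thus ?thesis using p_gt_1 residue_count_pos[of m] overlap_pos by (simp add: le_log_iff)
qed

end

section \<open>The Hausdorff dimension\<close>

lemma suminf_ennreal_ge_sum:
  fixes f :: "nat \<Rightarrow> ennreal"
  shows "finite I \<Longrightarrow> sum f I \<le> suminf f"
  by (rule sum_le_suminf) (auto intro: summableI)

context bounded_ifs_system
begin

lemma set_diameter_le:
  assumes "\<And>x y. x \<in> U \<Longrightarrow> y \<in> U \<Longrightarrow> padic_dist p x y \<le> r" "0 \<le> r"
  shows "set_diameter (padic_dist p) U \<le> r"
  unfolding set_diameter_def using assms by (auto intro!: cSUP_least)

lemma dist_le_set_diameter:
  assumes "\<And>x y. x \<in> U \<Longrightarrow> y \<in> U \<Longrightarrow> padic_dist p x y \<le> r" "x \<in> U" "y \<in> U"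
  shows "padic_dist p x y \<le> set_diameter (padic_dist p) U"
proof -
  have "bdd_above ((\<lambda>(x, y). padic_dist p x y) ` (U \<times> U))"
    using assms(1) by (auto intro!: bdd_aboveI[of _ r])
  from cSUP_upper[OF _ this, of "(x, y)"] show ?thesis
    using assms(2,3) by (auto simp: set_diameter_def)
qed

lemma set_diameter_nonneg:
  assumes "\<And>x y. x \<in> U \<Longrightarrow> y \<in> U \<Longrightarrow> padic_dist p x y \<le> r"
  shows "0 \<le> set_diameter (padic_dist p) U"
proof (cases "U = {}")
  case False
  then obtain x where x: "x \<in> U" by blast
  interpret M: Metric_space "carrier (Qp p)" "padic_dist p" by (rule padic_metric_space[OF prime])
  have "0 \<le> padic_dist p x x" by (rule M.nonneg)
  also have "\<dots> \<le> set_diameter (padic_dist p) U" by (rule dist_le_set_diameter[OF assms x x])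
  finally show ?thesis .
qed (simp add: set_diameter_def)

text \<open>The attractor is covered by N(m) sets of diameter at most p^-m, with a sum of at most a
  constant times p^((growth - s) m), which tends to 0.\<close>

lemma hausdorff_measure_above_growth:
  assumes s: "growth < s"
  shows "hausdorff_measure (carrier (Qp p)) (padic_dist p) s (point ` addresses) = 0"
proof -
  let ?P = "\<lambda>m. (1 / real p ^ m) powr s"
  have s0: "0 < s" using s growth_nonneg by linarith
  have p1: "1 < real p" using p_gt_1 by simp
  have content: "hausdorff_content (carrier (Qp p)) (padic_dist p) s \<delta> (point ` addresses) \<le>
      ennreal (real (residue_count m) * ?P m)" if m: "1 / real p ^ m \<le> \<delta>" for m \<delta>
  proof -
    obtain f where f: "bij_betw f {..<residue_count m} (residues m)"
      unfolding residue_count_def using ex_bij_betw_nat_finite[OF finite_residues, of m]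
      by (auto simp: lessThan_atLeast0)
    \<comment> \<open>Covers are indexed by all naturals; the empty sets used as padding have
      diameter 0 and contribute nothing.\<close>
    define U where "U i = (if i < residue_count m
      then point ` {a \<in> addresses. addr_sum a m mod int p ^ m = f i} else {})" for i
    have U_dist: "padic_dist p x y \<le> 1 / real p ^ m" if "x \<in> U i" "y \<in> U i" for x y i
      using that by (auto simp: U_def dist_point_le_iff mod_eq_dvd_iff[symmetric] split: if_splits)
    have cover: "point ` addresses \<subseteq> (\<Union>i. U i)"
    proof
      fix x assume "x \<in> point ` addresses"
      then obtain a where a: "a \<in> addresses" "x = point a" by blast
      hence "addr_sum a m mod int p ^ m \<in> residues m" by (simp add: residues_def)
      then obtain i where "i < residue_count m" "f i = addr_sum a m mod int p ^ m"
        using f unfolding bij_betw_def by (metis imageE lessThan_iff)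
      thus "x \<in> (\<Union>i. U i)" using a by (auto simp: U_def intro!: exI[of _ i])
    qed
    have sub: "U i \<subseteq> carrier (Qp p)" for i by (auto simp: U_def point_carrier)
    have "hausdorff_content (carrier (Qp p)) (padic_dist p) s \<delta> (point ` addresses) \<le>
        (\<Sum>i. ennreal (set_diameter (padic_dist p) (U i) powr s))"
      unfolding hausdorff_content_def
    proof (rule INF_lower, intro CollectI conjI allI ballI)
      show "padic_dist p x y \<le> \<delta>" if "x \<in> U i" "y \<in> U i" for i x y
        using U_dist[OF that] m by linarith
    qed (rule cover sub)+
    also have "\<dots> = (\<Sum>i<residue_count m. ennreal (set_diameter (padic_dist p) (U i) powr s))"
      by (rule suminf_finite) (auto simp: U_def set_diameter_def)
    also have "\<dots> \<le> (\<Sum>i<residue_count m. ennreal (?P m))"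
    proof (rule sum_mono, rule ennreal_leI)
      fix i
      show "set_diameter (padic_dist p) (U i) powr s \<le> ?P m"
        by (rule powr_mono2)
          (use s0 set_diameter_nonneg[OF U_dist] set_diameter_le[OF U_dist] in simp_all)
    qed
    also have "\<dots> = ennreal (real (residue_count m) * ?P m)"
      by (simp add: ennreal_of_nat_eq_real_of_nat ennreal_mult)
    finally show ?thesis .
  qed
  have P_eq: "?P m = real p powr (- s * real m)" for m
    using p1 by (simp add: powr_divide powr_powr powr_minus_divide mult.commute flip: powr_realpow)
  have bound: "real (residue_count m) * ?P m \<le> real p powr (growth * real \<kappa>) * (real p powr (growth - s)) ^ m" for m
  proof -
    have "real (residue_count m) * ?P m \<le> real p powr (growth * real (m + \<kappa>)) * real p powr (- s * real m)"
      unfolding P_eq by (rule mult_right_mono[OF residue_count_le_powr]) simp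
    also have "\<dots> = real p powr (growth * real \<kappa>) * real p powr ((growth - s) * real m)"
      by (simp add: algebra_simps flip: powr_add)
    also have "real p powr ((growth - s) * real m) = (real p powr (growth - s)) ^ m"
      using p1 by (simp add: powr_realpow[symmetric] powr_powr)
    finally show ?thesis .
  qed
  have "hausdorff_content (carrier (Qp p)) (padic_dist p) s \<delta> (point ` addresses) \<le> 0" if \<delta>: "0 < \<delta>" for \<delta>
  proof (rule ennreal_le_epsilon)
    fix e :: real assume e: "0 < e"
    have "real p powr (growth - s) < 1" using s p1 by (simp add: powr_less_one)
    hence "(\<lambda>m. real p powr (growth * real \<kappa>) * (real p powr (growth - s)) ^ m) \<longlonglongrightarrow> real p powr (growth * real \<kappa>) * 0"
      by (intro tendsto_mult_left LIMSEQ_power_zero) simp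
    hence "eventually (\<lambda>m. real p powr (growth * real \<kappa>) * (real p powr (growth - s)) ^ m < e) sequentially"
      using e by (intro order_tendstoD(2)) auto
    moreover have "(\<lambda>m. 1 / real p ^ m) \<longlonglongrightarrow> 0"
      using LIMSEQ_divide_realpow_zero[of "real p" 1] p1 by simp
    hence "eventually (\<lambda>m. 1 / real p ^ m < \<delta>) sequentially"
      using \<delta> by (rule order_tendstoD(2))
    ultimately have "eventually (\<lambda>m. real p powr (growth * real \<kappa>) * (real p powr (growth - s)) ^ m < e \<and>
        1 / real p ^ m < \<delta>) sequentially" by (rule eventually_conj)
    then obtain m where m: "real p powr (growth * real \<kappa>) * (real p powr (growth - s)) ^ m < e" "1 / real p ^ m < \<delta>"
      using eventually_happens'[OF sequentially_bot] by blast
    have "ennreal (real (residue_count m) * ?P m) \<le> ennreal e"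
      using bound[of m] m(1) by (intro ennreal_leI) linarith
    thus "hausdorff_content (carrier (Qp p)) (padic_dist p) s \<delta> (point ` addresses) \<le> 0 + ennreal e"
      using content[of m \<delta>] m(2) by simp
  qed
  hence "hausdorff_measure (carrier (Qp p)) (padic_dist p) s (point ` addresses) \<le> 0"
    unfolding hausdorff_measure_def by (intro SUP_least) auto
  thus ?thesis by simp
qed

text \<open>The combinatorial core of the mass distribution principle.\<close>

lemma finite_cover_sum_ge:
  fixes M :: "'i \<Rightarrow> nat"
  assumes I: "finite I" and cover: "\<And>a. a \<in> addresses \<Longrightarrow> \<exists>i\<in>I. addr_sum a (M i) mod int p ^ M i = u i"
  shows "1 \<le> real (overlap ^ 3 * residue_count \<kappa>) * (\<Sum>i\<in>I. real p powr (- growth * real (M i)))"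
proof -
  define N where "N = (\<Sum>i\<in>I. M i)"
  have M_le: "M i \<le> N" if "i \<in> I" for i
    unfolding N_def using I that by (intro member_le_sum) auto
  have "residues N \<subseteq> (\<Union>i\<in>I. {x \<in> residues N. x mod int p ^ M i = u i})"
  proof
    fix x assume x: "x \<in> residues N"
    then obtain a where a: "a \<in> addresses" "x = addr_sum a N mod int p ^ N" by (auto simp: residues_def)
    then obtain i where i: "i \<in> I" "addr_sum a (M i) mod int p ^ M i = u i" using cover by blast
    have "x mod int p ^ M i = addr_sum a N mod int p ^ M i"
      unfolding a(2) by (rule mod_mod_cancel) (rule le_imp_power_dvd[OF M_le[OF i(1)]])
    thus "x \<in> (\<Union>i\<in>I. {x \<in> residues N. x mod int p ^ M i = u i})"
      using x i addr_sum_mod[OF a(1) M_le[OF i(1)]] by auto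
  qed
  hence "residue_count N \<le> card (\<Union>i\<in>I. {x \<in> residues N. x mod int p ^ M i = u i})"
    unfolding residue_count_def using I by (intro card_mono) auto
  also have "\<dots> \<le> (\<Sum>i\<in>I. card {x \<in> residues N. x mod int p ^ M i = u i})" by (rule card_UN_le[OF I])
  finally have "real (residue_count N) \<le> (\<Sum>i\<in>I. real (card {x \<in> residues N. x mod int p ^ M i = u i}))"
    by (simp only: of_nat_le_iff flip: of_nat_sum)
  \<comment> \<open>With M = \<open>M i\<close>, three factors C arise: one bounds the part of a
    ball by C N(N - M), one bounds N(N + \<kappa>), which dominates N(M) N(N - M), and one replaces
    N(M) by p^(growth M).\<close>
  also have "\<dots> \<le> (\<Sum>i\<in>I. real (residue_count N) *
      (real (overlap ^ 3 * residue_count \<kappa>) * real p powr (- growth * real (M i))))"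
  proof (rule sum_mono)
    fix i assume i: "i \<in> I"
    let ?c = "card {x \<in> residues N. x mod int p ^ M i = u i}"
    have "?c \<le> overlap * residue_count (N - M i)"
      using card_residues_ball[of "M i" "N - M i" "u i"] M_le[OF i] by simp
    hence "residue_count (M i) * ?c \<le> overlap * (residue_count (M i) * residue_count (N - M i))"
      by (metis mult.left_commute mult_le_mono2)
    also have "\<dots> \<le> overlap * (overlap * residue_count N * residue_count \<kappa>)"
      using residue_count_mult_le[of "M i" "N - M i"] M_le[OF i] residue_count_add_le[of N \<kappa>]
      by (intro mult_le_mono2) simp
    finally have c: "real (residue_count (M i)) * real ?c \<le>
        real overlap * (real overlap * real (residue_count N) * real (residue_count \<kappa>))"
      by (simp only: of_nat_le_iff flip: of_nat_mult)
    let ?g = "real p powr (growth * real (M i))"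
    have "?g * real ?c \<le> real overlap * real (residue_count (M i)) * real ?c"
      by (rule mult_right_mono[OF powr_le_residue_count]) simp
    also have "\<dots> \<le> real overlap * (real overlap * (real overlap * real (residue_count N) * real (residue_count \<kappa>)))"
      using mult_left_mono[OF c, of "real overlap"] by (simp only: mult.assoc of_nat_0_le_iff)
    finally have "?g * real ?c \<le> real (residue_count N) * real (overlap ^ 3 * residue_count \<kappa>)"
      by (simp add: power3_eq_cube mult_ac)
    thus "real ?c \<le> real (residue_count N) * (real (overlap ^ 3 * residue_count \<kappa>) * real p powr (- growth * real (M i)))"
      using p_gt_1 by (simp add: powr_minus field_simps)
  qed
  also have "\<dots> = real (residue_count N) *
      (real (overlap ^ 3 * residue_count \<kappa>) * (\<Sum>i\<in>I. real p powr (- growth * real (M i))))"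
    by (simp only: sum_distrib_left)
  finally show ?thesis using residue_count_pos[of N] by simp
qed

text \<open>Rounding a diameter up to a power of 1/p costs a factor p^s. For diameter 0 no
  multiplicative bound can hold, and a large m with the additive e takes over.\<close>

lemma exists_level:
  assumes "0 \<le> r" "r \<le> 1" "0 < s" "0 < e"
  obtains m where "r \<le> 1 / real p ^ m" "real p powr (- s * real m) \<le> real p powr s * r powr s + e"
proof -
  have p1: "1 < real p" using p_gt_1 by simp
  show ?thesis
  proof (cases "r = 0")
    case True
    have "real p powr (- s) < 1" using p1 assms by (simp add: powr_less_one)
    then obtain m where "(real p powr (- s)) ^ m < e" using real_arch_pow_inv[OF assms(4)] by blast
    hence "real p powr (- s * real m) < e" using p1 by (simp add: powr_realpow[symmetric] powr_powr)
    thus ?thesis using True p1 by (intro that[of m]) simp_all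
  next
    case False
    hence r: "0 < r" using assms by simp
    define m where "m = (LEAST m. 1 / real p ^ Suc m < r)"
    obtain j where "1 / real p ^ j < r" by (rule inverse_power_less[OF r])
    moreover have "1 / real p ^ Suc j \<le> 1 / real p ^ j" using p1 by (intro frac_le power_increasing) auto
    ultimately have "1 / real p ^ Suc j < r" by linarith
    hence m: "1 / real p ^ Suc m < r" unfolding m_def by (rule LeastI)
    have le: "r \<le> 1 / real p ^ m"
    proof (cases m)
      case (Suc l)
      hence "\<not> 1 / real p ^ Suc l < r" unfolding m_def using not_less_Least lessI by metis
      thus ?thesis using Suc by simp
    qed (use assms in simp)
    have "1 / real p ^ Suc m = real p powr (- real (Suc m))"
      using p1 by (simp add: powr_minus_divide powr_realpow del: of_nat_Suc power_Suc)
    hence "real p powr s * (1 / real p ^ Suc m) powr s = real p powr (s + - real (Suc m) * s)"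
      by (simp only: powr_powr powr_add)
    also have "s + - real (Suc m) * s = - s * real m" by (simp add: algebra_simps)
    finally have "real p powr (- s * real m) = real p powr s * (1 / real p ^ Suc m) powr s" by simp
    also have "\<dots> \<le> real p powr s * r powr s"
      using m assms by (intro mult_left_mono powr_mono2) auto
    finally show ?thesis using le assms by (intro that[of m]) auto
  qed
qed

text \<open>Mass distribution with counting in place of a measure: compactness replaces a countable
  cover by finitely many balls, to which \<open>finite_cover_sum_ge\<close> applies. The critical
  exponent s = growth is included.\<close>

lemma hausdorff_measure_below_growth:
  assumes s: "0 < s" "s \<le> growth"
  shows "hausdorff_measure (carrier (Qp p)) (padic_dist p) s (point ` addresses) \<noteq> 0"
proof -
  interpret M: Metric_space "carrier (Qp p)" "padic_dist p" by (rule padic_metric_space[OF prime])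
  have p1: "1 < real p" using p_gt_1 by simp
  define A where "A = real (overlap ^ 3 * residue_count \<kappa>)"
  have A: "0 < A" using overlap_pos residue_count_pos[of \<kappa>] by (simp add: A_def)
  \<comment> \<open>Half of the 1 in \<open>finite_cover_sum_ge\<close> pays for the rounding
    errors; the other half is divided by the constants.\<close>
  define \<eta> where "\<eta> = 1 / (2 * A * real p powr s)"
  have \<eta>: "0 < \<eta>" using A p1 by (simp add: \<eta>_def)
  have main: "ennreal \<eta> \<le> (\<Sum>i. ennreal (set_diameter (padic_dist p) (U i) powr s))"
    if cover: "point ` addresses \<subseteq> (\<Union>i. U i)" and small: "\<And>i x y. x \<in> U i \<Longrightarrow> y \<in> U i \<Longrightarrow> padic_dist p x y \<le> 1"
    for U :: "nat \<Rightarrow> (nat \<Rightarrow> rat) set set"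
  proof -
    let ?r = "\<lambda>i. set_diameter (padic_dist p) (U i)"
    have r: "0 \<le> ?r i" "?r i \<le> 1" for i
      using set_diameter_nonneg[OF small] set_diameter_le[OF small] by simp_all
    \<comment> \<open>The errors are chosen to sum to 1 / (2 A) over all i.\<close>
    have "\<exists>m. ?r i \<le> 1 / real p ^ m \<and>
        real p powr (- s * real m) \<le> real p powr s * ?r i powr s + 1 / (2 * A) * (1 / 2) ^ Suc i" for i
      using exists_level[OF r s(1), of "1 / (2 * A) * (1 / 2) ^ Suc i" i] A by auto
    then obtain m where m: "\<And>i. ?r i \<le> 1 / real p ^ m i"
      "\<And>i. real p powr (- s * real (m i)) \<le> real p powr s * ?r i powr s + 1 / (2 * A) * (1 / 2) ^ Suc i"
      by metis
    define W where "W = {i. U i \<inter> point ` addresses \<noteq> {}}"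
    have "\<exists>a. a \<in> addresses \<and> point a \<in> U i" if "i \<in> W" for i using that by (auto simp: W_def)
    then obtain c where c: "\<And>i. i \<in> W \<Longrightarrow> c i \<in> addresses" "\<And>i. i \<in> W \<Longrightarrow> point (c i) \<in> U i" by metis
    \<comment> \<open>The ball is open, as compactness requires. By the gap between values of the
      distance, radius p^(1-m) still forces congruence modulo p^m.\<close>
    define V where "V i = M.mball (point (c i)) (real p / real p ^ m i)" for i
    have cover_V: "point ` addresses \<subseteq> \<Union> (V ` W)"
    proof
      fix x assume x: "x \<in> point ` addresses"
      then obtain i where i: "x \<in> U i" using cover by blast
      hence "i \<in> W" using x by (auto simp: W_def)
      moreover have "padic_dist p (point (c i)) x \<le> ?r i"
        by (rule dist_le_set_diameter[OF small c(2)[OF \<open>i \<in> W\<close>] i])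
      moreover have "1 / real p ^ m i < real p / real p ^ m i"
        using p1 by (intro divide_strict_right_mono) auto
      ultimately have "x \<in> V i"
        using m(1)[of i] c(1) x point_carrier by (auto simp: V_def)
      thus "x \<in> \<Union> (V ` W)" using \<open>i \<in> W\<close> by blast
    qed
    have open_V: "openin M.mtopology T" if "T \<in> V ` W" for T
      using that by (auto simp: V_def)
    obtain F where F: "finite F" "F \<subseteq> V ` W" "point ` addresses \<subseteq> \<Union> F"
      using compactinD[OF compactin_points[unfolded padic_topology_def] open_V cover_V] by blast
    obtain I where I: "I \<subseteq> W" "finite I" "F = V ` I"
      using finite_subset_image[OF F(1,2)] by blast
    have "\<exists>i\<in>I. addr_sum a (m i) mod int p ^ m i = addr_sum (c i) (m i) mod int p ^ m i"
      if a: "a \<in> addresses" for a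
    proof -
      obtain i where i: "i \<in> I" "point a \<in> V i" using F(3) I(3) a by blast
      have ci: "c i \<in> addresses" using i(1) I(1) c(1) by blast
      have "padic_dist p (point (c i)) (point a) < real p / real p ^ m i" using i(2) by (simp add: V_def)
      hence "int p ^ m i dvd addr_sum (c i) (m i) - addr_sum a (m i)"
        using padic_dist_frac_lim_ge[OF coherent_addr_sum[OF ci] coherent_addr_sum[OF a], of "m i"]
        unfolding point_def by linarith
      thus ?thesis using i(1) by (metis mod_eq_dvd_iff)
    qed
    from finite_cover_sum_ge[OF I(2) this]
    have "1 \<le> A * (\<Sum>i\<in>I. real p powr (- growth * real (m i)))" unfolding A_def .
    also have "\<dots> \<le> A * (\<Sum>i\<in>I. real p powr s * ?r i powr s + 1 / (2 * A) * (1 / 2) ^ Suc i)"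
    proof (intro mult_left_mono sum_mono)
      fix i
      have "real p powr (- growth * real (m i)) \<le> real p powr (- s * real (m i))"
        using p1 s by (intro powr_mono) (auto intro: mult_right_mono)
      thus "real p powr (- growth * real (m i)) \<le> real p powr s * ?r i powr s + 1 / (2 * A) * (1 / 2) ^ Suc i"
        using m(2)[of i] by linarith
    qed (use A in simp)
    also have "\<dots> = A * (real p powr s * (\<Sum>i\<in>I. ?r i powr s) + 1 / (2 * A) * (\<Sum>i\<in>I. (1 / 2) ^ Suc i))"
      by (simp only: sum.distrib sum_distrib_left)
    also have "\<dots> = A * real p powr s * (\<Sum>i\<in>I. ?r i powr s) + 1 / 2 * (\<Sum>i\<in>I. (1 / 2) ^ Suc i)"
      using A by (simp only: distrib_left mult.assoc[symmetric]) simp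
    finally have sum: "1 \<le> A * real p powr s * (\<Sum>i\<in>I. ?r i powr s) + 1 / 2 * (\<Sum>i\<in>I. (1 / 2) ^ Suc i)" .
    have "(\<Sum>i\<in>I. (1 / 2) ^ Suc i) \<le> (1 :: real)"
    proof -
      have "(\<Sum>i\<in>I. (1 / 2) ^ Suc i) \<le> (\<Sum>i. (1 / 2 :: real) ^ Suc i)"
        using power_half_series by (intro sum_le_suminf I(2)) (auto dest: sums_summable)
      also have "\<dots> = 1" using power_half_series by (rule sums_unique[symmetric])
      finally show ?thesis .
    qed
    hence "1 / 2 \<le> A * real p powr s * (\<Sum>i\<in>I. ?r i powr s)" using sum by linarith
    hence "\<eta> \<le> (\<Sum>i\<in>I. ?r i powr s)" using A p1 by (simp add: \<eta>_def field_simps)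
    hence "ennreal \<eta> \<le> ennreal (\<Sum>i\<in>I. ?r i powr s)" by (rule ennreal_leI)
    also have "\<dots> = (\<Sum>i\<in>I. ennreal (?r i powr s))" by (simp add: sum_ennreal)
    also have "\<dots> \<le> (\<Sum>i. ennreal (?r i powr s))" by (rule suminf_ennreal_ge_sum[OF I(2)])
    finally show ?thesis .
  qed
  have "ennreal \<eta> \<le> hausdorff_content (carrier (Qp p)) (padic_dist p) s 1 (point ` addresses)"
    unfolding hausdorff_content_def
  proof (rule INF_greatest, elim CollectE conjE)
    fix U :: "nat \<Rightarrow> (nat \<Rightarrow> rat) set set"
    assume "point ` addresses \<subseteq> (\<Union>i. U i)"
      "\<forall>i. U i \<subseteq> carrier (Qp p) \<and> (\<forall>x\<in>U i. \<forall>y\<in>U i. padic_dist p x y \<le> 1)"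
    thus "ennreal \<eta> \<le> (\<Sum>i. ennreal (set_diameter (padic_dist p) (U i) powr s))"
      by (intro main) simp_all
  qed
  also have "\<dots> \<le> hausdorff_measure (carrier (Qp p)) (padic_dist p) s (point ` addresses)"
    unfolding hausdorff_measure_def by (rule SUP_upper) simp
  finally show ?thesis using \<eta> by (auto simp: ennreal_eq_0_iff)
qed

lemma hausdorff_dimension_attractor:
  "hausdorff_dimension (carrier (Qp p)) (padic_dist p) (ifs_attractor p n b k d) = ereal growth"
proof -
  have "{s. 0 < s \<and> hausdorff_measure (carrier (Qp p)) (padic_dist p) s (point ` addresses) = 0} = {growth<..}"
    (is "?S = _")
  proof (intro equalityI subsetI)
    fix s assume "s \<in> ?S"
    thus "s \<in> {growth<..}"
      using hausdorff_measure_below_growth[of s] by (cases "s \<le> growth") auto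
  next
    fix s assume "s \<in> {growth<..}"
    thus "s \<in> ?S" using hausdorff_measure_above_growth[of s] growth_nonneg by simp
  qed
  moreover have "(INF s\<in>{growth<..}. ereal s) = ereal growth"
  proof (rule antisym)
    show "(INF s\<in>{growth<..}. ereal s) \<le> ereal growth"
    proof (rule ereal_le_epsilon2)
      fix e :: real assume "0 < e"
      hence "(INF s\<in>{growth<..}. ereal s) \<le> ereal (growth + e)" by (intro INF_lower) simp
      thus "(INF s\<in>{growth<..}. ereal s) \<le> ereal growth + ereal e" by simp
    qed
  qed (rule INF_greatest, simp)
  ultimately show ?thesis unfolding hausdorff_dimension_def attractor_eq by simp
qed

text \<open>Rounding down the base p logarithm of p^C N, where C is the overlap constant and N the
  number of residues of level M 2^e for M = kappa + C.\<close>

lemma growth_approx: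
  fixes e :: nat
  defines "M \<equiv> \<kappa> + overlap"
  defines "X \<equiv> residue_count (M * 2 ^ e) * p ^ overlap"
  shows "\<bar>growth - real (\<Sum>i<2 ^ e + 1. of_bool (p ^ (Suc i * M) \<le> X)) / 2 ^ e\<bar> \<le> 1 / 2 ^ e"
proof -
  define S where "S = {i \<in> {..<2 ^ e + 1}. p ^ (Suc i * M) \<le> X}"
  define u where "u = card S"
  have p1: "1 < p" "1 < real p" using p_gt_1 by simp_all
  have M: "0 < M" "overlap \<le> M" by (simp_all add: M_def overlap_pos)
  let ?N = "residue_count (M * 2 ^ e)"
  have N: "0 < ?N" by (rule residue_count_pos)
  have X: "0 < X" using N p1 by (simp add: X_def)
  have S_iff: "i \<in> S \<longleftrightarrow> i < u" for i
  proof -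
    have down: "j \<in> S" if "i \<in> S" "j \<le> i" for i j
    proof -
      have "p ^ (Suc j * M) \<le> p ^ (Suc i * M)"
        using that p1 by (intro power_increasing mult_le_mono1) auto
      thus ?thesis using that by (auto simp: S_def)
    qed
    have "\<exists>v. S = {..<v}"
    proof (cases "S = {}")
      case False
      have "finite S" by (simp add: S_def)
      hence "Max S \<in> S" "\<And>i. i \<in> S \<Longrightarrow> i \<le> Max S" using False by simp_all
      hence "S = {..<Suc (Max S)}"
        using down[of "Max S"] unfolding lessThan_Suc_atMost atMost_def by blast
      thus ?thesis by blast
    qed auto
    thus ?thesis by (auto simp: u_def)
  qed
  have u: "(\<Sum>i<2 ^ e + 1. of_bool (p ^ (Suc i * M) \<le> X)) = u"
    by (simp only: u_def S_def sum_of_bool_eq finite_lessThan Int_def mem_Collect_eq of_nat_id)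
  have low: "p ^ (u * M) \<le> X"
  proof (cases u)
    case (Suc v)
    thus ?thesis using S_iff[of v] by (simp add: S_def del: mult_Suc)
  qed (use X in simp)
  \<comment> \<open>The finite range does not truncate the count: if all 2^e + 1 indices are
    counted, the trivial bound on N already gives the inequality.\<close>
  have high: "X < p ^ (Suc u * M)"
  proof (cases "u < 2 ^ e + 1")
    case True
    thus ?thesis using S_iff[of u] by (simp add: S_def del: mult_Suc)
  next
    case False
    have "X \<le> p ^ (M * 2 ^ e) * p ^ overlap"
      unfolding X_def by (rule mult_le_mono1[OF residue_count_le])
    also have "\<dots> = p ^ (M * 2 ^ e + overlap)" by (simp add: power_add)
    also have "\<dots> < p ^ (Suc u * M)"
    proof (rule power_strict_increasing[OF _ p1(1)])
      have "M * 2 ^ e + overlap \<le> (2 ^ e + 1) * M" using M by (simp add: algebra_simps)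
      also have "\<dots> \<le> u * M" using False by (intro mult_le_mono1) simp
      also have "\<dots> < Suc u * M" using M by simp
      finally show "M * 2 ^ e + overlap < Suc u * M" .
    qed
    finally show ?thesis .
  qed
  let ?l = "log (real p) (real ?N)"
  have log_X: "log (real p) (real X) = ?l + real overlap"
    using N p1 by (simp add: X_def log_mult log_nat_power)
  have l_low: "real (u * M) \<le> ?l + real overlap"
  proof -
    have "real p ^ (u * M) \<le> real X" using low by (metis of_nat_le_iff of_nat_power)
    hence "log (real p) (real p ^ (u * M)) \<le> log (real p) (real X)"
      using X p1 by (subst log_le_cancel_iff) auto
    thus ?thesis using p1 by (simp only: log_X log_nat_power log_eq_one)
  qed
  have l_high: "?l + real overlap \<le> real (Suc u * M)"
  proof -
    have "real X \<le> real p ^ (Suc u * M)" using high by (metis less_imp_le of_nat_le_iff of_nat_power)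
    hence "log (real p) (real X) \<le> log (real p) (real p ^ (Suc u * M))"
      using X p1 by (subst log_le_cancel_iff) auto
    thus ?thesis using p1 by (simp only: log_X log_nat_power log_eq_one)
  qed
  let ?m = "real (M * 2 ^ e)"
  have m: "0 < ?m" using M by simp
  have upper: "growth \<le> (real u + 1) / 2 ^ e"
  proof -
    have "growth \<le> log (real p) (real (overlap * ?N)) / ?m" using M by (intro growth_le) simp
    also have "log (real p) (real (overlap * ?N)) = log (real p) (real overlap) + ?l"
      using N overlap_pos p1 by (simp add: log_mult)
    \<comment> \<open>The factor \<open>p ^ overlap\<close> in X exists for this estimate: it
      dominates the constant C of \<open>growth_le\<close>.\<close>
    also have "log (real p) (real overlap) \<le> real overlap"
    proof -
      have "overlap < p ^ overlap" by (rule power_gt_expt) (use p1 in simp)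
      hence "real overlap \<le> real p ^ overlap" by (metis less_imp_le of_nat_le_iff of_nat_power)
      hence "log (real p) (real overlap) \<le> log (real p) (real p ^ overlap)"
        using overlap_pos p1 by (subst log_le_cancel_iff) auto
      thus ?thesis using p1 by (simp only: log_nat_power log_eq_one)
    qed
    finally have "growth \<le> (real overlap + ?l) / ?m" using m by (simp add: divide_right_mono)
    also have "\<dots> \<le> real (Suc u * M) / ?m" using l_high m by (intro divide_right_mono) auto
    also have "\<dots> = (real u + 1) / 2 ^ e" using M by (simp add: field_simps)
    finally show ?thesis .
  qed
  have lower: "(real u - 1) / 2 ^ e \<le> growth"
  proof -
    have l_le: "?l \<le> ?m"
    proof -
      have "real ?N \<le> real p ^ (M * 2 ^ e)" using residue_count_le by (metis of_nat_le_iff of_nat_power)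
      hence "?l \<le> log (real p) (real p ^ (M * 2 ^ e))" using N p1 by (subst log_le_cancel_iff) auto
      thus ?thesis using p1 by (simp only: log_nat_power log_eq_one)
    qed
    \<comment> \<open>The losses \<kappa> and C add up to M, exactly one unit of the count; this
      dictates the choice of M.\<close>
    have "real (u * M) - real \<kappa> - real overlap = (real u - 1) * real M"
      by (simp add: M_def algebra_simps)
    hence "(real u - 1) / 2 ^ e = (real (u * M) - real \<kappa> - real overlap) / ?m"
      using M by simp
    also have "\<dots> \<le> (?l - real \<kappa>) / ?m" using l_low m by (intro divide_right_mono) auto
    \<comment> \<open>The subtracted \<kappa> is traded for the larger denominator of
      \<open>growth_ge\<close>, using that \<open>?l\<close> is at most \<open>?m\<close>.\<close>
    also have "\<dots> \<le> ?l / (?m + real \<kappa>)"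
    proof -
      have "(?l - real \<kappa>) * (?m + real \<kappa>) = ?l * ?m - real \<kappa> * (?m - ?l) - real \<kappa> * real \<kappa>"
        by (simp add: algebra_simps)
      also have "\<dots> \<le> ?l * ?m"
        using mult_nonneg_nonneg[of "real \<kappa>" "?m - ?l"] mult_nonneg_nonneg[of "real \<kappa>" "real \<kappa>"] l_le
        by linarith
      finally have le: "(?l - real \<kappa>) * (?m + real \<kappa>) \<le> ?l * ?m" .
      have "0 < ?m + real \<kappa>" using m by linarith
      thus ?thesis
        using le by (simp only: pos_divide_le_eq[OF m] times_divide_eq_left pos_le_divide_eq)
    qed
    also have "\<dots> \<le> growth" using growth_ge[of "M * 2 ^ e"] by simp
    finally show ?thesis .
  qed
  show ?thesis unfolding u using upper lower by (simp only: add_divide_distrib diff_divide_distrib)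
qed

end

section \<open>Correctness of the approximation\<close>

context ifs_system
begin

abbreviation (input) num :: "nat \<Rightarrow> int" where "num i \<equiv> fst (quotient_of (d i))"
abbreviation (input) den :: "nat \<Rightarrow> int" where "den i \<equiv> snd (quotient_of (d i))"

definition code :: nat where "code = ifs_code p n b k d"

definition entry :: "nat \<Rightarrow> nat" where
  "entry i = prod_encode (b i, prod_encode (k i, rat_code (d i)))"

lemma code_eq: "code = list_encode (p # map entry [1..<Suc n])"
proof -
  have "entry = (\<lambda>i. prod_encode (b i, prod_encode (k i, rat_code (d i))))"
    by (rule ext) (rule entry_def)
  thus ?thesis by (simp only: code_def ifs_code_def)
qed

lemma entry_code_code: "i \<in> {1..n} \<Longrightarrow> entry_code code i = entry i"
  unfolding code_eq by (subst entry_code_list_encode) (auto simp: nth_Cons' nth_append simp del: upt_Suc)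

lemma code_prime_code: "code_prime code = p"
  unfolding code_prime_def code_eq by (subst entry_code_list_encode) simp_all

lemma code_card_code: "code_card code = n"
  unfolding code_eq code_card_list_encode by simp

lemma code_entries:
  assumes "i \<in> {1..n}"
  shows "code_sign code i = b i" "code_exp code i = k i"
    and "code_num code i = int_encode (num i)" "code_den code i = nat (den i)"
  using quotient_of_denom_pos'[of "d i"]
  by (simp_all add: code_sign_def code_exp_def code_num_def code_den_def entry_code_code[OF assms]
      entry_def rat_code_def int_encode_def sum_encode_def)

lemma entry_le_code: "i \<in> {1..n} \<Longrightarrow> entry i \<le> code"
  unfolding code_eq by (rule set_le_list_encode) (auto simp del: upt_Suc)

text \<open>Pairing dominates its components, so the code itself is a computable bound for the
  exponents.\<close>

lemma k_le_code: "i \<in> {1..n} \<Longrightarrow> k i \<le> code"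
  using le_prod_encode_1[of "k i" "rat_code (d i)"]
    le_prod_encode_2[of "prod_encode (k i, rat_code (d i))" "b i"] entry_le_code[of i]
  by (simp add: entry_def)

lemma num_le_code: "i \<in> {1..n} \<Longrightarrow> \<bar>num i\<bar> \<le> int code"
proof -
  assume i: "i \<in> {1..n}"
  have "\<bar>num i\<bar> \<le> int (int_encode (num i))" by (auto simp: int_encode_def sum_encode_def)
  moreover have "int_encode (num i) \<le> rat_code (d i)"
    unfolding rat_code_def by (rule le_prod_encode_1)
  ultimately show ?thesis
    using le_prod_encode_2[of "rat_code (d i)" "k i"]
      le_prod_encode_2[of "prod_encode (k i, rat_code (d i))" "b i"] entry_le_code[OF i]
    by (simp add: entry_def)
qed

lemma code_common_den_code: "code_common_den code = nat common_den"
proof -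
  have "int (code_common_den code) = (\<Prod>i<n. int (code_den code (Suc i)))"
    by (simp add: code_common_den_def code_card_code)
  also have "\<dots> = (\<Prod>i<n. den (Suc i))"
  proof (rule prod.cong)
    fix i assume "i \<in> {..<n}"
    thus "int (code_den code (Suc i)) = den (Suc i)"
      using code_entries(4)[of "Suc i"] quotient_of_denom_pos'[of "d (Suc i)"] by simp
  qed simp
  also have "\<dots> = common_den"
    unfolding common_den_def by (rule prod.reindex_bij_witness[of _ "\<lambda>i. i - 1" Suc]) auto
  finally show ?thesis by simp
qed

sublocale coded: bounded_ifs_system p n b k d code "nat common_den * code"
proof
  fix i assume i: "i \<in> {1..n}"
  show "k i \<le> code" by (rule k_le_code[OF i])
  have "0 \<le> common_den div den i" "common_den div den i \<le> common_den"
    using common_den_pos quotient_of_denom_pos'[of "d i"] zdiv_mono2[of common_den 1 "den i"]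
    by (simp_all add: pos_imp_zdiv_nonneg_iff)
  hence "\<bar>shift i\<bar> \<le> int code * common_den"
    unfolding shift_def abs_mult using num_le_code[OF i] by (intro mult_mono) auto
  thus "\<bar>shift i\<bar> \<le> int (nat common_den * code)" using common_den_pos by (simp add: mult.commute)
qed

lemma code_const_code: "code_const code = coded.overlap"
  by (simp add: code_const_def coded.overlap_def code_common_den_code code_prime_code)

lemma code_shift_mod:
  assumes i: "i \<in> {1..n}" and P: "0 < P"
  shows "int (code_shift code P i) mod int P = shift i mod int P"
proof -
  have den: "0 < den i" by (rule quotient_of_denom_pos')
  have q: "int (nat common_den div nat (den i)) = common_den div den i"
    using common_den_pos den by (simp add: zdiv_int)
  show ?thesis
  proof (cases "0 \<le> num i")
    case True
    hence "int_encode (num i) = 2 * nat (num i)" by (simp add: int_encode_def sum_encode_def)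
    hence "int (code_shift code P i) = shift i"
      using True q by (simp add: code_shift_def code_entries[OF i] code_common_den_code shift_def)
    thus ?thesis by simp
  next
    case False
    hence enc: "int_encode (num i) = Suc (2 * nat (- num i - 1))"
      by (simp add: int_encode_def sum_encode_def)
    have "code_shift code P i = (P - Suc 0) * (nat (- num i - 1) + 1) * (nat common_den div nat (den i))"
      by (simp add: code_shift_def code_entries[OF i] code_common_den_code enc)
    hence "int (code_shift code P i) = (int P - 1) * (- num i) * (common_den div den i)"
    proof -
      have "int (P - Suc 0) = int P - 1" "int (nat (- num i - 1)) + 1 = - num i"
        using P False by simp_all
      thus ?thesis using q \<open>code_shift code P i = _\<close> by (simp only: of_nat_mult of_nat_add of_nat_1)
    qed
    \<comment> \<open>P - 1 acts as -1: the difference from the true translation is a multiple of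
      P.\<close>
    also have "\<dots> = shift i + int P * ((- num i) * (common_den div den i))"
      by (simp add: shift_def algebra_simps)
    finally show ?thesis by (simp only: mod_mult_self2)
  qed
qed

lemma code_ratio_mod:
  assumes i: "i \<in> {1..n}" and P: "0 < P"
  shows "int (code_ratio code P i) mod int P = ((-1) ^ b i * int p ^ k i) mod int P"
proof (cases "b i = 0")
  case True
  thus ?thesis by (simp add: code_ratio_def code_entries[OF i] code_prime_code)
next
  case False
  hence b: "b i = 1" using b_cases[OF i] by simp
  have "int (code_ratio code P i) = (int P - 1) * int p ^ k i"
    using P by (simp add: code_ratio_def code_entries[OF i] code_prime_code b of_nat_diff)
  also have "\<dots> = (-1) ^ b i * int p ^ k i + int P * int p ^ k i"
    by (simp add: b algebra_simps)
  finally show ?thesis by (simp only: mod_mult_self2)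
qed

text \<open>The recursion of \<open>code_sum\<close> works from the innermost map outwards, so each
  digit prepends a letter. The constant letter 1 after the first j entries only makes the address
  infinite; the first j terms ignore it.\<close>

fun word_address :: "nat \<Rightarrow> nat \<Rightarrow> nat \<Rightarrow> nat" where
  "word_address w 0 = (\<lambda>_. 1)"
| "word_address w (Suc j) = case_nat (Suc (w div n ^ j mod n)) (word_address w j)"

lemma word_letter: "Suc (x mod n) \<in> {1..n}"
  using n_ge_1 by (simp add: Suc_le_eq)

lemma word_address_in: "word_address w j \<in> addresses"
proof (induction j)
  case 0
  show ?case using n_ge_1 by (simp add: addresses_def)
next
  case (Suc j)
  show ?case unfolding word_address.simps by (rule addresses_case_nat[OF word_letter Suc])
qed

lemma code_sum_eq:
  assumes P: "0 < P"
  shows "int (code_sum code P w j) = addr_sum (word_address w j) j mod int P"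
proof (induction j)
  case (Suc j)
  let ?i = "Suc (w div n ^ j mod n)"
  let ?S = "code_sum code P w j"
  have i: "?i \<in> {1..n}" by (rule word_letter)
  have "int (code_sum code P w (Suc j)) =
      (int (code_shift code P ?i) + int (code_ratio code P ?i) * int ?S) mod int P"
    by (simp add: code_sum_def code_card_code zmod_int)
  also have "\<dots> = (shift ?i + ((-1) ^ b ?i * int p ^ k ?i) * addr_sum (word_address w j) j) mod int P"
  proof (intro mod_add_cong mod_mult_cong code_shift_mod[OF i P] code_ratio_mod[OF i P])
    show "int ?S mod int P = addr_sum (word_address w j) j mod int P" using Suc by simp
  qed
  finally show ?case by (simp only: word_address.simps addr_sum_case_nat)
qed (use P in \<open>simp add: code_sum_def\<close>)

lemma word_address_cong:
  "(\<And>i. i < j \<Longrightarrow> w div n ^ i mod n = w' div n ^ i mod n) \<Longrightarrow> word_address w j = word_address w' j"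
  by (induction j) auto

lemma word_address_surj:
  assumes "a \<in> addresses"
  shows "\<exists>w<n ^ j. \<forall>i<j. word_address w j i = a i"
  using assms
proof (induction j arbitrary: a)
  case (Suc j)
  have "(\<lambda>i. a (1 + i)) \<in> addresses" by (rule addresses_shift[OF Suc.prems])
  then obtain w' where w': "w' < n ^ j" "\<And>i. i < j \<Longrightarrow> word_address w' j i = a (1 + i)"
    using Suc.IH by blast
  define t where "t = a 0 - 1"
  have t: "t < n" "a 0 = Suc t" using addressesD[OF Suc.prems, of 0] by (auto simp: t_def)
  \<comment> \<open>The first letter is the leading base n digit, because it is prepended
    last.\<close>
  define w where "w = w' + t * n ^ j"
  have pos: "0 < n ^ i" for i using n_ge_1 by simp
  have "w < n ^ j + t * n ^ j" using w'(1) by (simp add: w_def)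
  also have "\<dots> = Suc t * n ^ j" by simp
  also have "\<dots> \<le> n * n ^ j" using t(1) by (intro mult_le_mono1) simp
  finally have "w < n ^ Suc j" by simp
  moreover have "word_address w (Suc j) i = a i" if i: "i < Suc j" for i
  proof -
    have "w div n ^ j mod n = t" using w'(1) t(1) pos[of j] by (simp add: w_def)
    moreover have "word_address w j = word_address w' j"
    proof (rule word_address_cong)
      fix i assume i: "i < j"
      hence "n ^ j = n ^ i * (n * n ^ (j - Suc i))"
        by (simp flip: power_add power_Suc)
      hence "w = w' + n ^ i * (n * (n ^ (j - Suc i) * t))" by (simp add: w_def mult_ac)
      hence "w div n ^ i = w' div n ^ i + n * (n ^ (j - Suc i) * t)"
        using pos[of i] by (simp only: div_mult_self2 neq0_conv)
      thus "w div n ^ i mod n = w' div n ^ i mod n" by (simp only: mod_mult_self2)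
    qed
    ultimately show ?thesis using t(2) w'(2) i by (cases i) auto
  qed
  ultimately show ?case by blast
qed simp

text \<open>Only the first m letters enter \<open>addr_sum a m\<close>, so the words below n^m
  produce all residues of level m.\<close>

lemma code_count_code: "code_count code m = residue_count m"
proof -
  let ?R = "{r. r < p ^ m \<and> (\<exists>w<n ^ m. code_sum code (p ^ m) w m = r)}"
  have P: "0 < p ^ m" using p_gt_1 by simp
  have "(1 \<le> (\<Sum>w<n ^ m. of_bool (code_sum code (p ^ m) w m = r) :: nat)) \<longleftrightarrow>
      (\<exists>w<n ^ m. code_sum code (p ^ m) w m = r)" for r
    by (simp add: sum_of_bool_eq card_gt_0_iff Suc_le_eq) blast
  hence "code_count code m = (\<Sum>r<p ^ m. of_bool (\<exists>w<n ^ m. code_sum code (p ^ m) w m = r))"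
    by (simp only: code_count_def code_prime_code code_card_code)
  also have "\<dots> = card ?R"
    by (simp only: sum_of_bool_eq finite_lessThan Int_def lessThan_iff mem_Collect_eq of_nat_id)
  also have "\<dots> = card (int ` ?R)" by (rule card_image[symmetric]) simp
  also have "int ` ?R = residues m"
  proof (intro equalityI subsetI)
    fix x assume "x \<in> int ` ?R"
    then obtain w where "x = int (code_sum code (p ^ m) w m)" by blast
    hence "x = addr_sum (word_address w m) m mod int p ^ m" using code_sum_eq[OF P] by simp
    thus "x \<in> residues m" using word_address_in by (auto simp: residues_def)
  next
    fix x assume "x \<in> residues m"
    then obtain a where a: "a \<in> addresses" "x = addr_sum a m mod int p ^ m" by (auto simp: residues_def)
    obtain w where w: "w < n ^ m" "\<And>i. i < m \<Longrightarrow> word_address w m i = a i"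
      using word_address_surj[OF a(1)] by blast
    have "addr_sum (word_address w m) m = addr_sum a m" by (rule addr_sum_cong(3)) (rule w(2))
    hence x: "x = int (code_sum code (p ^ m) w m)" using a(2) code_sum_eq[OF P] by simp
    moreover have "x < int p ^ m" unfolding a(2) using P by simp
    ultimately have "code_sum code (p ^ m) w m < p ^ m" by (metis of_nat_less_iff of_nat_power)
    thus "x \<in> int ` ?R" using x w(1) by blast
  qed
  finally show ?thesis by (simp add: residue_count_def)
qed

lemma code_approx_code: "\<bar>coded.growth - real (code_approx code e) / 2 ^ e\<bar> \<le> 1 / 2 ^ e"
  using coded.growth_approx[of e]
  by (simp only: code_approx_def code_prime_code code_const_code code_count_code)

end

lemma hausdorff_dimension_computable:
  "computable_from
     {(ifs_code p n b k d,
       hausdorff_dimension (carrier (Qp p)) (padic_dist p) (ifs_attractor p n b k d))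
      | p n b k d. ifs_data p n b k d}"
proof -
  \<comment> \<open>The factor 2 encodes the sign: \<open>int_decode (2 * x)\<close> is the
    nonnegative integer x.\<close>
  have "recursive_fun 2 (\<lambda>xs. 2 * code_approx (xs ! 0) (xs ! 1))"
    by (intro recursive_fun_mult recursive_fun_const recursive_fun_code_approx)
  then obtain f where f: "general_recursive 2 f"
    "\<And>xs. length xs = 2 \<Longrightarrow> f xs = 2 * code_approx (xs ! 0) (xs ! 1)"
    unfolding recursive_fun_def by blast
  have approx: "\<bar>hausdorff_dimension (carrier (Qp p)) (padic_dist p) (ifs_attractor p n b k d) -
      ereal (real_of_int (int_decode (f [ifs_code p n b k d, m])) / 2 ^ m)\<bar> \<le> ereal (1 / 2 ^ m)"
    if "ifs_data p n b k d" for p n b k d m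
  proof -
    interpret ifs_system p n b k d by unfold_locales (rule that)
    have "int_decode (f [ifs_code p n b k d, m]) = int (code_approx code m)"
      by (simp add: f(2) code_def int_decode_def sum_decode_def)
    thus ?thesis using code_approx_code[of m] by (simp add: coded.hausdorff_dimension_attractor)
  qed
  show ?thesis unfolding computable_from_def
    by (intro exI[of _ f] conjI f(1)) (use approx in auto)
qed

theorem theorem3p3:
  shows "(\<forall>p n b k d. ifs_data p n b k d \<longrightarrow>
            (\<exists>T :: (nat, nat, nat) transducer.
               finite_transducer {1..n} {0..<p} T \<and>
               (\<forall>a. (\<forall>j. a j \<in> {1..n}) \<longrightarrow>
                  (\<exists>x\<in>ifs_attractor p n b k d. \<exists>c.
                     address_value p b k d a x \<and> padic_expansion p c x \<and> transduces T a c))) \<and>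
            (\<exists>M :: (nat, nat) automaton.
               finite_automaton {0..<p} M \<and>
               recognized_words M = {c. \<exists>x\<in>ifs_attractor p n b k d. padic_expansion p c x})) \<and>
         computable_from
           {(ifs_code p n b k d,
             hausdorff_dimension (carrier (Qp p)) (padic_dist p) (ifs_attractor p n b k d))
            | p n b k d. ifs_data p n b k d}"
proof (intro conjI allI impI)
  fix p n b k d assume "ifs_data p n b k d"
  then interpret ifs_system p n b k d by unfold_locales
  show "\<exists>T :: (nat, nat, nat) transducer.
      finite_transducer {1..n} {0..<p} T \<and>
      (\<forall>a. (\<forall>j. a j \<in> {1..n}) \<longrightarrow>
        (\<exists>x\<in>ifs_attractor p n b k d. \<exists>c.
          address_value p b k d a x \<and> padic_expansion p c x \<and> transduces T a c))"
    using finite_ifs_transducer transducer_correct by (intro exI[of _ ifs_transducer]) simp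
  show "\<exists>M :: (nat, nat) automaton.
      finite_automaton {0..<p} M \<and>
      recognized_words M = {c. \<exists>x\<in>ifs_attractor p n b k d. padic_expansion p c x}"
    using finite_ifs_automaton recognized_words_eq by blast
qed (rule hausdorff_dimension_computable)

end
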